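(* Let $\Bbbk$ be a field and let $H$ be a weak bialgebra over $\Bbbk$. Let $\mathcal{A}^H$ be the category of right $H$-comodule algebras, and let $\mathsf{Alg}(\mathcal{M}^H)$ be the category of algebras in the monoidal category $\mathcal{M}^H$ of right $H$-comodules. Then there is an isomorphism of categories $$\mathcal{A}^H \cong \mathsf{Alg}(\mathcal{M}^H).$$
   Context: All structures are $\Bbbk$-linear, $\otimes=\otimes_\Bbbk$, (co)algebras are (co)associative and (co)unital; Sweedler notation $\Delta(h)=h_1\otimes h_2$ and, for a right comodule $M$, $\rho_M(m)=m_{[0]}\otimes m_{[1]}$ is used. **Weak bialgebra.** A tuple $(H,m,u,\Delta,\varepsilon)$ with $(H,m,u)$ a $\Bbbk$-algebra, $(H,\Delta,\varepsilon)$ a $\Bbbk$-coalgebra, such that for all $a,b,c\in H$: $\Delta(ab)=\Delta(a)\Delta(b)$; $\varepsilon(abc)=\varepsilon(ab_1)\varepsilon(b_2c)=\varepsilon(ab_2)\varepsilon(b_1c)$; and $(\Delta\otimes\mathrm{Id})\Delta(1)=(\Delta(1)\otimes 1)(1\otimes\Delta(1))=(1\otimes\Delta(1))(\Delta(1)\otimes 1)$. Define $\varepsilon_s(x)=1_1\,\varepsilon(x1_2)$ and $\varepsilon_t(x)=\varepsilon(1_1x)\,1_2$, and put $H_s=\varepsilon_s(H)$, $H_t=\varepsilon_t(H)$ (these are subalgebras of $H$). **Right $H$-comodule.** A right comodule over the coalgebra $(H,\Delta,\varepsilon)$. **The monoidal category $\mathcal{M}^H$.** Objects: right $H$-comodules;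 morphisms: $H$-comodule maps. The monoidal product of $M,N$ is the subspace $M\,\bar\otimes\, N\subseteq M\otimes N$ of elements fixed by the linear (idempotent) map $m\otimes n\mapsto \varepsilon(m_{[1]}n_{[1]})\,m_{[0]}\otimes n_{[0]}$, with coaction induced by $m\otimes n\mapsto m_{[0]}\otimes n_{[0]}\otimes m_{[1]}n_{[1]}$; $f\,\bar\otimes\, g$ is the restriction of $f\otimes g$. The unit object is $H_s$ with coaction $\Delta|_{H_s}: H_s\to H_s\otimes H$. The associativity constraint is the one of vector spaces. The unit isomorphisms are $l_M:H_s\,\bar\otimes\, M\to M$, $x\,\bar\otimes\, m\mapsto\varepsilon(xm_{[1]})m_{[0]}$, and $r_M:M\,\bar\otimes\, H_s\to M$, $m\,\bar\otimes\, x\mapsto\varepsilon(m_{[1]}x)m_{[0]}$. **$\mathsf{Alg}(\mathcal{M}^H)$.** Objects: triples $(A,\bar m:A\,\bar\otimes\, A\to A,\ \bar u:H_s\to A)$ with $A\in\mathcal{M}^H$ and $\bar m,\bar u$ morphisms of $\mathcal{M}^H$ satisfying associativity and unitality with respect to the monoidal structure: $\bar m(\bar m\,\bar\otimes\,\mathrm{id})=\bar m(\mathrm{id}\,\bar\otimes\,\bar m)$, $\bar m(\bar u\,\bar\otimes\,\mathrm{id})=l_A$, $\bar m(\mathrm{id}\,\bar\otimes\,\bar u)=r_A$. Morphisms: morphisms of $\mathcal{M}^H$ compatible with $\bar m$ and $\bar u$. **$\mathcal{A}^H$.** Objects: $\Bbbk$-algebras $A$ that are right $H$-comodules via $\rho_A:A\to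 A\otimes H$, such that $(ab)_{[0]}\otimes(ab)_{[1]}=a_{[0]}b_{[0]}\otimes a_{[1]}b_{[1]}$ for all $a,b\in A$, and $\rho_A(1_A)\in A\otimes H_t$. Morphisms: $\Bbbk$-algebra maps that are also $H$-comodule maps. *)

theory Defs
  imports "HOL-Algebra.Module" "HOL-Algebra.AbelCoset" "HOL-Library.FuncSet"
begin

section \<open>Vector spaces, linear maps and tensor products\<close>

text \<open>
  A vector space is a record satisfying \<^term>\<open>module K M\<close> for a field \<open>K\<close>; only the fields
  \<open>carrier\<close>, \<open>zero\<close>, \<open>add\<close> and \<open>smult\<close> matter, the fields \<open>mult\<close> and \<open>one\<close> carry no information.
  Isomorphism of categories involves equality of objects, so the values of these records that have
  no mathematical meaning (\<open>mult\<close>, \<open>one\<close>, and operations outside the carrier) are fixed to be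
  \<^term>\<open>undefined\<close>.
\<close>

definition make_space :: "('k, 'z) ring_scheme \<Rightarrow> 'a set \<Rightarrow> 'a \<Rightarrow> ('a \<Rightarrow> 'a \<Rightarrow> 'a) \<Rightarrow>
    ('k \<Rightarrow> 'a \<Rightarrow> 'a) \<Rightarrow> ('k, 'a) module" where
  "make_space K C z p s =
     \<lparr>carrier = C, mult = undefined, one = undefined, zero = z,
      add = (\<lambda>x\<in>C. \<lambda>y\<in>C. p x y), smult = (\<lambda>a\<in>carrier K. \<lambda>x\<in>C. s a x)\<rparr>"

definition subspace_module :: "('k, 'z) ring_scheme \<Rightarrow> ('k, 'a, 'm) module_scheme \<Rightarrow> 'a set \<Rightarrow>
    ('k, 'a) module" where
  "subspace_module K M S = make_space K S \<zero>\<^bsub>M\<^esub> (add M) (smult M)"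

definition normal_space :: "('k, 'z) ring_scheme \<Rightarrow> ('k, 'a, 'm) module_scheme \<Rightarrow> bool" where
  "normal_space K M \<longleftrightarrow>
     add M \<in> carrier M \<rightarrow>\<^sub>E carrier M \<rightarrow>\<^sub>E carrier M \<and>
     smult M \<in> carrier K \<rightarrow>\<^sub>E carrier M \<rightarrow>\<^sub>E carrier M"

definition linear_map :: "('k, 'z) ring_scheme \<Rightarrow> ('k, 'a, 'm) module_scheme \<Rightarrow>
    ('k, 'b, 'n) module_scheme \<Rightarrow> ('a \<Rightarrow> 'b) \<Rightarrow> bool" where
  "linear_map K M N f \<longleftrightarrow>
     f \<in> carrier M \<rightarrow> carrier N \<and>
     (\<forall>x\<in>carrier M. \<forall>y\<in>carrier M. f (x \<oplus>\<^bsub>M\<^esub> y) = f x \<oplus>\<^bsub>N\<^esub> f y) \<and>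
     (\<forall>a\<in>carrier K. \<forall>x\<in>carrier M. f (a \<odot>\<^bsub>M\<^esub> x) = a \<odot>\<^bsub>N\<^esub> f x)"

definition base_module :: "('k, 'z) ring_scheme \<Rightarrow> ('k, 'k) module" where
  "base_module K =
     \<lparr>carrier = carrier K, mult = mult K, one = \<one>\<^bsub>K\<^esub>, zero = \<zero>\<^bsub>K\<^esub>, add = add K, smult = mult K\<rparr>"

definition free_module :: "('k, 'z) ring_scheme \<Rightarrow> 'x set \<Rightarrow> ('k, 'x \<Rightarrow> 'k) module" where
  "free_module K X =
     \<lparr>carrier = {\<phi>. range \<phi> \<subseteq> carrier K \<and> finite {x. \<phi> x \<noteq> \<zero>\<^bsub>K\<^esub>} \<and> {x. \<phi> x \<noteq> \<zero>\<^bsub>K\<^esub>} \<subseteq> X},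
      mult = undefined, one = undefined, zero = (\<lambda>x. \<zero>\<^bsub>K\<^esub>),
      add = (\<lambda>\<phi> \<psi> x. \<phi> x \<oplus>\<^bsub>K\<^esub> \<psi> x), smult = (\<lambda>a \<phi> x. a \<otimes>\<^bsub>K\<^esub> \<phi> x)\<rparr>"

definition free_gen :: "('k, 'z) ring_scheme \<Rightarrow> 'x \<Rightarrow> 'x \<Rightarrow> 'k" where
  "free_gen K x = (\<lambda>y. if y = x then \<one>\<^bsub>K\<^esub> else \<zero>\<^bsub>K\<^esub>)"

definition tensor_relations :: "('k, 'z) ring_scheme \<Rightarrow> ('k, 'a, 'm) module_scheme \<Rightarrow>
    ('k, 'b, 'n) module_scheme \<Rightarrow> ('a \<times> 'b \<Rightarrow> 'k) set" where
  "tensor_relations K M N =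
     (let F = free_module K (carrier M \<times> carrier N); \<delta> = (\<lambda>m n. free_gen K (m, n))
      in \<Inter>{S. submodule S K F \<and>
        {\<delta> (m \<oplus>\<^bsub>M\<^esub> m') n \<ominus>\<^bsub>F\<^esub> (\<delta> m n \<oplus>\<^bsub>F\<^esub> \<delta> m' n) | m m' n.
            m \<in> carrier M \<and> m' \<in> carrier M \<and> n \<in> carrier N} \<union>
         {\<delta> m (n \<oplus>\<^bsub>N\<^esub> n') \<ominus>\<^bsub>F\<^esub> (\<delta> m n \<oplus>\<^bsub>F\<^esub> \<delta> m n') | m n n'.
            m \<in> carrier M \<and> n \<in> carrier N \<and> n' \<in> carrier N} \<union>
         {\<delta> (a \<odot>\<^bsub>M\<^esub> m) n \<ominus>\<^bsub>F\<^esub> a \<odot>\<^bsub>F\<^esub> \<delta> m n | a m n.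
            a \<in> carrier K \<and> m \<in> carrier M \<and> n \<in> carrier N} \<union>
         {\<delta> m (a \<odot>\<^bsub>N\<^esub> n) \<ominus>\<^bsub>F\<^esub> a \<odot>\<^bsub>F\<^esub> \<delta> m n | a m n.
            a \<in> carrier K \<and> m \<in> carrier M \<and> n \<in> carrier N} \<subseteq> S})"

definition tensor :: "('k, 'z) ring_scheme \<Rightarrow> ('k, 'a, 'm) module_scheme \<Rightarrow>
    ('k, 'b, 'n) module_scheme \<Rightarrow> ('k, ('a \<times> 'b \<Rightarrow> 'k) set) module" where
  "tensor K M N =
     (let F = free_module K (carrier M \<times> carrier N); S = tensor_relations K M N
      in make_space K (a_rcosets\<^bsub>F\<^esub> S) S (set_add F) (\<lambda>a X. \<Union>\<phi>\<in>X. S +>\<^bsub>F\<^esub> (a \<odot>\<^bsub>F\<^esub> \<phi>)))"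

definition tens :: "('k, 'z) ring_scheme \<Rightarrow> ('k, 'a, 'm) module_scheme \<Rightarrow>
    ('k, 'b, 'n) module_scheme \<Rightarrow> 'a \<Rightarrow> 'b \<Rightarrow> ('a \<times> 'b \<Rightarrow> 'k) set" where
  "tens K M N m n =
     tensor_relations K M N +>\<^bsub>free_module K (carrier M \<times> carrier N)\<^esub> free_gen K (m, n)"

text \<open>
  For \<open>\<beta>\<close> bilinear with values in \<open>P\<close>, \<open>tensor_lift K P \<beta>\<close> is the induced linear map
  \<open>m \<otimes> n \<mapsto> \<beta> m n\<close>: the sum below takes the same value at all representatives of a coset.
  With it, Sweedler notation \<open>\<beta> m\<^sub>0 m\<^sub>1\<close> (implicit summation) is rendered as
  \<open>tensor_lift K P (\<lambda>m\<^sub>0 m\<^sub>1. \<beta> m\<^sub>0 m\<^sub>1) (\<rho> m)\<close>.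
\<close>

definition tensor_lift :: "('k, 'z) ring_scheme \<Rightarrow> ('k, 'c, 'p) module_scheme \<Rightarrow>
    ('a \<Rightarrow> 'b \<Rightarrow> 'c) \<Rightarrow> ('a \<times> 'b \<Rightarrow> 'k) set \<Rightarrow> 'c" where
  "tensor_lift K P \<beta> X =
     the_elem ((\<lambda>\<phi>. \<Oplus>\<^bsub>P\<^esub>q\<in>{q. \<phi> q \<noteq> \<zero>\<^bsub>K\<^esub>}. \<phi> q \<odot>\<^bsub>P\<^esub> \<beta> (fst q) (snd q)) ` X)"

text \<open>\<open>tensor_map K M' N' f g\<close> is \<open>f \<otimes> g\<close> for linear maps \<open>f\<close> into \<open>M'\<close> and \<open>g\<close> into \<open>N'\<close>.
  For \<open>f\<close> and \<open>g\<close> the identity functions it is the map induced by inclusions of subspaces.\<close>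

definition tensor_map :: "('k, 'z) ring_scheme \<Rightarrow> ('k, 'c, 'm) module_scheme \<Rightarrow>
    ('k, 'd, 'n) module_scheme \<Rightarrow> ('a \<Rightarrow> 'c) \<Rightarrow> ('b \<Rightarrow> 'd) \<Rightarrow>
    ('a \<times> 'b \<Rightarrow> 'k) set \<Rightarrow> ('c \<times> 'd \<Rightarrow> 'k) set" where
  "tensor_map K M' N' f g = tensor_lift K (tensor K M' N') (\<lambda>m n. tens K M' N' (f m) (g n))"

definition tensor_assoc :: "('k, 'z) ring_scheme \<Rightarrow> ('k, 'a, 'm) module_scheme \<Rightarrow>
    ('k, 'b, 'n) module_scheme \<Rightarrow> ('k, 'c, 'p) module_scheme \<Rightarrow>
    (('a \<times> 'b \<Rightarrow> 'k) set \<times> 'c \<Rightarrow> 'k) set \<Rightarrow> ('a \<times> ('b \<times> 'c \<Rightarrow> 'k) set \<Rightarrow> 'k) set" where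
  "tensor_assoc K M N P =
     (let T = tensor K M (tensor K N P)
      in tensor_lift K T (\<lambda>t p. tensor_lift K T
           (\<lambda>m n. tens K M (tensor K N P) m (tens K N P n p)) t))"

text \<open>For a subspace \<open>S\<close> of \<open>M\<close>, regard an element of \<open>M \<otimes> N\<close> that comes from \<open>S \<otimes> N\<close>
  as an element of \<open>S \<otimes> N\<close> (the map \<open>S \<otimes> N \<rightarrow> M \<otimes> N\<close> being injective over a field).\<close>

definition corestrict :: "('k, 'z) ring_scheme \<Rightarrow> ('k, 'a, 'm) module_scheme \<Rightarrow> 'a set \<Rightarrow>
    ('k, 'b, 'n) module_scheme \<Rightarrow> ('a \<times> 'b \<Rightarrow> 'k) set \<Rightarrow> ('a \<times> 'b \<Rightarrow> 'k) set" where
  "corestrict K M S N =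
     inv_into (carrier (tensor K (subspace_module K M S) N)) (tensor_map K M N (\<lambda>x. x) (\<lambda>x. x))"


section \<open>Weak bialgebras\<close>

text \<open>The library's \<^locale>\<open>algebra\<close> is restricted to commutative rings.\<close>

locale k_algebra = module K A + ring A for K and A (structure) +
  assumes smult_mult_left:
      "\<lbrakk>a \<in> carrier K; x \<in> carrier A; y \<in> carrier A\<rbrakk> \<Longrightarrow> (a \<odot> x) \<otimes> y = a \<odot> (x \<otimes> y)"
    and smult_mult_right:
      "\<lbrakk>a \<in> carrier K; x \<in> carrier A; y \<in> carrier A\<rbrakk> \<Longrightarrow> x \<otimes> (a \<odot> y) = a \<odot> (x \<otimes> y)"

definition tensor_algebra :: "('k, 'z) ring_scheme \<Rightarrow> ('k, 'a, 'm) module_scheme \<Rightarrow>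
    ('k, 'b, 'n) module_scheme \<Rightarrow> ('k, ('a \<times> 'b \<Rightarrow> 'k) set) module" where
  "tensor_algebra K A B =
     (let T = tensor K A B
      in T\<lparr>mult := (\<lambda>X Y. tensor_lift K T (\<lambda>a b. tensor_lift K T
               (\<lambda>a' b'. tens K A B (a \<otimes>\<^bsub>A\<^esub> a') (b \<otimes>\<^bsub>B\<^esub> b')) Y) X),
           one := tens K A B \<one>\<^bsub>A\<^esub> \<one>\<^bsub>B\<^esub>\<rparr>)"

record ('k, 'h) bialgebra = "('k, 'h) module" +
  comult :: "'h \<Rightarrow> ('h \<times> 'h \<Rightarrow> 'k) set"
  counit :: "'h \<Rightarrow> 'k"

definition coalgebra :: "('k, 'z) ring_scheme \<Rightarrow> ('k, 'h, 'w) bialgebra_scheme \<Rightarrow> bool" where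
  "coalgebra K C \<longleftrightarrow>
     module K C \<and>
     linear_map K C (tensor K C C) (comult C) \<and>
     linear_map K C (base_module K) (counit C) \<and>
     (\<forall>c\<in>carrier C.
        tensor_assoc K C C C (tensor_map K (tensor K C C) C (comult C) (\<lambda>x. x) (comult C c)) =
          tensor_map K C (tensor K C C) (\<lambda>x. x) (comult C) (comult C c) \<and>
        tensor_lift K C (\<lambda>c\<^sub>1 c\<^sub>2. counit C c\<^sub>1 \<odot>\<^bsub>C\<^esub> c\<^sub>2) (comult C c) = c \<and>
        tensor_lift K C (\<lambda>c\<^sub>1 c\<^sub>2. counit C c\<^sub>2 \<odot>\<^bsub>C\<^esub> c\<^sub>1) (comult C c) = c)"

text \<open>The identities for the iterated coproduct of the unit are stated in \<open>H \<otimes> (H \<otimes> H)\<close>.\<close>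

definition weak_bialgebra :: "('k, 'z) ring_scheme \<Rightarrow> ('k, 'h, 'w) bialgebra_scheme \<Rightarrow> bool" where
  "weak_bialgebra K H \<longleftrightarrow>
     k_algebra K H \<and> coalgebra K H \<and>
     (\<forall>a\<in>carrier H. \<forall>b\<in>carrier H.
        comult H (a \<otimes>\<^bsub>H\<^esub> b) = comult H a \<otimes>\<^bsub>tensor_algebra K H H\<^esub> comult H b) \<and>
     (\<forall>a\<in>carrier H. \<forall>b\<in>carrier H. \<forall>c\<in>carrier H.
        counit H (a \<otimes>\<^bsub>H\<^esub> b \<otimes>\<^bsub>H\<^esub> c) =
          tensor_lift K (base_module K)
            (\<lambda>b\<^sub>1 b\<^sub>2. counit H (a \<otimes>\<^bsub>H\<^esub> b\<^sub>1) \<otimes>\<^bsub>K\<^esub> counit H (b\<^sub>2 \<otimes>\<^bsub>H\<^esub> c)) (comult H b) \<and>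
        counit H (a \<otimes>\<^bsub>H\<^esub> b \<otimes>\<^bsub>H\<^esub> c) =
          tensor_lift K (base_module K)
            (\<lambda>b\<^sub>1 b\<^sub>2. counit H (a \<otimes>\<^bsub>H\<^esub> b\<^sub>2) \<otimes>\<^bsub>K\<^esub> counit H (b\<^sub>1 \<otimes>\<^bsub>H\<^esub> c)) (comult H b)) \<and>
     (let HH = tensor_algebra K H H; HHH = tensor_algebra K H HH;
          \<Delta>1 = comult H \<one>\<^bsub>H\<^esub>;
          \<Delta>1_1 = tensor_assoc K H H H (tens K HH H \<Delta>1 \<one>\<^bsub>H\<^esub>);
          one_\<Delta>1 = tens K H HH \<one>\<^bsub>H\<^esub> \<Delta>1;
          \<Delta>\<Delta>1 = tensor_assoc K H H H (tensor_map K HH H (comult H) (\<lambda>x. x) \<Delta>1)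
      in \<Delta>\<Delta>1 = \<Delta>1_1 \<otimes>\<^bsub>HHH\<^esub> one_\<Delta>1 \<and> \<Delta>\<Delta>1 = one_\<Delta>1 \<otimes>\<^bsub>HHH\<^esub> \<Delta>1_1)"

definition counit_s :: "('k, 'z) ring_scheme \<Rightarrow> ('k, 'h, 'w) bialgebra_scheme \<Rightarrow> 'h \<Rightarrow> 'h" where
  "counit_s K H x = tensor_lift K H (\<lambda>e\<^sub>1 e\<^sub>2. counit H (x \<otimes>\<^bsub>H\<^esub> e\<^sub>2) \<odot>\<^bsub>H\<^esub> e\<^sub>1) (comult H \<one>\<^bsub>H\<^esub>)"

definition counit_t :: "('k, 'z) ring_scheme \<Rightarrow> ('k, 'h, 'w) bialgebra_scheme \<Rightarrow> 'h \<Rightarrow> 'h" where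
  "counit_t K H x = tensor_lift K H (\<lambda>e\<^sub>1 e\<^sub>2. counit H (e\<^sub>1 \<otimes>\<^bsub>H\<^esub> x) \<odot>\<^bsub>H\<^esub> e\<^sub>2) (comult H \<one>\<^bsub>H\<^esub>)"

definition H_s :: "('k, 'z) ring_scheme \<Rightarrow> ('k, 'h, 'w) bialgebra_scheme \<Rightarrow> 'h set" where
  "H_s K H = counit_s K H ` carrier H"

definition H_t :: "('k, 'z) ring_scheme \<Rightarrow> ('k, 'h, 'w) bialgebra_scheme \<Rightarrow> 'h set" where
  "H_t K H = counit_t K H ` carrier H"


section \<open>The monoidal category of right comodules\<close>

text \<open>The record also serves for comodule algebras, whose product and unit are the fields \<open>mult\<close>
  and \<open>one\<close>.\<close>

record ('k, 'a, 'h) comodule = "('k, 'a) module" +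
  coact :: "'a \<Rightarrow> ('a \<times> 'h \<Rightarrow> 'k) set"

definition with_coact :: "('k, 'a) module \<Rightarrow> ('a \<Rightarrow> ('a \<times> 'h \<Rightarrow> 'k) set) \<Rightarrow>
    ('k, 'a, 'h) comodule" where
  "with_coact V \<rho> = module.extend V (comodule.fields (restrict \<rho> (carrier V)))"

definition right_comodule :: "('k, 'z) ring_scheme \<Rightarrow> ('k, 'h, 'w) bialgebra_scheme \<Rightarrow>
    ('k, 'a, 'h) comodule \<Rightarrow> bool" where
  "right_comodule K H M \<longleftrightarrow>
     module K M \<and>
     linear_map K M (tensor K M H) (coact M) \<and>
     (\<forall>m\<in>carrier M.
        tensor_assoc K M H H (tensor_map K (tensor K M H) H (coact M) (\<lambda>x. x) (coact M m)) =
          tensor_map K M (tensor K H H) (\<lambda>x. x) (comult H) (coact M m) \<and>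
        tensor_lift K M (\<lambda>m\<^sub>0 m\<^sub>1. counit H m\<^sub>1 \<odot>\<^bsub>M\<^esub> m\<^sub>0) (coact M m) = m)"

definition normal_comodule :: "('k, 'z) ring_scheme \<Rightarrow> ('k, 'a, 'h) comodule \<Rightarrow> bool" where
  "normal_comodule K M \<longleftrightarrow> normal_space K M \<and> coact M \<in> extensional (carrier M)"

definition comodules :: "('k, 'z) ring_scheme \<Rightarrow> ('k, 'h, 'w) bialgebra_scheme \<Rightarrow>
    ('k, 'a, 'h) comodule set" where
  "comodules K H =
     {M. right_comodule K H M \<and> normal_comodule K M \<and> mult M = undefined \<and> one M = undefined}"

definition comodule_hom :: "('k, 'z) ring_scheme \<Rightarrow> ('k, 'h, 'w) bialgebra_scheme \<Rightarrow>
    ('k, 'a, 'h) comodule \<Rightarrow> ('k, 'b, 'h) comodule \<Rightarrow> ('a \<Rightarrow> 'b) set" where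
  "comodule_hom K H M N =
     {f \<in> extensional (carrier M). linear_map K M N f \<and>
        (\<forall>m\<in>carrier M. coact N (f m) = tensor_map K N H f (\<lambda>x. x) (coact M m))}"

definition prod_proj :: "('k, 'z) ring_scheme \<Rightarrow> ('k, 'h, 'w) bialgebra_scheme \<Rightarrow>
    ('k, 'a, 'h) comodule \<Rightarrow> ('k, 'b, 'h) comodule \<Rightarrow>
    ('a \<times> 'b \<Rightarrow> 'k) set \<Rightarrow> ('a \<times> 'b \<Rightarrow> 'k) set" where
  "prod_proj K H M N =
     (let T = tensor K M N
      in tensor_lift K T (\<lambda>m n.
           tensor_lift K T (\<lambda>m\<^sub>0 m\<^sub>1.
             tensor_lift K T (\<lambda>n\<^sub>0 n\<^sub>1. counit H (m\<^sub>1 \<otimes>\<^bsub>H\<^esub> n\<^sub>1) \<odot>\<^bsub>T\<^esub> tens K M N m\<^sub>0 n\<^sub>0)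
               (coact N n)) (coact M m)))"

definition prod_coact :: "('k, 'z) ring_scheme \<Rightarrow> ('k, 'h, 'w) bialgebra_scheme \<Rightarrow>
    ('k, 'a, 'h) comodule \<Rightarrow> ('k, 'b, 'h) comodule \<Rightarrow>
    ('a \<times> 'b \<Rightarrow> 'k) set \<Rightarrow> (('a \<times> 'b \<Rightarrow> 'k) set \<times> 'h \<Rightarrow> 'k) set" where
  "prod_coact K H M N =
     (let T = tensor K M N; TH = tensor K T H
      in tensor_lift K TH (\<lambda>m n.
           tensor_lift K TH (\<lambda>m\<^sub>0 m\<^sub>1.
             tensor_lift K TH (\<lambda>n\<^sub>0 n\<^sub>1. tens K T H (tens K M N m\<^sub>0 n\<^sub>0) (m\<^sub>1 \<otimes>\<^bsub>H\<^esub> n\<^sub>1))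
               (coact N n)) (coact M m)))"

definition comodule_prod :: "('k, 'z) ring_scheme \<Rightarrow> ('k, 'h, 'w) bialgebra_scheme \<Rightarrow>
    ('k, 'a, 'h) comodule \<Rightarrow> ('k, 'b, 'h) comodule \<Rightarrow>
    ('k, ('a \<times> 'b \<Rightarrow> 'k) set, 'h) comodule" where
  "comodule_prod K H M N =
     (let T = tensor K M N; S = {x \<in> carrier T. prod_proj K H M N x = x}
      in with_coact (subspace_module K T S) (\<lambda>x. corestrict K T S H (prod_coact K H M N x)))"

text \<open>The carrier of \<^term>\<open>comodule_prod K H M N\<close> is literally a subset of that of
  \<^term>\<open>tensor K M N\<close>, so the product of two maps is a restriction.\<close>

definition prod_map :: "('k, 'z) ring_scheme \<Rightarrow> ('k, 'h, 'w) bialgebra_scheme \<Rightarrow>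
    ('k, 'a, 'h) comodule \<Rightarrow> ('k, 'b, 'h) comodule \<Rightarrow>
    ('k, 'c, 'h) comodule \<Rightarrow> ('k, 'd, 'h) comodule \<Rightarrow> ('a \<Rightarrow> 'c) \<Rightarrow> ('b \<Rightarrow> 'd) \<Rightarrow>
    ('a \<times> 'b \<Rightarrow> 'k) set \<Rightarrow> ('c \<times> 'd \<Rightarrow> 'k) set" where
  "prod_map K H M N M' N' f g =
     restrict (tensor_map K M' N' f g) (carrier (comodule_prod K H M N))"

text \<open>The associator of vector spaces, viewed as a map between the iterated products, which are
  identified with subspaces of \<open>(M \<otimes> N) \<otimes> P\<close> and of \<open>M \<otimes> (N \<otimes> P)\<close> along the (injective)
  maps induced by the inclusions.\<close>

definition prod_assoc :: "('k, 'z) ring_scheme \<Rightarrow> ('k, 'h, 'w) bialgebra_scheme \<Rightarrow>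
    ('k, 'a, 'h) comodule \<Rightarrow> ('k, 'b, 'h) comodule \<Rightarrow> ('k, 'c, 'h) comodule \<Rightarrow>
    (('a \<times> 'b \<Rightarrow> 'k) set \<times> 'c \<Rightarrow> 'k) set \<Rightarrow> ('a \<times> ('b \<times> 'c \<Rightarrow> 'k) set \<Rightarrow> 'k) set" where
  "prod_assoc K H M N P =
     (\<lambda>x\<in>carrier (comodule_prod K H (comodule_prod K H M N) P).
        inv_into (carrier (comodule_prod K H M (comodule_prod K H N P)))
          (tensor_map K M (tensor K N P) (\<lambda>x. x) (\<lambda>x. x))
          (tensor_assoc K M N P (tensor_map K (tensor K M N) P (\<lambda>x. x) (\<lambda>x. x) x)))"

definition unit_comodule :: "('k, 'z) ring_scheme \<Rightarrow> ('k, 'h, 'w) bialgebra_scheme \<Rightarrow>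
    ('k, 'h, 'h) comodule" where
  "unit_comodule K H =
     with_coact (subspace_module K H (H_s K H)) (\<lambda>x. corestrict K H (H_s K H) H (comult H x))"

definition left_unitor :: "('k, 'z) ring_scheme \<Rightarrow> ('k, 'h, 'w) bialgebra_scheme \<Rightarrow>
    ('k, 'a, 'h) comodule \<Rightarrow> ('h \<times> 'a \<Rightarrow> 'k) set \<Rightarrow> 'a" where
  "left_unitor K H M =
     restrict (tensor_lift K M (\<lambda>x m.
         tensor_lift K M (\<lambda>m\<^sub>0 m\<^sub>1. counit H (x \<otimes>\<^bsub>H\<^esub> m\<^sub>1) \<odot>\<^bsub>M\<^esub> m\<^sub>0) (coact M m)))
       (carrier (comodule_prod K H (unit_comodule K H) M))"

definition right_unitor :: "('k, 'z) ring_scheme \<Rightarrow> ('k, 'h, 'w) bialgebra_scheme \<Rightarrow>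
    ('k, 'a, 'h) comodule \<Rightarrow> ('a \<times> 'h \<Rightarrow> 'k) set \<Rightarrow> 'a" where
  "right_unitor K H M =
     restrict (tensor_lift K M (\<lambda>m x.
         tensor_lift K M (\<lambda>m\<^sub>0 m\<^sub>1. counit H (m\<^sub>1 \<otimes>\<^bsub>H\<^esub> x) \<odot>\<^bsub>M\<^esub> m\<^sub>0) (coact M m)))
       (carrier (comodule_prod K H M (unit_comodule K H)))"


section \<open>Categories\<close>

text \<open>Hom sets are indexed by source and target, so they need not be disjoint;
  \<open>Comp C X Y Z g f\<close> is the composite of \<open>f : X \<rightarrow> Y\<close> and \<open>g : Y \<rightarrow> Z\<close>.\<close>

record ('o, 'm) cat =
  Obj :: "'o set"
  Hom :: "'o \<Rightarrow> 'o \<Rightarrow> 'm set"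
  Ident :: "'o \<Rightarrow> 'm"
  Comp :: "'o \<Rightarrow> 'o \<Rightarrow> 'o \<Rightarrow> 'm \<Rightarrow> 'm \<Rightarrow> 'm"

definition category :: "('o, 'm) cat \<Rightarrow> bool" where
  "category C \<longleftrightarrow>
     (\<forall>X\<in>Obj C. Ident C X \<in> Hom C X X) \<and>
     (\<forall>X\<in>Obj C. \<forall>Y\<in>Obj C. \<forall>Z\<in>Obj C. \<forall>f\<in>Hom C X Y. \<forall>g\<in>Hom C Y Z.
        Comp C X Y Z g f \<in> Hom C X Z) \<and>
     (\<forall>X\<in>Obj C. \<forall>Y\<in>Obj C. \<forall>f\<in>Hom C X Y.
        Comp C X X Y f (Ident C X) = f \<and> Comp C X Y Y (Ident C Y) f = f) \<and>
     (\<forall>W\<in>Obj C. \<forall>X\<in>Obj C. \<forall>Y\<in>Obj C. \<forall>Z\<in>Obj C.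
        \<forall>f\<in>Hom C W X. \<forall>g\<in>Hom C X Y. \<forall>h\<in>Hom C Y Z.
        Comp C W X Z (Comp C X Y Z h g) f = Comp C W Y Z h (Comp C W X Y g f))"

definition is_functor :: "('o, 'm) cat \<Rightarrow> ('p, 'n) cat \<Rightarrow> ('o \<Rightarrow> 'p) \<Rightarrow>
    ('o \<Rightarrow> 'o \<Rightarrow> 'm \<Rightarrow> 'n) \<Rightarrow> bool" where
  "is_functor C D F\<^sub>o F\<^sub>m \<longleftrightarrow>
     (\<forall>X\<in>Obj C. F\<^sub>o X \<in> Obj D) \<and>
     (\<forall>X\<in>Obj C. \<forall>Y\<in>Obj C. \<forall>f\<in>Hom C X Y. F\<^sub>m X Y f \<in> Hom D (F\<^sub>o X) (F\<^sub>o Y)) \<and>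
     (\<forall>X\<in>Obj C. F\<^sub>m X X (Ident C X) = Ident D (F\<^sub>o X)) \<and>
     (\<forall>X\<in>Obj C. \<forall>Y\<in>Obj C. \<forall>Z\<in>Obj C. \<forall>f\<in>Hom C X Y. \<forall>g\<in>Hom C Y Z.
        F\<^sub>m X Z (Comp C X Y Z g f) = Comp D (F\<^sub>o X) (F\<^sub>o Y) (F\<^sub>o Z) (F\<^sub>m Y Z g) (F\<^sub>m X Y f))"

definition isomorphic_categories :: "('o, 'm) cat \<Rightarrow> ('p, 'n) cat \<Rightarrow> bool" where
  "isomorphic_categories C D \<longleftrightarrow>
     category C \<and> category D \<and>
     (\<exists>F\<^sub>o F\<^sub>m G\<^sub>o G\<^sub>m. is_functor C D F\<^sub>o F\<^sub>m \<and> is_functor D C G\<^sub>o G\<^sub>m \<and>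
        (\<forall>X\<in>Obj C. G\<^sub>o (F\<^sub>o X) = X) \<and> (\<forall>X\<in>Obj D. F\<^sub>o (G\<^sub>o X) = X) \<and>
        (\<forall>X\<in>Obj C. \<forall>Y\<in>Obj C. \<forall>f\<in>Hom C X Y. G\<^sub>m (F\<^sub>o X) (F\<^sub>o Y) (F\<^sub>m X Y f) = f) \<and>
        (\<forall>X\<in>Obj D. \<forall>Y\<in>Obj D. \<forall>f\<in>Hom D X Y. F\<^sub>m (G\<^sub>o X) (G\<^sub>o Y) (G\<^sub>m X Y f) = f))"

text \<open>The category of right \<open>H\<close>-comodule algebras whose underlying set is contained in the
  type \<open>'a\<close>.\<close>

definition comodule_algebra :: "('k, 'z) ring_scheme \<Rightarrow> ('k, 'h, 'w) bialgebra_scheme \<Rightarrow>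
    ('k, 'a, 'h) comodule \<Rightarrow> bool" where
  "comodule_algebra K H A \<longleftrightarrow>
     k_algebra K A \<and> right_comodule K H A \<and>
     (\<forall>a\<in>carrier A. \<forall>b\<in>carrier A.
        coact A (a \<otimes>\<^bsub>A\<^esub> b) = coact A a \<otimes>\<^bsub>tensor_algebra K A H\<^esub> coact A b) \<and>
     coact A \<one>\<^bsub>A\<^esub> \<in>
       tensor_map K A H (\<lambda>x. x) (\<lambda>x. x) ` carrier (tensor K A (subspace_module K H (H_t K H)))"

definition comodule_algebra_cat :: "('k, 'z) ring_scheme \<Rightarrow> ('k, 'h, 'w) bialgebra_scheme \<Rightarrow>
    (('k, 'a, 'h) comodule, 'a \<Rightarrow> 'a) cat" where
  "comodule_algebra_cat K H =
     \<lparr>Obj = {A. comodule_algebra K H A \<and> normal_comodule K A \<and>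
                mult A \<in> carrier A \<rightarrow>\<^sub>E carrier A \<rightarrow>\<^sub>E carrier A},
      Hom = (\<lambda>A B. comodule_hom K H A B \<inter> ring_hom A B),
      Ident = (\<lambda>A. \<lambda>x\<in>carrier A. x),
      Comp = (\<lambda>A B C g f. compose (carrier A) g f)\<rparr>"

text \<open>The category of algebras in the monoidal category of right \<open>H\<close>-comodules, again with
  underlying set contained in the type \<open>'a\<close>.\<close>

definition algebra_in_comodules :: "('k, 'z) ring_scheme \<Rightarrow> ('k, 'h, 'w) bialgebra_scheme \<Rightarrow>
    ('k, 'a, 'h) comodule \<Rightarrow> (('a \<times> 'a \<Rightarrow> 'k) set \<Rightarrow> 'a) \<Rightarrow> ('h \<Rightarrow> 'a) \<Rightarrow> bool" where
  "algebra_in_comodules K H A m u \<longleftrightarrow>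
     (let AA = comodule_prod K H A A; I = unit_comodule K H; i = (\<lambda>x\<in>carrier A. x)
      in A \<in> comodules K H \<and> m \<in> comodule_hom K H AA A \<and> u \<in> comodule_hom K H I A \<and>
         (\<forall>x\<in>carrier (comodule_prod K H AA A).
            m (prod_map K H AA A A A m i x) =
            m (prod_map K H A AA A A i m (prod_assoc K H A A A x))) \<and>
         (\<forall>x\<in>carrier (comodule_prod K H I A).
            m (prod_map K H I A A A u i x) = left_unitor K H A x) \<and>
         (\<forall>x\<in>carrier (comodule_prod K H A I).
            m (prod_map K H A I A A i u x) = right_unitor K H A x))"

definition alg_comodule_cat :: "('k, 'z) ring_scheme \<Rightarrow> ('k, 'h, 'w) bialgebra_scheme \<Rightarrow>
    (('k, 'a, 'h) comodule \<times> (('a \<times> 'a \<Rightarrow> 'k) set \<Rightarrow> 'a) \<times> ('h \<Rightarrow> 'a), 'a \<Rightarrow> 'a) cat" where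
  "alg_comodule_cat K H =
     \<lparr>Obj = {(A, m, u). algebra_in_comodules K H A m u},
      Hom = (\<lambda>(A, m, u) (B, m', u').
        {f \<in> comodule_hom K H A B.
           (\<forall>x\<in>carrier (comodule_prod K H A A). f (m x) = m' (prod_map K H A A B B f f x)) \<and>
           (\<forall>x\<in>H_s K H. f (u x) = u' x)}),
      Ident = (\<lambda>(A, m, u). \<lambda>x\<in>carrier A. x),
      Comp = (\<lambda>(A, m, u) Y Z g f. compose (carrier A) g f)\<rparr>"

end

theory Submission
  imports Defs
begin

text \<open>
  A product in the category of comodules is defined on the image of the idempotent \<open>P\<close> on
  \<open>A \<otimes> A\<close> only.  It extends to \<open>A \<otimes> A\<close> by composition with \<open>P\<close>; conversely the product of a
  comodule algebra is determined by its restriction, since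
  \<open>a\<^sub>0 b\<^sub>0 \<epsilon>(a\<^sub>1 b\<^sub>1) = (a b)\<^sub>0 \<epsilon>((a b)\<^sub>1) = a b\<close>.  The unit element and the unit morphism correspond by
  \<open>u x = \<epsilon>(x 1\<^sub>1) 1\<^sub>0\<close> and \<open>1 = u 1\<close>.  That \<open>u\<close> is colinear uses that the coaction of the unit has
  its second leg in \<open>H\<^sub>t\<close>, and the two unit laws follow by applying
  \<open>\<epsilon>(x y z) = \<epsilon>(x y\<^sub>2) \<epsilon>(y\<^sub>1 z) = \<epsilon>(x y\<^sub>1) \<epsilon>(y\<^sub>2 z)\<close> to the coactions of \<open>1 a\<close> and \<open>a 1\<close>; for the
  second one, \<open>H\<^sub>s\<close> and \<open>H\<^sub>t\<close> commute.  All subspaces that occur (\<open>H\<^sub>s\<close>, \<open>H\<^sub>t\<close>, the monoidal products)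
  are images of idempotents, so their inclusions remain split after tensoring.
\<close>

section \<open>Linear maps and free modules\<close>

text \<open>Sweedler identities become equations between nested sums \<open>tsum\<close>. The
  simplifier moves sums outwards and checks linearity; reordering, coassociativity and the axioms on
  \<Delta> and \<epsilon> are invoked by name. What shapes the rest is that several notions are
  given by choices: a value common to all representatives in \<open>tensor_lift\<close>, inverse
  functions in \<open>corestrict\<close> and \<open>prod_assoc\<close>. The first two are replaced
  by formulas, \<open>corestrict\<close> by Q \<otimes> id for an idempotent Q. Of
  \<open>prod_assoc\<close> only its membership in the product and its image in A \<otimes> (A
  \<otimes> A) are kept. This suffices because id \<otimes> m factors through A \<otimes> (A
  \<otimes> A) once m is extended to all of A \<otimes> A. The map P itself is t_0 \<epsilon>(t_1)
  for the product coaction, so that its idempotence follows from coassociativity of that coaction,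
  which need not be counital on A \<otimes> A. Finally, morphisms on the two sides turn out to be
  the same functions, so both functors fix every morphism and the category axioms are checked on one
  side only.\<close>

definition bilinear_map :: "('k, 'z) ring_scheme \<Rightarrow> ('k, 'a, 'm) module_scheme \<Rightarrow>
    ('k, 'b, 'n) module_scheme \<Rightarrow> ('k, 'c, 'p) module_scheme \<Rightarrow> ('a \<Rightarrow> 'b \<Rightarrow> 'c) \<Rightarrow> bool" where
  "bilinear_map K M N P \<beta> \<longleftrightarrow>
     (\<forall>n\<in>carrier N. linear_map K M P (\<lambda>m. \<beta> m n)) \<and>
     (\<forall>m\<in>carrier M. linear_map K N P (\<lambda>n. \<beta> m n))"

lemma bilinear_mapI:
  assumes "\<And>n. n \<in> carrier N \<Longrightarrow> linear_map K M P (\<lambda>m. \<beta> m n)"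
    and "\<And>m. m \<in> carrier M \<Longrightarrow> linear_map K N P (\<lambda>n. \<beta> m n)"
  shows "bilinear_map K M N P \<beta>"
  using assms by (auto simp: bilinear_map_def)

lemma bilinear_map_linear:
  assumes "bilinear_map K M N P \<beta>"
  shows "n \<in> carrier N \<Longrightarrow> linear_map K M P (\<lambda>m. \<beta> m n)"
    and "m \<in> carrier M \<Longrightarrow> linear_map K N P (\<lambda>n. \<beta> m n)"
  using assms by (auto simp: bilinear_map_def)

lemma linear_mapI:
  assumes "\<And>x. x \<in> carrier M \<Longrightarrow> f x \<in> carrier N"
    and "\<And>x y. \<lbrakk>x \<in> carrier M; y \<in> carrier M\<rbrakk> \<Longrightarrow> f (x \<oplus>\<^bsub>M\<^esub> y) = f x \<oplus>\<^bsub>N\<^esub> f y"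
    and "\<And>a x. \<lbrakk>a \<in> carrier K; x \<in> carrier M\<rbrakk> \<Longrightarrow> f (a \<odot>\<^bsub>M\<^esub> x) = a \<odot>\<^bsub>N\<^esub> f x"
  shows "linear_map K M N f"
  using assms by (auto simp: linear_map_def)

lemma linear_map_closed: "\<lbrakk>linear_map K M N f; x \<in> carrier M\<rbrakk> \<Longrightarrow> f x \<in> carrier N"
  by (auto simp: linear_map_def)

lemma bilinear_map_closed:
  "\<lbrakk>bilinear_map K M N P \<beta>; m \<in> carrier M; n \<in> carrier N\<rbrakk> \<Longrightarrow> \<beta> m n \<in> carrier P"
  by (auto simp: bilinear_map_def linear_map_def Pi_iff)

lemma linear_map_add:
  "\<lbrakk>linear_map K M N f; x \<in> carrier M; y \<in> carrier M\<rbrakk> \<Longrightarrow> f (x \<oplus>\<^bsub>M\<^esub> y) = f x \<oplus>\<^bsub>N\<^esub> f y"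
  by (auto simp: linear_map_def)

lemma linear_map_smult:
  "\<lbrakk>linear_map K M N f; a \<in> carrier K; x \<in> carrier M\<rbrakk> \<Longrightarrow> f (a \<odot>\<^bsub>M\<^esub> x) = a \<odot>\<^bsub>N\<^esub> f x"
  by (auto simp: linear_map_def)

lemma linear_map_cong:
  assumes "linear_map K M N f" "module K M" "\<And>x. x \<in> carrier M \<Longrightarrow> f x = g x"
  shows "linear_map K M N g"
proof -
  interpret module K M by fact
  show ?thesis
    using assms(1) by (auto simp: linear_map_def assms(3)[symmetric])
qed

lemma linear_map_zero:
  assumes "module K M" "module K N" "linear_map K M N f"
  shows "f \<zero>\<^bsub>M\<^esub> = \<zero>\<^bsub>N\<^esub>"
proof -
  interpret M: module K M by fact
  interpret N: module K N by fact
  have "f (\<zero>\<^bsub>K\<^esub> \<odot>\<^bsub>M\<^esub> \<zero>\<^bsub>M\<^esub>) = \<zero>\<^bsub>K\<^esub> \<odot>\<^bsub>N\<^esub> f \<zero>\<^bsub>M\<^esub>"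
    using assms(3) by (intro linear_map_smult) auto
  then show ?thesis
    using linear_map_closed[OF assms(3), of "\<zero>\<^bsub>M\<^esub>"] by simp
qed

lemma linear_map_minus:
  assumes "module K M" "module K N" "linear_map K M N f" "x \<in> carrier M" "y \<in> carrier M"
  shows "f (x \<ominus>\<^bsub>M\<^esub> y) = f x \<ominus>\<^bsub>N\<^esub> f y"
proof -
  interpret M: module K M by fact
  interpret N: module K N by fact
  note cl = linear_map_closed[OF assms(3)]
  have "f x = f ((x \<ominus>\<^bsub>M\<^esub> y) \<oplus>\<^bsub>M\<^esub> y)"
    using assms(4,5) by (simp add: M.minus_eq M.a_assoc M.l_neg)
  also have "\<dots> = f (x \<ominus>\<^bsub>M\<^esub> y) \<oplus>\<^bsub>N\<^esub> f y"
    using assms by (simp add: linear_map_add)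
  finally show ?thesis
    using assms(4,5) cl by (simp add: N.minus_eq N.a_assoc N.r_neg)
qed

lemma submodule_kernel:
  assumes "module K M" "module K N" "linear_map K M N f"
  shows "submodule {x \<in> carrier M. f x = \<zero>\<^bsub>N\<^esub>} K M"
proof -
  interpret M: module K M by fact
  interpret N: module K N by fact
  have neg: "f (\<ominus>\<^bsub>M\<^esub> x) = \<zero>\<^bsub>N\<^esub>" if "x \<in> carrier M" "f x = \<zero>\<^bsub>N\<^esub>" for x
    using linear_map_minus[OF assms, of "\<zero>\<^bsub>M\<^esub>" x] that
    by (simp add: linear_map_zero[OF assms] M.minus_eq N.minus_eq)
  show ?thesis
    by (rule M.submoduleI)
      (use neg in \<open>auto simp: linear_map_zero[OF assms] linear_map_add[OF assms(3)]
          linear_map_smult[OF assms(3)]\<close>)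
qed

lemma (in abelian_group) minus_eq_zeroD:
  assumes "x \<ominus> y = \<zero>" "x \<in> carrier G" "y \<in> carrier G"
  shows "x = y"
proof -
  have "x = (x \<ominus> y) \<oplus> y"
    using assms(2,3) by (simp add: minus_eq a_assoc l_neg)
  with assms show ?thesis by simp
qed

text \<open>Each module law for T is the image of the same law in F, since c is surjective and
  respects the operations. This makes modules of the tensor product, of the images of idempotents,
  and of a record with other values of \<open>mult\<close> and \<open>one\<close>.\<close>

lemma module_image:
  fixes F (structure) and T (structure)
  assumes "module K F"
    and carr: "carrier T = c ` carrier F"
    and zero: "c \<zero>\<^bsub>F\<^esub> = \<zero>\<^bsub>T\<^esub>"
    and add: "\<And>x y. \<lbrakk>x \<in> carrier F; y \<in> carrier F\<rbrakk> \<Longrightarrow> c x \<oplus>\<^bsub>T\<^esub> c y = c (x \<oplus>\<^bsub>F\<^esub> y)"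
    and smult: "\<And>a x. \<lbrakk>a \<in> carrier K; x \<in> carrier F\<rbrakk> \<Longrightarrow> a \<odot>\<^bsub>T\<^esub> c x = c (a \<odot>\<^bsub>F\<^esub> x)"
  shows "module K T"
proof -
  interpret F: module K F by fact
  have "abelian_group T"
  proof (rule abelian_groupI)
    fix x assume "x \<in> carrier T"
    then obtain x' where "x' \<in> carrier F" "x = c x'"
      by (auto simp: carr)
    then have "c (\<ominus>\<^bsub>F\<^esub> x') \<oplus>\<^bsub>T\<^esub> x = \<zero>\<^bsub>T\<^esub>"
      by (simp add: add F.l_neg zero)
    moreover have "c (\<ominus>\<^bsub>F\<^esub> x') \<in> carrier T"
      using \<open>x' \<in> carrier F\<close> by (simp add: carr)
    ultimately show "\<exists>y\<in>carrier T. y \<oplus>\<^bsub>T\<^esub> x = \<zero>\<^bsub>T\<^esub>"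
      by blast
  qed (auto simp: carr add zero[symmetric] F.a_ac)
  then show ?thesis
    by (intro moduleI F.R.cring_axioms)
      (auto simp: carr add smult F.smult_l_distr F.smult_r_distr F.smult_assoc1)
qed

lemma free_module_simps [simp]:
  "zero (free_module K X) = (\<lambda>x. \<zero>\<^bsub>K\<^esub>)"
  "add (free_module K X) \<phi> \<psi> = (\<lambda>x. \<phi> x \<oplus>\<^bsub>K\<^esub> \<psi> x)"
  "smult (free_module K X) a \<phi> = (\<lambda>x. a \<otimes>\<^bsub>K\<^esub> \<phi> x)"
  by (simp_all add: free_module_def)

lemma free_module_carrier:
  "\<phi> \<in> carrier (free_module K X) \<longleftrightarrow>
     (\<forall>x. \<phi> x \<in> carrier K) \<and> finite {x. \<phi> x \<noteq> \<zero>\<^bsub>K\<^esub>} \<and> {x. \<phi> x \<noteq> \<zero>\<^bsub>K\<^esub>} \<subseteq> X"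
  by (auto simp: free_module_def)

lemma (in cring) free_module_module: "module R (free_module R X)"
proof -
  let ?F = "free_module R X"
  have supp_add: "{x. \<phi> x \<oplus> \<psi> x \<noteq> \<zero>} \<subseteq> {x. \<phi> x \<noteq> \<zero>} \<union> {x. \<psi> x \<noteq> \<zero>}" for \<phi> \<psi> :: "'c \<Rightarrow> 'a"
    by auto
  have add: "\<phi> \<oplus>\<^bsub>?F\<^esub> \<psi> \<in> carrier ?F" if "\<phi> \<in> carrier ?F" "\<psi> \<in> carrier ?F" for \<phi> \<psi>
    using that finite_subset[OF supp_add[of \<phi> \<psi>]] supp_add[of \<phi> \<psi>]
    by (auto simp: free_module_carrier)
  have smult: "a \<odot>\<^bsub>?F\<^esub> \<phi> \<in> carrier ?F" if "a \<in> carrier R" "\<phi> \<in> carrier ?F" for a \<phi>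
  proof -
    have "{x. a \<otimes> \<phi> x \<noteq> \<zero>} \<subseteq> {x. \<phi> x \<noteq> \<zero>}"
      using that by auto
    then show ?thesis
      using that finite_subset[of "{x. a \<otimes> \<phi> x \<noteq> \<zero>}" "{x. \<phi> x \<noteq> \<zero>}"]
      by (auto simp: free_module_carrier)
  qed
  have "abelian_group ?F"
  proof (rule abelian_groupI)
    fix \<phi> assume "\<phi> \<in> carrier ?F"
    then have "(\<ominus> \<one>) \<odot>\<^bsub>?F\<^esub> \<phi> \<in> carrier ?F \<and> (\<ominus> \<one>) \<odot>\<^bsub>?F\<^esub> \<phi> \<oplus>\<^bsub>?F\<^esub> \<phi> = \<zero>\<^bsub>?F\<^esub>"
      using smult[of "\<ominus> \<one>" \<phi>] by (auto simp: free_module_carrier l_minus l_neg)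
    then show "\<exists>\<psi>\<in>carrier ?F. \<psi> \<oplus>\<^bsub>?F\<^esub> \<phi> = \<zero>\<^bsub>?F\<^esub>"
      by blast
  qed (use add in \<open>auto simp: free_module_carrier a_ac\<close>)
  then show ?thesis
    by (intro moduleI cring_axioms smult)
      (auto simp: free_module_carrier l_distr r_distr m_assoc)
qed

lemma (in cring) free_gen_closed: "x \<in> X \<Longrightarrow> free_gen R x \<in> carrier (free_module R X)"
proof -
  assume "x \<in> X"
  moreover have "{y. free_gen R x y \<noteq> \<zero>} \<subseteq> {x}"
    by (auto simp: free_gen_def)
  ultimately show ?thesis
    using finite_subset[of "{y. free_gen R x y \<noteq> \<zero>}" "{x}"]
    by (auto simp: free_module_carrier) (auto simp: free_gen_def)
qed

text \<open>The induction runs over a finite set containing the support rather than over the support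
  itself, so that a new point of the set may leave the function as it is.\<close>

lemma (in cring) free_module_induct [consumes 1, case_names zero add gen]:
  assumes "\<phi> \<in> carrier (free_module R X)"
    and zero: "P (\<lambda>x. \<zero>)"
    and add: "\<And>\<phi> \<psi>. \<lbrakk>\<phi> \<in> carrier (free_module R X); \<psi> \<in> carrier (free_module R X); P \<phi>; P \<psi>\<rbrakk>
      \<Longrightarrow> P (\<lambda>x. \<phi> x \<oplus> \<psi> x)"
    and gen: "\<And>a x. \<lbrakk>a \<in> carrier R; x \<in> X\<rbrakk> \<Longrightarrow> P (\<lambda>y. a \<otimes> free_gen R x y)"
  shows "P \<phi>"
proof -
  interpret F: module R "free_module R X" by (rule free_module_module)
  have "P \<phi>" if "finite A" "\<phi> \<in> carrier (free_module R X)" "{x. \<phi> x \<noteq> \<zero>} \<subseteq> A" for A \<phi>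
    using that
  proof (induction A arbitrary: \<phi> rule: finite_induct)
    case empty
    then have "\<phi> = (\<lambda>x. \<zero>)" by auto
    with zero show ?case by simp
  next
    case (insert x A)
    show ?case
    proof (cases "\<phi> x = \<zero>")
      case True
      with insert.prems have "{x. \<phi> x \<noteq> \<zero>} \<subseteq> A"
        by (metis (mono_tags, lifting) insertE mem_Collect_eq subset_iff)
      with insert show ?thesis by simp
    next
      case False
      then have x: "x \<in> X" and \<phi>x: "\<phi> x \<in> carrier R"
        using insert.prems by (auto simp: free_module_carrier)
      \<comment> \<open>Erasing the value at x and adding it back as a multiple of the generator
        splits off one point of the support.\<close>
      define \<psi> where "\<psi> = \<phi>(x := \<zero>)"
      have sub: "{y. \<psi> y \<noteq> \<zero>} \<subseteq> {y. \<phi> y \<noteq> \<zero>}"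
        by (auto simp: \<psi>_def)
      have \<psi>: "\<psi> \<in> carrier (free_module R X)"
        using insert.prems(1) sub finite_subset[OF sub]
        by (auto simp: free_module_carrier \<psi>_def)
      have "{y. \<psi> y \<noteq> \<zero>} \<subseteq> A"
        using insert.prems(2) by (auto simp: \<psi>_def)
      then have "P \<psi>"
        using insert.IH \<psi> by blast
      moreover have g: "(\<lambda>y. \<phi> x \<otimes> free_gen R x y) \<in> carrier (free_module R X)"
        using F.smult_closed[OF \<phi>x free_gen_closed[OF x]] by simp
      ultimately have "P (\<lambda>y. \<psi> y \<oplus> \<phi> x \<otimes> free_gen R x y)"
        using add[OF \<psi> g] gen[OF \<phi>x x] by blast
      moreover have "(\<lambda>y. \<psi> y \<oplus> \<phi> x \<otimes> free_gen R x y) = \<phi>"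
        using \<phi>x \<psi> insert.prems(1) by (auto simp: \<psi>_def free_gen_def free_module_carrier)
      ultimately show ?thesis by simp
    qed
  qed
  then show ?thesis
    using assms(1) by (auto simp: free_module_carrier)
qed

text \<open>With \<open>b q = \<beta> (fst q) (snd q)\<close> this is the sum inside
  \<open>tensor_lift\<close>, evaluated at a single representative. Its linearity on the free module
  is shown before cosets enter.\<close>

definition free_lift :: "('k, 'z) ring_scheme \<Rightarrow> ('k, 'c, 'p) module_scheme \<Rightarrow>
    ('x \<Rightarrow> 'c) \<Rightarrow> ('x \<Rightarrow> 'k) \<Rightarrow> 'c" where
  "free_lift K P b \<phi> = (\<Oplus>\<^bsub>P\<^esub>q\<in>{q. \<phi> q \<noteq> \<zero>\<^bsub>K\<^esub>}. \<phi> q \<odot>\<^bsub>P\<^esub> b q)"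

text \<open>Terms outside the support vanish, so the sum may run over any finite set containing it.
  Additivity depends on this: the supports of \<phi>, \<psi> and \<phi> \<oplus> \<psi> differ and
  are replaced by one common set.\<close>

lemma (in module) free_lift_eq:
  assumes "finite A" "{x. \<phi> x \<noteq> \<zero>} \<subseteq> A" "A \<subseteq> X" "\<phi> \<in> carrier (free_module R X)"
    and "b \<in> X \<rightarrow> carrier M"
  shows "free_lift R M b \<phi> = (\<Oplus>\<^bsub>M\<^esub>q\<in>A. \<phi> q \<odot>\<^bsub>M\<^esub> b q)"
  unfolding free_lift_def
proof (rule M.add.finprod_mono_neutral_cong_left)
  show "\<And>i. i \<in> A - {x. \<phi> x \<noteq> \<zero>} \<Longrightarrow> \<phi> i \<odot>\<^bsub>M\<^esub> b i = \<zero>\<^bsub>M\<^esub>"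
    using assms by (auto intro!: smult_l_null)
  show "(\<lambda>q. \<phi> q \<odot>\<^bsub>M\<^esub> b q) \<in> A \<rightarrow> carrier M"
    using assms by (auto simp: free_module_carrier intro!: smult_closed)
qed (use assms in auto)

lemma (in module) free_lift_linear:
  assumes b: "b \<in> X \<rightarrow> carrier M"
  shows "linear_map R (free_module R X) M (free_lift R M b)"
proof (rule linear_mapI)
  interpret F: module R "free_module R X" by (rule R.free_module_module)
  have cl: "(\<lambda>q. \<phi> q \<odot>\<^bsub>M\<^esub> b q) \<in> A \<rightarrow> carrier M"
    if "\<phi> \<in> carrier (free_module R X)" "A \<subseteq> X" for \<phi> A
    using that b by (auto simp: free_module_carrier intro!: smult_closed)
  fix \<phi> assume \<phi>: "\<phi> \<in> carrier (free_module R X)"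
  show "free_lift R M b \<phi> \<in> carrier M"
    unfolding free_lift_def using \<phi> by (intro M.finsum_closed cl) (auto simp: free_module_carrier)
  { fix \<psi> assume \<psi>: "\<psi> \<in> carrier (free_module R X)"
    let ?A = "{x. \<phi> x \<noteq> \<zero>} \<union> {x. \<psi> x \<noteq> \<zero>}"
    have A: "finite ?A" "?A \<subseteq> X"
      using \<phi> \<psi> by (auto simp: free_module_carrier)
    have "free_lift R M b (\<phi> \<oplus>\<^bsub>free_module R X\<^esub> \<psi>) = (\<Oplus>\<^bsub>M\<^esub>q\<in>?A. (\<phi> q \<oplus> \<psi> q) \<odot>\<^bsub>M\<^esub> b q)"
      using A F.a_closed[OF \<phi> \<psi>] by (subst free_lift_eq[OF _ _ _ _ b, where A = ?A]) auto
    also have "\<dots> = (\<Oplus>\<^bsub>M\<^esub>q\<in>?A. \<phi> q \<odot>\<^bsub>M\<^esub> b q \<oplus>\<^bsub>M\<^esub> \<psi> q \<odot>\<^bsub>M\<^esub> b q)"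
      using \<phi> \<psi> A(2) b cl[OF \<phi> A(2)] cl[OF \<psi> A(2)]
      by (intro M.finsum_cong' smult_l_distr)
        (auto simp: free_module_carrier subset_iff intro!: M.a_closed smult_closed)
    also have "\<dots> = (\<Oplus>\<^bsub>M\<^esub>q\<in>?A. \<phi> q \<odot>\<^bsub>M\<^esub> b q) \<oplus>\<^bsub>M\<^esub> (\<Oplus>\<^bsub>M\<^esub>q\<in>?A. \<psi> q \<odot>\<^bsub>M\<^esub> b q)"
      using cl[OF \<phi> A(2)] cl[OF \<psi> A(2)] by (rule M.finsum_addf)
    also have "\<dots> = free_lift R M b \<phi> \<oplus>\<^bsub>M\<^esub> free_lift R M b \<psi>"
      using A \<phi> \<psi> by (simp add: free_lift_eq[OF _ _ _ _ b, where A = ?A])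
    finally show "free_lift R M b (\<phi> \<oplus>\<^bsub>free_module R X\<^esub> \<psi>) =
      free_lift R M b \<phi> \<oplus>\<^bsub>M\<^esub> free_lift R M b \<psi>" . }
  fix a assume a: "a \<in> carrier R"
  let ?A = "{x. \<phi> x \<noteq> \<zero>}"
  have A: "finite ?A" "?A \<subseteq> X"
    using \<phi> by (auto simp: free_module_carrier)
  have "free_lift R M b (a \<odot>\<^bsub>free_module R X\<^esub> \<phi>) = (\<Oplus>\<^bsub>M\<^esub>q\<in>?A. (a \<otimes> \<phi> q) \<odot>\<^bsub>M\<^esub> b q)"
    using A F.smult_closed[OF a \<phi>] a by (subst free_lift_eq[OF _ _ _ _ b, where A = ?A]) auto
  also have "\<dots> = (\<Oplus>\<^bsub>M\<^esub>q\<in>?A. a \<odot>\<^bsub>M\<^esub> (\<phi> q \<odot>\<^bsub>M\<^esub> b q))"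
    using a \<phi> A(2) b cl[OF \<phi> A(2)]
    by (intro M.finsum_cong' smult_assoc1) (auto simp: free_module_carrier intro!: smult_closed)
  also have "\<dots> = a \<odot>\<^bsub>M\<^esub> free_lift R M b \<phi>"
    unfolding free_lift_def using A cl[OF \<phi> A(2)] a by (simp add: finsum_smult_ldistr)
  finally show "free_lift R M b (a \<odot>\<^bsub>free_module R X\<^esub> \<phi>) = a \<odot>\<^bsub>M\<^esub> free_lift R M b \<phi>" .
qed

lemma (in module) free_lift_gen:
  assumes b: "b \<in> X \<rightarrow> carrier M" and x: "x \<in> X"
  shows "free_lift R M b (free_gen R x) = b x"
proof -
  have "free_lift R M b (free_gen R x) = (\<Oplus>\<^bsub>M\<^esub>q\<in>{x}. free_gen R x q \<odot>\<^bsub>M\<^esub> b q)"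
    using x R.free_gen_closed[OF x]
    by (intro free_lift_eq[OF _ _ _ _ b]) (auto simp: free_gen_def)
  also have "\<dots> = b x"
    using b x by (simp add: free_gen_def Pi_iff)
  finally show ?thesis .
qed

section \<open>The universal property of the tensor product\<close>

text \<open>The four families inside \<open>tensor_relations\<close>, named in order to speak of the
  relations as the least submodule containing them.\<close>

definition tensor_generators :: "('k, 'z) ring_scheme \<Rightarrow> ('k, 'a, 'm) module_scheme \<Rightarrow>
    ('k, 'b, 'n) module_scheme \<Rightarrow> ('a \<times> 'b \<Rightarrow> 'k) set" where
  "tensor_generators K M N =
     (let F = free_module K (carrier M \<times> carrier N); \<delta> = (\<lambda>m n. free_gen K (m, n))
      in {\<delta> (m \<oplus>\<^bsub>M\<^esub> m') n \<ominus>\<^bsub>F\<^esub> (\<delta> m n \<oplus>\<^bsub>F\<^esub> \<delta> m' n) | m m' n.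
            m \<in> carrier M \<and> m' \<in> carrier M \<and> n \<in> carrier N} \<union>
         {\<delta> m (n \<oplus>\<^bsub>N\<^esub> n') \<ominus>\<^bsub>F\<^esub> (\<delta> m n \<oplus>\<^bsub>F\<^esub> \<delta> m n') | m n n'.
            m \<in> carrier M \<and> n \<in> carrier N \<and> n' \<in> carrier N} \<union>
         {\<delta> (a \<odot>\<^bsub>M\<^esub> m) n \<ominus>\<^bsub>F\<^esub> a \<odot>\<^bsub>F\<^esub> \<delta> m n | a m n.
            a \<in> carrier K \<and> m \<in> carrier M \<and> n \<in> carrier N} \<union>
         {\<delta> m (a \<odot>\<^bsub>N\<^esub> n) \<ominus>\<^bsub>F\<^esub> a \<odot>\<^bsub>F\<^esub> \<delta> m n | a m n.
            a \<in> carrier K \<and> m \<in> carrier M \<and> n \<in> carrier N})"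

lemma tensor_relations_eq:
  "tensor_relations K M N = \<Inter>{S. submodule S K (free_module K (carrier M \<times> carrier N)) \<and>
     tensor_generators K M N \<subseteq> S}"
  unfolding tensor_relations_def tensor_generators_def Let_def ..

lemma (in module) submodule_Inter:
  assumes "\<And>S. S \<in> \<A> \<Longrightarrow> submodule S R M" "\<A> \<noteq> {}"
  shows "submodule (\<Inter>\<A>) R M"
proof (rule submoduleI)
  show "\<Inter>\<A> \<subseteq> carrier M"
    using assms submoduleE(1) by blast
  show "\<zero>\<^bsub>M\<^esub> \<in> \<Inter>\<A>"
    using assms(1) subgroup.one_closed[OF submodule.axioms(1)] by fastforce
qed (use assms(1) submoduleE(3,4,5) in blast)+

locale tensor_pair = M: module K M + N: module K N
  for K :: "('k, 'z) ring_scheme" and M :: "('k, 'a, 'm) module_scheme"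
    and N :: "('k, 'b, 'n) module_scheme"
begin

abbreviation "free \<equiv> free_module K (carrier M \<times> carrier N)"
abbreviation "rel \<equiv> tensor_relations K M N"
abbreviation "gen m n \<equiv> free_gen K (m, n)"

sublocale F: module K free
  by (rule M.R.free_module_module)

lemma gen_closed: "\<lbrakk>m \<in> carrier M; n \<in> carrier N\<rbrakk> \<Longrightarrow> gen m n \<in> carrier free"
  by (intro M.R.free_gen_closed) auto

lemma tensor_generators_subset: "tensor_generators K M N \<subseteq> carrier free"
  unfolding tensor_generators_def Let_def
  by (auto intro!: F.M.minus_closed F.M.a_closed F.smult_closed gen_closed
      simp del: free_module_simps)

lemma rel_submodule: "submodule rel K free"
  unfolding tensor_relations_eq
  using F.carrier_is_submodule tensor_generators_subset by (intro F.submodule_Inter) auto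

lemma generators_rel: "tensor_generators K M N \<subseteq> rel"
  unfolding tensor_relations_eq by auto

lemma rel_least: "\<lbrakk>submodule S K free; tensor_generators K M N \<subseteq> S\<rbrakk> \<Longrightarrow> rel \<subseteq> S"
  unfolding tensor_relations_eq by auto

sublocale S: abelian_subgroup rel free
  using rel_submodule
  by (intro abelian_subgroupI3 F.M.abelian_group_axioms)
    (simp add: additive_subgroup_def submodule_def)

abbreviation "coset \<phi> \<equiv> rel +>\<^bsub>free\<^esub> \<phi>"

lemma coset_memD:
  "\<lbrakk>\<phi> \<in> carrier free; \<psi> \<in> coset \<phi>\<rbrakk> \<Longrightarrow> \<psi> \<in> carrier free \<and> \<psi> \<ominus>\<^bsub>free\<^esub> \<phi> \<in> rel"
  using S.a_elemrcos_carrier[of \<phi> \<psi>] S.a_rcos_module_imp[of \<phi> \<psi>] by (simp add: a_minus_def)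

lemma coset_eqI:
  "\<lbrakk>\<phi> \<in> carrier free; \<psi> \<in> carrier free; \<psi> \<ominus>\<^bsub>free\<^esub> \<phi> \<in> rel\<rbrakk> \<Longrightarrow> coset \<psi> = coset \<phi>"
  using S.a_rcos_module_rev[of \<phi> \<psi>] S.a_repr_independence'[of \<psi> \<phi>] by (simp add: a_minus_def)

lemma tensor_carrier: "carrier (tensor K M N) = coset ` carrier free"
  by (auto simp: tensor_def Let_def make_space_def A_RCOSETS_def')

lemma tensor_zero: "\<zero>\<^bsub>tensor K M N\<^esub> = coset \<zero>\<^bsub>free\<^esub>"
  using F.M.a_coset_add_zero[OF S.a_subset] by (simp add: tensor_def Let_def make_space_def)

lemma tensor_add:
  assumes "\<phi> \<in> carrier free" "\<psi> \<in> carrier free"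
  shows "coset \<phi> \<oplus>\<^bsub>tensor K M N\<^esub> coset \<psi> = coset (\<phi> \<oplus>\<^bsub>free\<^esub> \<psi>)"
proof -
  have "coset \<phi> \<in> a_rcosets\<^bsub>free\<^esub> rel" "coset \<psi> \<in> a_rcosets\<^bsub>free\<^esub> rel"
    using assms by (auto simp: A_RCOSETS_def')
  then show ?thesis
    using S.a_rcos_sum[OF assms] by (simp add: tensor_def Let_def make_space_def)
qed

text \<open>Scalar multiplication is defined by a union over all representatives; they all give the
  same coset because \<open>rel\<close> is closed under scalars.\<close>

lemma tensor_smult:
  assumes "a \<in> carrier K" "\<phi> \<in> carrier free"
  shows "a \<odot>\<^bsub>tensor K M N\<^esub> coset \<phi> = coset (a \<odot>\<^bsub>free\<^esub> \<phi>)"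
proof -
  have "coset \<phi> \<in> a_rcosets\<^bsub>free\<^esub> rel"
    using assms by (auto simp: A_RCOSETS_def')
  then have "a \<odot>\<^bsub>tensor K M N\<^esub> coset \<phi> = (\<Union>\<psi>\<in>coset \<phi>. coset (a \<odot>\<^bsub>free\<^esub> \<psi>))"
    using assms by (simp add: tensor_def Let_def make_space_def)
  also have "\<dots> = (\<Union>\<psi>\<in>coset \<phi>. coset (a \<odot>\<^bsub>free\<^esub> \<phi>))"
  proof (rule SUP_cong[OF refl])
    fix \<psi> assume "\<psi> \<in> coset \<phi>"
    then have \<psi>: "\<psi> \<in> carrier free" "\<psi> \<ominus>\<^bsub>free\<^esub> \<phi> \<in> rel"
      using coset_memD assms by auto
    have "a \<odot>\<^bsub>free\<^esub> \<psi> \<ominus>\<^bsub>free\<^esub> a \<odot>\<^bsub>free\<^esub> \<phi> = a \<odot>\<^bsub>free\<^esub> (\<psi> \<ominus>\<^bsub>free\<^esub> \<phi>)"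
      using \<psi>(1) assms
      by (simp add: F.M.minus_eq F.smult_r_distr F.smult_r_minus del: free_module_simps)
    also have "\<dots> \<in> rel"
      using F.submoduleE(4)[OF rel_submodule] assms(1) \<psi>(2) by blast
    finally show "coset (a \<odot>\<^bsub>free\<^esub> \<psi>) = coset (a \<odot>\<^bsub>free\<^esub> \<phi>)"
      using assms \<psi>(1) by (intro coset_eqI F.smult_closed)
  qed
  also have "\<dots> = coset (a \<odot>\<^bsub>free\<^esub> \<phi>)"
    using S.a_rcos_self[OF assms(2)] by auto
  finally show ?thesis .
qed

lemma tensor_is_module: "module K (tensor K M N)"
  by (rule module_image[OF F.module_axioms, where c = "\<lambda>\<phi>. coset \<phi>"])
    (simp_all only: tensor_carrier tensor_zero tensor_add tensor_smult)

lemma tens_in: "\<lbrakk>m \<in> carrier M; n \<in> carrier N\<rbrakk> \<Longrightarrow> tens K M N m n \<in> carrier (tensor K M N)"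
  unfolding tens_def tensor_carrier by (intro imageI gen_closed)

lemma tens_bilinear_map: "bilinear_map K M N (tensor K M N) (tens K M N)"
proof -
  note [simp del] = free_module_simps
  have "coset (gen (m \<oplus>\<^bsub>M\<^esub> m') n) = coset (gen m n \<oplus>\<^bsub>free\<^esub> gen m' n)"
    if "m \<in> carrier M" "m' \<in> carrier M" "n \<in> carrier N" for m m' n
    using that
    by (intro coset_eqI gen_closed F.M.a_closed M.a_closed subsetD[OF generators_rel])
      (unfold tensor_generators_def Let_def, blast+)
  moreover have "coset (gen m (n \<oplus>\<^bsub>N\<^esub> n')) = coset (gen m n \<oplus>\<^bsub>free\<^esub> gen m n')"
    if "m \<in> carrier M" "n \<in> carrier N" "n' \<in> carrier N" for m n n'
    using that
    by (intro coset_eqI gen_closed F.M.a_closed N.a_closed subsetD[OF generators_rel])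
      (unfold tensor_generators_def Let_def, blast+)
  moreover have "coset (gen (a \<odot>\<^bsub>M\<^esub> m) n) = coset (a \<odot>\<^bsub>free\<^esub> gen m n)"
    if "a \<in> carrier K" "m \<in> carrier M" "n \<in> carrier N" for a m n
    using that
    by (intro coset_eqI gen_closed F.smult_closed M.smult_closed subsetD[OF generators_rel])
      (unfold tensor_generators_def Let_def, blast+)
  moreover have "coset (gen m (a \<odot>\<^bsub>N\<^esub> n)) = coset (a \<odot>\<^bsub>free\<^esub> gen m n)"
    if "a \<in> carrier K" "m \<in> carrier M" "n \<in> carrier N" for a m n
    using that
    by (intro coset_eqI gen_closed F.smult_closed N.smult_closed subsetD[OF generators_rel])
      (unfold tensor_generators_def Let_def, blast+)
  ultimately show ?thesis
    unfolding bilinear_map_def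
    by (intro conjI ballI linear_mapI tens_in)
      (auto simp: tens_def tensor_add tensor_smult gen_closed)
qed

lemma tensor_induction [consumes 1, case_names zero add smult_tens]:
  assumes "t \<in> carrier (tensor K M N)"
    and zero: "P \<zero>\<^bsub>tensor K M N\<^esub>"
    and add: "\<And>s t. \<lbrakk>s \<in> carrier (tensor K M N); t \<in> carrier (tensor K M N); P s; P t\<rbrakk>
      \<Longrightarrow> P (s \<oplus>\<^bsub>tensor K M N\<^esub> t)"
    and tens: "\<And>a m n. \<lbrakk>a \<in> carrier K; m \<in> carrier M; n \<in> carrier N\<rbrakk>
      \<Longrightarrow> P (a \<odot>\<^bsub>tensor K M N\<^esub> tens K M N m n)"
  shows "P t"
proof -
  obtain \<phi> where "\<phi> \<in> carrier free" and t: "t = coset \<phi>"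
    using assms(1) by (auto simp: tensor_carrier)
  then have "P (coset \<phi>)"
  proof (induction \<phi> arbitrary: t rule: M.R.free_module_induct)
    case zero
    show ?case using assms(2) by (simp add: tensor_zero)
  next
    case (add \<phi> \<psi>)
    then show ?case
      using assms(3)[of "coset \<phi>" "coset \<psi>"] by (auto simp: tensor_add tensor_carrier)
  next
    case (gen a q)
    then show ?case
      using tens[of a "fst q" "snd q"] tensor_smult[of a "free_gen K q"] gen_closed[of "fst q" "snd q"]
      by (auto simp: tens_def)
  qed
  with t show ?thesis by simp
qed

context
  fixes P :: "('k, 'c, 'p) module_scheme" and \<beta> :: "'a \<Rightarrow> 'b \<Rightarrow> 'c"
  assumes P: "module K P" and \<beta>: "bilinear_map K M N P \<beta>"
begin

interpretation P: module K P by (rule P)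

lemma bilinear_funcset: "(\<lambda>q. \<beta> (fst q) (snd q)) \<in> carrier M \<times> carrier N \<rightarrow> carrier P"
  using bilinear_map_closed[OF \<beta>] by auto

text \<open>Bilinearity of \<beta> makes the linear extension vanish on the four families of
  generators. Its kernel is a submodule, hence contains the least submodule with these
  generators.\<close>

lemma rel_free_lift:
  assumes "\<phi> \<in> rel"
  shows "free_lift K P (\<lambda>q. \<beta> (fst q) (snd q)) \<phi> = \<zero>\<^bsub>P\<^esub>"
proof -
  let ?L = "free_lift K P (\<lambda>q. \<beta> (fst q) (snd q))"
  note [simp del] = free_module_simps
  note L = P.free_lift_linear[OF bilinear_funcset]
  have gen: "?L (gen m n) = \<beta> m n" if "m \<in> carrier M" "n \<in> carrier N" for m n
    using P.free_lift_gen[OF bilinear_funcset, of "(m, n)"] that by simp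
  have ker: "?L (\<phi> \<ominus>\<^bsub>free\<^esub> \<psi>) = \<zero>\<^bsub>P\<^esub>"
    if "\<phi> \<in> carrier free" "\<psi> \<in> carrier free" "?L \<phi> = ?L \<psi>" for \<phi> \<psi>
    using that linear_map_closed[OF L, of \<psi>]
    by (simp add: linear_map_minus[OF F.module_axioms P L] P.M.minus_eq P.M.r_neg)
  note bil = bilinear_map_linear[OF \<beta>]
  have "tensor_generators K M N \<subseteq> {\<phi> \<in> carrier free. ?L \<phi> = \<zero>\<^bsub>P\<^esub>}"
  proof (intro subsetI CollectI conjI)
    fix \<phi> assume "\<phi> \<in> tensor_generators K M N"
    then show "?L \<phi> = \<zero>\<^bsub>P\<^esub>"
      unfolding tensor_generators_def Let_def
      by (elim UnE CollectE exE conjE; simp only:; intro ker)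
        (simp_all add: linear_map_add[OF L] linear_map_smult[OF L] gen gen_closed
          linear_map_add[OF bil(1)] linear_map_smult[OF bil(1)]
          linear_map_add[OF bil(2)] linear_map_smult[OF bil(2)])
  qed (use tensor_generators_subset in blast)
  then have "rel \<subseteq> {\<phi> \<in> carrier free. ?L \<phi> = \<zero>\<^bsub>P\<^esub>}"
    by (intro rel_least submodule_kernel L F.module_axioms P)
  with assms show ?thesis by auto
qed

text \<open>By \<open>rel_free_lift\<close> the extension is constant on a coset, so the image in
  \<open>tensor_lift_def\<close> is a singleton and \<open>the_elem\<close> returns its
  element.\<close>

lemma tensor_lift_coset:
  assumes "\<phi> \<in> carrier free"
  shows "tensor_lift K P \<beta> (coset \<phi>) = free_lift K P (\<lambda>q. \<beta> (fst q) (snd q)) \<phi>"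
proof -
  let ?L = "free_lift K P (\<lambda>q. \<beta> (fst q) (snd q))"
  note L = P.free_lift_linear[OF bilinear_funcset]
  have "?L \<psi> = ?L \<phi>" if "\<psi> \<in> coset \<phi>" for \<psi>
  proof -
    have "\<psi> \<in> carrier free" and "\<psi> \<ominus>\<^bsub>free\<^esub> \<phi> \<in> rel"
      using coset_memD[OF assms that] by auto
    then have "?L \<psi> \<ominus>\<^bsub>P\<^esub> ?L \<phi> = \<zero>\<^bsub>P\<^esub>"
      using rel_free_lift[of "\<psi> \<ominus>\<^bsub>free\<^esub> \<phi>"] assms
      by (simp only: linear_map_minus[OF F.module_axioms P L])
    then show ?thesis
      using linear_map_closed[OF L \<open>\<psi> \<in> carrier free\<close>] linear_map_closed[OF L assms]
      by (rule P.M.minus_eq_zeroD)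
  qed
  then have "?L ` coset \<phi> = (\<lambda>_. ?L \<phi>) ` coset \<phi>"
    by (rule image_cong[OF refl])
  also have "\<dots> = {?L \<phi>}"
    using S.a_rcos_self[OF assms] by (rule image_constant)
  finally have "?L ` coset \<phi> = {?L \<phi>}" .
  then show ?thesis
    unfolding tensor_lift_def free_lift_def by simp
qed

lemma tensor_lift_is_linear: "linear_map K (tensor K M N) P (tensor_lift K P \<beta>)"
proof -
  note [simp del] = free_module_simps
  note L = P.free_lift_linear[OF bilinear_funcset]
  show ?thesis
    by (rule linear_mapI)
      (auto simp: tensor_carrier tensor_add tensor_smult tensor_lift_coset linear_map_add[OF L]
        linear_map_smult[OF L] intro: linear_map_closed[OF L])
qed

lemma tensor_lift_of_tens:
  "\<lbrakk>m \<in> carrier M; n \<in> carrier N\<rbrakk> \<Longrightarrow> tensor_lift K P \<beta> (tens K M N m n) = \<beta> m n"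
  unfolding tens_def
  using P.free_lift_gen[OF bilinear_funcset, of "(m, n)"] by (simp add: tensor_lift_coset gen_closed)

end

end

lemma tensor_module [simp]: "\<lbrakk>module K M; module K N\<rbrakk> \<Longrightarrow> module K (tensor K M N)"
  by (rule tensor_pair.tensor_is_module[OF tensor_pair.intro])

lemma tens_closed [simp]:
  "\<lbrakk>module K M; module K N; m \<in> carrier M; n \<in> carrier N\<rbrakk>
   \<Longrightarrow> tens K M N m n \<in> carrier (tensor K M N)"
  by (rule tensor_pair.tens_in[OF tensor_pair.intro])

lemma tens_bilinear:
  "\<lbrakk>module K M; module K N\<rbrakk> \<Longrightarrow> bilinear_map K M N (tensor K M N) (tens K M N)"
  by (rule tensor_pair.tens_bilinear_map[OF tensor_pair.intro])

lemmas tensor_induct [consumes 3, case_names zero add smult_tens] =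
  tensor_pair.tensor_induction[OF tensor_pair.intro]

lemma tensor_lift_linear:
  "\<lbrakk>module K M; module K N; module K P; bilinear_map K M N P \<beta>\<rbrakk>
   \<Longrightarrow> linear_map K (tensor K M N) P (tensor_lift K P \<beta>)"
  by (rule tensor_pair.tensor_lift_is_linear[OF tensor_pair.intro])

lemma tensor_lift_tens:
  "\<lbrakk>module K M; module K N; module K P; bilinear_map K M N P \<beta>; m \<in> carrier M; n \<in> carrier N\<rbrakk>
   \<Longrightarrow> tensor_lift K P \<beta> (tens K M N m n) = \<beta> m n"
  by (rule tensor_pair.tensor_lift_of_tens[OF tensor_pair.intro])

text \<open>Pure tensors span. This reduces identities between linear maps on a tensor product to
  computations on m \<otimes> n.\<close>

lemma tensor_ext:
  assumes "module K M" "module K N" "module K P"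
    and f: "linear_map K (tensor K M N) P f" and g: "linear_map K (tensor K M N) P g"
    and "\<And>m n. \<lbrakk>m \<in> carrier M; n \<in> carrier N\<rbrakk> \<Longrightarrow> f (tens K M N m n) = g (tens K M N m n)"
    and "t \<in> carrier (tensor K M N)"
  shows "f t = g t"
  using assms(1,2,7)
proof (induction t rule: tensor_induct)
  case zero
  show ?case
    using assms(1-3) by (simp add: linear_map_zero[OF _ _ f] linear_map_zero[OF _ _ g])
next
  case (add s t)
  then show ?case by (simp add: linear_map_add[OF f] linear_map_add[OF g])
next
  case (smult_tens a m n)
  then show ?case using assms by (simp add: linear_map_smult[OF f] linear_map_smult[OF g])
qed

lemma foldSetD_cong:
  assumes "(B, z) \<in> foldSetD D f e" "B \<subseteq> A" "\<And>x y. x \<in> A \<Longrightarrow> f x y = g x y"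
  shows "(B, z) \<in> foldSetD D g e"
  using assms(1,2)
proof (induction rule: foldSetD.induct)
  case emptyI
  then show ?case by (simp add: foldSetD.emptyI)
next
  case (insertI x B y)
  then have "g x y = f x y"
    by (simp add: assms(3))
  then show ?case
    using insertI foldSetD.insertI[of x B g y D e] by simp
qed

text \<open>The values of \<beta> are not known to lie in a module here, so the sums are compared
  through the relation \<open>foldSetD\<close>, which sees the summand on the index set only. In
  return, sums can be rewritten before bilinearity is established.\<close>

lemma tensor_lift_cong:
  assumes "module K M" "module K N" "t \<in> carrier (tensor K M N)"
    and "\<And>m n. \<lbrakk>m \<in> carrier M; n \<in> carrier N\<rbrakk> \<Longrightarrow> \<beta> m n = \<beta>' m n"
  shows "tensor_lift K P \<beta> t = tensor_lift K P \<beta>' t"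
proof -
  interpret tensor_pair K M N by (intro tensor_pair.intro assms)
  obtain \<phi> where \<phi>: "\<phi> \<in> carrier free" "t = coset \<phi>"
    using assms(3) by (auto simp: tensor_carrier)
  have "(\<Oplus>\<^bsub>P\<^esub>q\<in>{q. \<psi> q \<noteq> \<zero>\<^bsub>K\<^esub>}. \<psi> q \<odot>\<^bsub>P\<^esub> \<beta> (fst q) (snd q)) =
      (\<Oplus>\<^bsub>P\<^esub>q\<in>{q. \<psi> q \<noteq> \<zero>\<^bsub>K\<^esub>}. \<psi> q \<odot>\<^bsub>P\<^esub> \<beta>' (fst q) (snd q))" if "\<psi> \<in> t" for \<psi>
  proof -
    have "\<psi> \<in> carrier free"
      using coset_memD \<phi> that by blast
    then have "\<psi> q \<odot>\<^bsub>P\<^esub> \<beta> (fst q) (snd q) = \<psi> q \<odot>\<^bsub>P\<^esub> \<beta>' (fst q) (snd q)" if "\<psi> q \<noteq> \<zero>\<^bsub>K\<^esub>" for q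
      using assms(4)[of "fst q" "snd q"] that by (fastforce simp: free_module_carrier)
    then show ?thesis
      unfolding finsum_def finprod_def foldD_def
      using foldSetD_cong[of _ _ _ "\<lambda>q. add P (\<psi> q \<odot>\<^bsub>P\<^esub> \<beta> (fst q) (snd q))" _ "{q. \<psi> q \<noteq> \<zero>\<^bsub>K\<^esub>}"
          "\<lambda>q. add P (\<psi> q \<odot>\<^bsub>P\<^esub> \<beta>' (fst q) (snd q))"]
        foldSetD_cong[of _ _ _ "\<lambda>q. add P (\<psi> q \<odot>\<^bsub>P\<^esub> \<beta>' (fst q) (snd q))" _ "{q. \<psi> q \<noteq> \<zero>\<^bsub>K\<^esub>}"
          "\<lambda>q. add P (\<psi> q \<odot>\<^bsub>P\<^esub> \<beta> (fst q) (snd q))"]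
      by (intro if_cong refl arg_cong[where f = The] ext) (auto simp: comp_def)
  qed
  then show ?thesis
    unfolding tensor_lift_def by (intro arg_cong[where f = the_elem] image_cong) auto
qed

text \<open>The modules \<open>M\<close> and \<open>N\<close> are redundant here; they let the simplifier instantiate the side
  conditions of the rules below.\<close>

definition tsum :: "('k, 'z) ring_scheme \<Rightarrow> ('k, 'a, 'm) module_scheme \<Rightarrow>
    ('k, 'b, 'n) module_scheme \<Rightarrow> ('k, 'c, 'p) module_scheme \<Rightarrow>
    ('a \<Rightarrow> 'b \<Rightarrow> 'c) \<Rightarrow> ('a \<times> 'b \<Rightarrow> 'k) set \<Rightarrow> 'c" where
  "tsum K M N P \<beta> t = tensor_lift K P \<beta> t"

lemma bilinear_mapI' [simp]:
  assumes "\<And>n. n \<in> carrier N \<Longrightarrow> linear_map K M P (\<lambda>m. \<beta> m n)"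
    and "\<And>m. m \<in> carrier M \<Longrightarrow> linear_map K N P (\<lambda>n. \<beta> m n)"
  shows "bilinear_map K M N P (\<lambda>m n. \<beta> m n)"
  using assms by (rule bilinear_mapI)

text \<open>As a congruence rule it hands the simplifier the membership of the bound variables in
  the carriers, from which the side conditions of rewriting under a sum are discharged.\<close>

lemma tsum_cong [cong]:
  assumes "module K M" "module K N" "t = t'" "t' \<in> carrier (tensor K M N)"
    and "\<And>m n. \<lbrakk>m \<in> carrier M; n \<in> carrier N\<rbrakk> \<Longrightarrow> \<beta> m n = \<beta>' m n"
  shows "tsum K M N P \<beta> t = tsum K M N P \<beta>' t'"
  unfolding tsum_def assms(3) using assms(1,2,4,5) by (rule tensor_lift_cong)

lemma base_module_simps [simp]:
  "carrier (base_module K) = carrier K"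
  "zero (base_module K) = zero K"
  "add (base_module K) = add K"
  "smult (base_module K) = mult K"
  by (simp_all add: base_module_def)

lemma base_module_module [simp]: "cring K \<Longrightarrow> module K (base_module K)"
proof -
  assume "cring K"
  then interpret cring K .
  show "module K (base_module K)"
    by (rule moduleI[OF \<open>cring K\<close>])
      (auto intro!: abelian_groupI simp: l_distr r_distr m_assoc a_ac intro: l_neg a_inv_closed)
qed

lemma tsum_linear:
  "\<lbrakk>module K M; module K N; module K P; bilinear_map K M N P \<beta>\<rbrakk>
   \<Longrightarrow> linear_map K (tensor K M N) P (tsum K M N P \<beta>)"
  unfolding tsum_def by (rule tensor_lift_linear)

lemma tsum_closed [simp]:
  "\<lbrakk>module K M; module K N; module K P; bilinear_map K M N P \<beta>; t \<in> carrier (tensor K M N)\<rbrakk>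
   \<Longrightarrow> tsum K M N P \<beta> t \<in> carrier P"
  by (rule linear_map_closed[OF tsum_linear])

lemma tsum_tens [simp]:
  "\<lbrakk>module K M; module K N; module K P; bilinear_map K M N P \<beta>; m \<in> carrier M; n \<in> carrier N\<rbrakk>
   \<Longrightarrow> tsum K M N P \<beta> (tens K M N m n) = \<beta> m n"
  unfolding tsum_def by (rule tensor_lift_tens)

section \<open>Linearity of expressions containing sums\<close>

lemma linear_id [simp]: "linear_map K M M (\<lambda>x. x)"
  by (auto simp: linear_map_def)

lemma linear_comp:
  assumes "linear_map K N P f" "linear_map K M N g"
  shows "linear_map K M P (\<lambda>x. f (g x))"
  using assms by (auto simp: linear_map_def Pi_iff)

lemma linear_smult_r [simp]:
  assumes "module K P" "a \<in> carrier K" "linear_map K M P f"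
  shows "linear_map K M P (\<lambda>x. a \<odot>\<^bsub>P\<^esub> f x)"
proof -
  interpret P: module K P by fact
  have "a \<odot>\<^bsub>P\<^esub> (b \<odot>\<^bsub>P\<^esub> f x) = b \<odot>\<^bsub>P\<^esub> (a \<odot>\<^bsub>P\<^esub> f x)" if "b \<in> carrier K" "x \<in> carrier M" for b x
    using that assms linear_map_closed[OF assms(3)]
    by (simp add: P.smult_assoc1[symmetric] P.R.m_comm)
  then show ?thesis
    using assms by (auto simp: linear_map_def Pi_iff P.smult_r_distr)
qed

lemma linear_smult_l [simp]:
  assumes "module K P" "p \<in> carrier P" "linear_map K M (base_module K) f"
  shows "linear_map K M P (\<lambda>x. f x \<odot>\<^bsub>P\<^esub> p)"
proof -
  interpret P: module K P by fact
  show ?thesis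
    using assms by (auto simp: linear_map_def Pi_iff P.smult_l_distr P.smult_assoc1)
qed

lemma linear_tens_l [simp]:
  "\<lbrakk>module K M; module K N; n \<in> carrier N; linear_map K X M f\<rbrakk>
   \<Longrightarrow> linear_map K X (tensor K M N) (\<lambda>x. tens K M N (f x) n)"
  by (rule linear_comp[OF bilinear_map_linear(1)[OF tens_bilinear]])

lemma linear_tens_r [simp]:
  "\<lbrakk>module K M; module K N; m \<in> carrier M; linear_map K X N f\<rbrakk>
   \<Longrightarrow> linear_map K X (tensor K M N) (\<lambda>x. tens K M N m (f x))"
  by (rule linear_comp[OF bilinear_map_linear(2)[OF tens_bilinear]])

lemma linear_tsum_arg [simp]:
  "\<lbrakk>module K M; module K N; module K P; bilinear_map K M N P \<beta>; linear_map K X (tensor K M N) f\<rbrakk>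
   \<Longrightarrow> linear_map K X P (\<lambda>x. tsum K M N P \<beta> (f x))"
  by (rule linear_comp[OF tsum_linear])

lemma linear_add:
  assumes "module K P" "linear_map K M P f" "linear_map K M P g"
  shows "linear_map K M P (\<lambda>x. f x \<oplus>\<^bsub>P\<^esub> g x)"
proof -
  interpret P: module K P by fact
  show ?thesis
    using assms by (auto simp: linear_map_def Pi_iff P.smult_r_distr P.M.a_ac)
qed

text \<open>Here the variable sits in the summand and the tensor t is fixed. Additivity and
  homogeneity in x are themselves equations between linear functions of t, so they can be tested on
  pure tensors.\<close>

lemma linear_tsum_fun [simp]:
  assumes M: "module K M" "module K N" "module K P" and t: "t \<in> carrier (tensor K M N)"
    and lin: "\<And>m n. \<lbrakk>m \<in> carrier M; n \<in> carrier N\<rbrakk> \<Longrightarrow> linear_map K X P (\<lambda>x. \<gamma> x m n)"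
    and bil: "\<And>x. x \<in> carrier X \<Longrightarrow> bilinear_map K M N P (\<gamma> x)"
    and "module K X"
  shows "linear_map K X P (\<lambda>x. tsum K M N P (\<gamma> x) t)"
proof (rule linear_mapI)
  interpret X: module K X by fact
  fix x assume x: "x \<in> carrier X"
  show "tsum K M N P (\<gamma> x) t \<in> carrier P"
    using M t bil[OF x] by simp
  { fix y assume y: "y \<in> carrier X"
    show "tsum K M N P (\<gamma> (x \<oplus>\<^bsub>X\<^esub> y)) t = tsum K M N P (\<gamma> x) t \<oplus>\<^bsub>P\<^esub> tsum K M N P (\<gamma> y) t"
      by (rule tensor_ext[OF M _ _ _ t, where f = "tsum K M N P (\<gamma> (x \<oplus>\<^bsub>X\<^esub> y))"
            and g = "\<lambda>t. tsum K M N P (\<gamma> x) t \<oplus>\<^bsub>P\<^esub> tsum K M N P (\<gamma> y) t"])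
        (use x y M bil lin in \<open>auto intro: tsum_linear linear_add simp: linear_map_add[OF lin] cong del: tsum_cong\<close>) }
  fix a assume a: "a \<in> carrier K"
  show "tsum K M N P (\<gamma> (a \<odot>\<^bsub>X\<^esub> x)) t = a \<odot>\<^bsub>P\<^esub> tsum K M N P (\<gamma> x) t"
    by (rule tensor_ext[OF M _ _ _ t, where f = "tsum K M N P (\<gamma> (a \<odot>\<^bsub>X\<^esub> x))"
          and g = "\<lambda>t. a \<odot>\<^bsub>P\<^esub> tsum K M N P (\<gamma> x) t"])
      (use x a M bil lin in \<open>auto intro: tsum_linear linear_smult_r simp: linear_map_smult[OF lin] cong del: tsum_cong\<close>)
qed

text \<open>Both sides are linear in t and agree on pure tensors. The rules below that pull a sum
  out of an expression are instances.\<close>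

lemma linear_tsum:
  assumes "module K M" "module K N" "module K P" "module K Q" "bilinear_map K M N P \<beta>"
    and f: "linear_map K P Q f" and "t \<in> carrier (tensor K M N)"
  shows "f (tsum K M N P \<beta> t) = tsum K M N Q (\<lambda>m n. f (\<beta> m n)) t"
proof -
  have "bilinear_map K M N Q (\<lambda>m n. f (\<beta> m n))"
    using bilinear_map_linear[OF assms(5)] by (intro bilinear_mapI linear_comp[OF f])
  moreover have "tsum K M N P \<beta> (tens K M N m n) = \<beta> m n" if "m \<in> carrier M" "n \<in> carrier N" for m n
    using assms(1-3,5) that by (rule tsum_tens)
  ultimately show ?thesis
    using assms(1-5,7)
    by (intro tensor_ext[OF assms(1,2,4) _ _ _ assms(7), where f = "\<lambda>t. f (tsum K M N P \<beta> t)"]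
        linear_comp[OF f] tsum_linear) simp_all
qed

lemma tsum_tens_id:
  assumes "module K M" "module K N" "t \<in> carrier (tensor K M N)"
  shows "tsum K M N (tensor K M N) (\<lambda>m n. tens K M N m n) t = t"
  using assms tens_bilinear[OF assms(1,2)]
  by (intro tensor_ext[OF assms(1,2) _ _ _ _ assms(3),
        where P = "tensor K M N" and g = "\<lambda>t. t"] tsum_linear
      tensor_module) simp_all

text \<open>With t fixed, both sides are linear in s, and for a pure tensor the sum over s
  disappears. Only sums whose tensors do not depend on each other's variables can be interchanged in
  this way; legs of one element are regrouped by coassociativity.\<close>

lemma tsum_swap:
  assumes "module K A" "module K B" "module K C" "module K D" "module K P"
    and "s \<in> carrier (tensor K A B)" "t \<in> carrier (tensor K C D)"
    and "\<And>a b. \<lbrakk>a \<in> carrier A; b \<in> carrier B\<rbrakk> \<Longrightarrow> bilinear_map K C D P (\<gamma> a b)"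
    and "\<And>c d. \<lbrakk>c \<in> carrier C; d \<in> carrier D\<rbrakk> \<Longrightarrow> bilinear_map K A B P (\<lambda>a b. \<gamma> a b c d)"
  shows "tsum K A B P (\<lambda>a b. tsum K C D P (\<lambda>c d. \<gamma> a b c d) t) s =
    tsum K C D P (\<lambda>c d. tsum K A B P (\<lambda>a b. \<gamma> a b c d) s) t"
proof -
  note b = assms(8,9)[THEN bilinear_map_linear(1)] assms(8,9)[THEN bilinear_map_linear(2)]
  have 1: "bilinear_map K A B P (\<lambda>a b. tsum K C D P (\<lambda>c d. \<gamma> a b c d) t)"
    using assms(1-7) b assms(8) by (intro bilinear_mapI linear_tsum_fun) auto
  have 2: "bilinear_map K C D P (\<lambda>c d. tsum K A B P (\<lambda>a b. \<gamma> a b c d) s)"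
    if "s \<in> carrier (tensor K A B)" for s
    using assms(1-5) that b assms(9) by (intro bilinear_mapI linear_tsum_fun) auto
  show ?thesis
  proof (rule tensor_ext[where f = "tsum K A B P (\<lambda>a b. tsum K C D P (\<lambda>c d. \<gamma> a b c d) t)"
        and g = "\<lambda>s. tsum K C D P (\<lambda>c d. tsum K A B P (\<lambda>a b. \<gamma> a b c d) s) t" and K = K
        and M = A and N = B and P = P])
    show "linear_map K (tensor K A B) P
        (\<lambda>s. tsum K C D P (\<lambda>c d. tsum K A B P (\<lambda>a b. \<gamma> a b c d) s) t)"
      using assms(1-7) assms(9) 2 by (intro linear_tsum_fun tsum_linear) auto
  next
    fix m n assume "m \<in> carrier A" "n \<in> carrier B"
    then show "tsum K A B P (\<lambda>a b. tsum K C D P (\<gamma> a b) t) (tens K A B m n) =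
        tsum K C D P (\<lambda>c d. tsum K A B P (\<lambda>a b. \<gamma> a b c d) (tens K A B m n)) t"
      using assms(1-7) 1 assms(9) by (simp del: bilinear_mapI')
  qed (use assms 1 in \<open>auto intro: tsum_linear\<close>)
qed

section \<open>Sweedler calculus\<close>

text \<open>\<open>tensor\<close> and \<open>tens\<close> inspect only \<open>carrier\<close>,
  \<open>add\<close> and \<open>smult\<close> of the factors, so that algebras, comodules and bare
  spaces on the same data have literally equal tensor products.\<close>

lemma tensor_record_cong:
  assumes "carrier M = carrier M'" "add M = add M'" "smult M = smult M'"
    and "carrier N = carrier N'" "add N = add N'" "smult N = smult N'"
  shows "tensor K M N = tensor K M' N'" "tens K M N = tens K M' N'"
  using assms by (simp_all add: tensor_def tens_def tensor_relations_def fun_eq_iff)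

lemma tensor_algebra_simps [simp]:
  "carrier (tensor_algebra K A B) = carrier (tensor K A B)"
  "add (tensor_algebra K A B) = add (tensor K A B)"
  "zero (tensor_algebra K A B) = zero (tensor K A B)"
  "smult (tensor_algebra K A B) = smult (tensor K A B)"
  by (simp_all add: tensor_algebra_def Let_def)

lemma tensor_tensor_algebra [simp]:
  "tensor K (tensor_algebra K A B) N = tensor K (tensor K A B) N"
  "tens K (tensor_algebra K A B) N = tens K (tensor K A B) N"
  "tensor K N (tensor_algebra K A B) = tensor K N (tensor K A B)"
  "tens K N (tensor_algebra K A B) = tens K N (tensor K A B)"
  by (rule tensor_record_cong; simp)+

lemma tensor_map_eq_tsum:
  "tensor_map K M' N' f g t = tsum K M N (tensor K M' N') (\<lambda>m n. tens K M' N' (f m) (g n)) t"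
  by (simp add: tsum_def tensor_map_def)

lemma tensor_assoc_eq_tsum:
  "tensor_assoc K M N P t =
     tsum K (tensor K M N) P (tensor K M (tensor K N P))
       (\<lambda>s p. tsum K M N (tensor K M (tensor K N P))
          (\<lambda>m n. tens K M (tensor K N P) m (tens K N P n p)) s) t"
  by (simp add: tsum_def tensor_assoc_def Let_def)

lemma tensor_algebra_mult_eq_tsum:
  "X \<otimes>\<^bsub>tensor_algebra K A B\<^esub> Y =
     tsum K A B (tensor K A B) (\<lambda>a b. tsum K A B (tensor K A B)
       (\<lambda>a' b'. tens K A B (a \<otimes>\<^bsub>A\<^esub> a') (b \<otimes>\<^bsub>B\<^esub> b')) Y) X"
  by (simp add: tsum_def tensor_algebra_def Let_def)

text \<open>With these rules every sum moves outwards.\<close>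

lemma tens_tsum_l [simp]:
  assumes "module K A" "module K B" "module K M" "module K N"
    "bilinear_map K A B M \<beta>" "t \<in> carrier (tensor K A B)" "n \<in> carrier N"
  shows "tens K M N (tsum K A B M \<beta> t) n = tsum K A B (tensor K M N) (\<lambda>a b. tens K M N (\<beta> a b) n) t"
  using assms by (intro linear_tsum[where f = "\<lambda>m. tens K M N m n" and Q = "tensor K M N"]) auto

lemma tens_tsum_r [simp]:
  assumes "module K A" "module K B" "module K M" "module K N"
    "bilinear_map K A B N \<beta>" "t \<in> carrier (tensor K A B)" "m \<in> carrier M"
  shows "tens K M N m (tsum K A B N \<beta> t) = tsum K A B (tensor K M N) (\<lambda>a b. tens K M N m (\<beta> a b)) t"
  using assms by (intro linear_tsum[where f = "\<lambda>n. tens K M N m n" and Q = "tensor K M N"]) auto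

lemma smult_tsum [simp]:
  assumes "module K A" "module K B" "module K P"
    "bilinear_map K A B P \<beta>" "t \<in> carrier (tensor K A B)" "k \<in> carrier K"
  shows "k \<odot>\<^bsub>P\<^esub> tsum K A B P \<beta> t = tsum K A B P (\<lambda>a b. k \<odot>\<^bsub>P\<^esub> \<beta> a b) t"
  using assms by (intro linear_tsum[where f = "\<lambda>p. k \<odot>\<^bsub>P\<^esub> p" and Q = P and K = K]) auto

lemma tsum_smult [simp]:
  assumes "module K A" "module K B" "module K P"
    "bilinear_map K A B (base_module K) \<beta>" "t \<in> carrier (tensor K A B)" "p \<in> carrier P"
  shows "tsum K A B (base_module K) \<beta> t \<odot>\<^bsub>P\<^esub> p = tsum K A B P (\<lambda>a b. \<beta> a b \<odot>\<^bsub>P\<^esub> p) t"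
proof -
  have "cring K"
    using assms(1) by (simp add: module_def)
  then show ?thesis
    using assms
    by (intro linear_tsum[where f = "\<lambda>k. k \<odot>\<^bsub>P\<^esub> p" and Q = P and P = "base_module K" and K = K]) auto
qed

lemma tsum_tsum [simp]:
  assumes "module K A" "module K B" "module K C" "module K D" "module K P"
    "bilinear_map K A B (tensor K C D) \<beta>" "t \<in> carrier (tensor K A B)" "bilinear_map K C D P \<gamma>"
  shows "tsum K C D P \<gamma> (tsum K A B (tensor K C D) \<beta> t) =
    tsum K A B P (\<lambda>a b. tsum K C D P \<gamma> (\<beta> a b)) t"
  using assms
  by (intro linear_tsum[where f = "\<lambda>s. tsum K C D P \<gamma> s" and Q = P] tsum_linear) auto

lemma tsum_smult_tens [simp]:
  assumes "module K C" "module K D" "module K P" "bilinear_map K C D P \<gamma>"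
    "k \<in> carrier K" "t \<in> carrier (tensor K C D)"
  shows "tsum K C D P \<gamma> (k \<odot>\<^bsub>tensor K C D\<^esub> t) = k \<odot>\<^bsub>P\<^esub> tsum K C D P \<gamma> t"
  using assms by (intro linear_map_smult[OF tsum_linear]) auto

definition trilinear_map :: "('k, 'z) ring_scheme \<Rightarrow> ('k, 'a, 'm) module_scheme \<Rightarrow>
    ('k, 'b, 'n) module_scheme \<Rightarrow> ('k, 'c, 'p) module_scheme \<Rightarrow> ('k, 'd, 'q) module_scheme \<Rightarrow>
    ('a \<Rightarrow> 'b \<Rightarrow> 'c \<Rightarrow> 'd) \<Rightarrow> bool" where
  "trilinear_map K A B C P \<gamma> \<longleftrightarrow>
     (\<forall>b\<in>carrier B. \<forall>c\<in>carrier C. linear_map K A P (\<lambda>a. \<gamma> a b c)) \<and>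
     (\<forall>a\<in>carrier A. \<forall>c\<in>carrier C. linear_map K B P (\<lambda>b. \<gamma> a b c)) \<and>
     (\<forall>a\<in>carrier A. \<forall>b\<in>carrier B. linear_map K C P (\<lambda>c. \<gamma> a b c))"

lemma trilinear_mapI [simp]:
  assumes "\<And>b c. \<lbrakk>b \<in> carrier B; c \<in> carrier C\<rbrakk> \<Longrightarrow> linear_map K A P (\<lambda>a. \<gamma> a b c)"
    and "\<And>a c. \<lbrakk>a \<in> carrier A; c \<in> carrier C\<rbrakk> \<Longrightarrow> linear_map K B P (\<lambda>b. \<gamma> a b c)"
    and "\<And>a b. \<lbrakk>a \<in> carrier A; b \<in> carrier B\<rbrakk> \<Longrightarrow> linear_map K C P (\<lambda>c. \<gamma> a b c)"
  shows "trilinear_map K A B C P (\<lambda>a b c. \<gamma> a b c)"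
  using assms by (auto simp: trilinear_map_def)

lemma trilinear_map_linear:
  assumes "trilinear_map K A B C P \<gamma>"
  shows "\<lbrakk>b \<in> carrier B; c \<in> carrier C\<rbrakk> \<Longrightarrow> linear_map K A P (\<lambda>a. \<gamma> a b c)"
    and "\<lbrakk>a \<in> carrier A; c \<in> carrier C\<rbrakk> \<Longrightarrow> linear_map K B P (\<lambda>b. \<gamma> a b c)"
    and "\<lbrakk>a \<in> carrier A; b \<in> carrier B\<rbrakk> \<Longrightarrow> linear_map K C P (\<lambda>c. \<gamma> a b c)"
  using assms by (auto simp: trilinear_map_def)

text \<open>Kept apart from the counit law because the natural coaction on the full space M
  \<otimes> N is coassociative but in general not counital.\<close>

definition coassociative :: "('k, 'z) ring_scheme \<Rightarrow> ('k, 'h, 'w) bialgebra_scheme \<Rightarrow>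
    ('k, 'a, 'm) module_scheme \<Rightarrow> ('a \<Rightarrow> ('a \<times> 'h \<Rightarrow> 'k) set) \<Rightarrow> bool" where
  "coassociative K H V \<rho> \<longleftrightarrow>
     (\<forall>v\<in>carrier V. tensor_assoc K V H H (tensor_map K (tensor K V H) H \<rho> (\<lambda>x. x) (\<rho> v)) =
        tensor_map K V (tensor K H H) (\<lambda>x. x) (comult H) (\<rho> v))"

section \<open>Weak bialgebras\<close>

locale weak_bialg =
  fixes K :: "('k, 'z) ring_scheme" and H :: "('k, 'h, 'w) bialgebra_scheme"
  assumes weak_bialgebra: "weak_bialgebra K H"
begin

abbreviation "\<Delta>\<^sub>1 \<equiv> comult H \<one>\<^bsub>H\<^esub>"

lemma k_algebra_H: "k_algebra K H" and coalgebra_H: "coalgebra K H"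
  using weak_bialgebra by (simp_all add: weak_bialgebra_def)

sublocale H: k_algebra K H by (rule k_algebra_H)

lemma cring_K [simp]: "cring K" and module_H [simp]: "module K H" and ring_H [simp]: "ring H"
  by unfold_locales

text \<open>A copy of \<open>module.smult_closed\<close> with \<open>K\<close> fixed: the simplifier cannot guess \<open>K\<close> from the conclusion.\<close>

lemma smult_closed [simp]:
  "\<lbrakk>module K M; a \<in> carrier K; x \<in> carrier M\<rbrakk> \<Longrightarrow> a \<odot>\<^bsub>M\<^esub> x \<in> carrier M"
  by (rule module.smult_closed)

lemma linear_mult_l [simp]:
  assumes "k_algebra K A" "c \<in> carrier A" "linear_map K X A f"
  shows "linear_map K X A (\<lambda>x. f x \<otimes>\<^bsub>A\<^esub> c)"
proof -
  interpret k_algebra K A by fact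
  show ?thesis
    using assms by (auto simp: linear_map_def Pi_iff l_distr smult_mult_left)
qed

lemma linear_mult_r [simp]:
  assumes "k_algebra K A" "c \<in> carrier A" "linear_map K X A f"
  shows "linear_map K X A (\<lambda>x. c \<otimes>\<^bsub>A\<^esub> f x)"
proof -
  interpret k_algebra K A by fact
  show ?thesis
    using assms by (auto simp: linear_map_def Pi_iff r_distr smult_mult_right)
qed

lemmas linear_mult_H [simp] = linear_mult_l[OF k_algebra_H] linear_mult_r[OF k_algebra_H]

lemma comult_linear: "linear_map K H (tensor K H H) (comult H)"
  and counit_linear: "linear_map K H (base_module K) (counit H)"
  using coalgebra_H by (simp_all add: coalgebra_def)

lemmas linear_comult [simp] = linear_comp[OF comult_linear]
lemmas linear_counit [simp] = linear_comp[OF counit_linear]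
lemmas comult_closed [simp] = linear_map_closed[OF comult_linear]
lemmas counit_closed [simp] = linear_map_closed[OF counit_linear, simplified]

lemma linear_mult_K [simp]:
  "\<lbrakk>a \<in> carrier K; linear_map K X (base_module K) f\<rbrakk> \<Longrightarrow> linear_map K X (base_module K) (\<lambda>x. f x \<otimes>\<^bsub>K\<^esub> a)"
  "\<lbrakk>a \<in> carrier K; linear_map K X (base_module K) f\<rbrakk> \<Longrightarrow> linear_map K X (base_module K) (\<lambda>x. a \<otimes>\<^bsub>K\<^esub> f x)"
  using linear_smult_l[of K "base_module K" a X f] linear_smult_r[of K "base_module K" a X f]
  by simp_all

lemma tsum_mult_l [simp]:
  assumes "module K A" "module K B" "bilinear_map K A B H \<beta>" "t \<in> carrier (tensor K A B)" "c \<in> carrier H"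
  shows "tsum K A B H \<beta> t \<otimes>\<^bsub>H\<^esub> c = tsum K A B H (\<lambda>a b. \<beta> a b \<otimes>\<^bsub>H\<^esub> c) t"
  using assms by (intro linear_tsum[where f = "\<lambda>x. x \<otimes>\<^bsub>H\<^esub> c" and Q = H and K = K]) auto

lemma tsum_mult_r [simp]:
  assumes "module K A" "module K B" "bilinear_map K A B H \<beta>" "t \<in> carrier (tensor K A B)" "c \<in> carrier H"
  shows "c \<otimes>\<^bsub>H\<^esub> tsum K A B H \<beta> t = tsum K A B H (\<lambda>a b. c \<otimes>\<^bsub>H\<^esub> \<beta> a b) t"
  using assms by (intro linear_tsum[where f = "\<lambda>x. c \<otimes>\<^bsub>H\<^esub> x" and Q = H and K = K]) auto

lemma comult_tsum [simp]:
  assumes "module K A" "module K B" "bilinear_map K A B H \<beta>" "t \<in> carrier (tensor K A B)"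
  shows "comult H (tsum K A B H \<beta> t) = tsum K A B (tensor K H H) (\<lambda>a b. comult H (\<beta> a b)) t"
  using assms by (intro linear_tsum[OF _ _ _ _ _ comult_linear]) auto

lemma coassociativeD:
  assumes "module K V" and lin: "linear_map K V (tensor K V H) \<rho>" and "coassociative K H V \<rho>"
    and "module K P" "trilinear_map K V H H P \<gamma>" "v \<in> carrier V"
  shows "tsum K V H P (\<lambda>a c. tsum K V H P (\<lambda>a' b. \<gamma> a' b c) (\<rho> a)) (\<rho> v) =
    tsum K V H P (\<lambda>a b. tsum K H H P (\<lambda>b' c. \<gamma> a b' c) (comult H b)) (\<rho> v)"
proof -
  note [simp] = assms(1,4,6) linear_comp[OF lin] linear_map_closed[OF lin]
    trilinear_map_linear[OF assms(5)]
  let ?HH = "tensor K H H" and ?T = "tensor K V (tensor K H H)"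
  \<comment> \<open>The map on V \<otimes> (H \<otimes> H) induced by \<gamma>. Applied to the two
    sides of coassociativity it yields the two double sums.\<close>
  let ?G = "tsum K V ?HH P (\<lambda>a s. tsum K H H P (\<lambda>b c. \<gamma> a b c) s)"
  have "?G (tensor_assoc K V H H (tensor_map K (tensor K V H) H \<rho> (\<lambda>x. x) (\<rho> v))) =
    ?G (tensor_map K V ?HH (\<lambda>x. x) (comult H) (\<rho> v))"
    using assms(3,6) by (intro arg_cong[where f = ?G]) (simp only: coassociative_def)
  then show ?thesis
    unfolding tensor_assoc_eq_tsum tensor_map_eq_tsum[where M = V and N = H]
    by simp
qed

lemma coassociative_comult: "coassociative K H H (comult H)"
  using coalgebra_H by (simp add: coalgebra_def coassociative_def)

lemmas comult_coassoc = coassociativeD[OF module_H comult_linear coassociative_comult]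

lemma comult_counit_l:
  assumes "module K P" "linear_map K H P f" "h \<in> carrier H"
  shows "tsum K H H P (\<lambda>a b. counit H a \<odot>\<^bsub>P\<^esub> f b) (comult H h) = f h"
proof -
  note [simp] = assms linear_comp[OF assms(2)] linear_map_closed[OF assms(2)]
  have "tsum K H H H (\<lambda>a b. counit H a \<odot>\<^bsub>H\<^esub> b) (comult H h) = h"
    using coalgebra_H by (simp add: coalgebra_def tsum_def)
  then have "f h = f (tsum K H H H (\<lambda>a b. counit H a \<odot>\<^bsub>H\<^esub> b) (comult H h))"
    by simp
  also have "\<dots> = tsum K H H P (\<lambda>a b. f (counit H a \<odot>\<^bsub>H\<^esub> b)) (comult H h)"
    by (rule linear_tsum) auto
  finally show ?thesis
    by (simp add: linear_map_smult[OF assms(2)])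
qed

lemma comult_counit_r:
  assumes "module K P" "linear_map K H P f" "h \<in> carrier H"
  shows "tsum K H H P (\<lambda>a b. counit H b \<odot>\<^bsub>P\<^esub> f a) (comult H h) = f h"
proof -
  note [simp] = assms linear_comp[OF assms(2)] linear_map_closed[OF assms(2)]
  have "tsum K H H H (\<lambda>a b. counit H b \<odot>\<^bsub>H\<^esub> a) (comult H h) = h"
    using coalgebra_H by (simp add: coalgebra_def tsum_def)
  then have "f h = f (tsum K H H H (\<lambda>a b. counit H b \<odot>\<^bsub>H\<^esub> a) (comult H h))"
    by simp
  also have "\<dots> = tsum K H H P (\<lambda>a b. f (counit H b \<odot>\<^bsub>H\<^esub> a)) (comult H h)"
    by (rule linear_tsum) auto
  finally show ?thesis
    by (simp add: linear_map_smult[OF assms(2)])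
qed

lemma comult_mult:
  assumes "module K P" "bilinear_map K H H P \<beta>" "a \<in> carrier H" "b \<in> carrier H"
  shows "tsum K H H P \<beta> (comult H (a \<otimes>\<^bsub>H\<^esub> b)) =
    tsum K H H P (\<lambda>a\<^sub>1 a\<^sub>2. tsum K H H P (\<lambda>b\<^sub>1 b\<^sub>2. \<beta> (a\<^sub>1 \<otimes>\<^bsub>H\<^esub> b\<^sub>1) (a\<^sub>2 \<otimes>\<^bsub>H\<^esub> b\<^sub>2)) (comult H b)) (comult H a)"
proof -
  note [simp] = assms bilinear_map_linear[OF assms(2), THEN linear_comp]
  have "comult H (a \<otimes>\<^bsub>H\<^esub> b) = comult H a \<otimes>\<^bsub>tensor_algebra K H H\<^esub> comult H b"
    using weak_bialgebra assms(3,4) by (simp add: weak_bialgebra_def)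
  then show ?thesis
    by (simp add: tensor_algebra_mult_eq_tsum)
qed

lemma counit_mult:
  assumes "a \<in> carrier H" "b \<in> carrier H" "c \<in> carrier H"
  shows "counit H (a \<otimes>\<^bsub>H\<^esub> b \<otimes>\<^bsub>H\<^esub> c) = tsum K H H (base_module K)
      (\<lambda>b\<^sub>1 b\<^sub>2. counit H (a \<otimes>\<^bsub>H\<^esub> b\<^sub>1) \<otimes>\<^bsub>K\<^esub> counit H (b\<^sub>2 \<otimes>\<^bsub>H\<^esub> c)) (comult H b)" (is ?A)
    and "counit H (a \<otimes>\<^bsub>H\<^esub> b \<otimes>\<^bsub>H\<^esub> c) = tsum K H H (base_module K)
      (\<lambda>b\<^sub>1 b\<^sub>2. counit H (a \<otimes>\<^bsub>H\<^esub> b\<^sub>2) \<otimes>\<^bsub>K\<^esub> counit H (b\<^sub>1 \<otimes>\<^bsub>H\<^esub> c)) (comult H b)" (is ?B)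
proof -
  from weak_bialgebra assms have "?A \<and> ?B"
    unfolding weak_bialgebra_def tsum_def by blast
  then show ?A ?B by auto
qed

text \<open>The map induced by \<gamma> is applied to the axioms for the iterated coproduct of 1 in
  H \<otimes> (H \<otimes> H). The factors 1 in the outer slots cancel, which leaves 1_1 \<otimes>
  1_2 1'_1 \<otimes> 1'_2 for one order of multiplication and 1_1 \<otimes> 1'_1 1_2 \<otimes> 1'_2
  for the other.\<close>

lemma comult_one_mult:
  assumes "module K P" "trilinear_map K H H H P \<gamma>"
  shows "tsum K H H P (\<lambda>a c. tsum K H H P (\<lambda>a' b. \<gamma> a' b c) (comult H a)) \<Delta>\<^sub>1 =
      tsum K H H P (\<lambda>a b. tsum K H H P (\<lambda>b' c. \<gamma> a (b \<otimes>\<^bsub>H\<^esub> b') c) \<Delta>\<^sub>1) \<Delta>\<^sub>1"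
      (is "?l = ?r")
    and "tsum K H H P (\<lambda>a c. tsum K H H P (\<lambda>a' b. \<gamma> a' b c) (comult H a)) \<Delta>\<^sub>1 =
      tsum K H H P (\<lambda>a b. tsum K H H P (\<lambda>b' c. \<gamma> a (b' \<otimes>\<^bsub>H\<^esub> b) c) \<Delta>\<^sub>1) \<Delta>\<^sub>1"
      (is "?l = ?r'")
proof -
  note [simp] = assms(1) trilinear_map_linear[OF assms(2)]
    trilinear_map_linear[OF assms(2), THEN linear_comp]
  let ?HH = "tensor_algebra K H H"
  let ?HHH = "tensor_algebra K H ?HH"
  let ?a = "tensor_assoc K H H H (tens K ?HH H \<Delta>\<^sub>1 \<one>\<^bsub>H\<^esub>)"
  let ?b = "tens K H ?HH \<one>\<^bsub>H\<^esub> \<Delta>\<^sub>1"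
  let ?d = "tensor_assoc K H H H (tensor_map K ?HH H (comult H) (\<lambda>x. x) \<Delta>\<^sub>1)"
  let ?G = "tsum K H (tensor K H H) P (\<lambda>a s. tsum K H H P (\<lambda>b c. \<gamma> a b c) s)"
  have "?d = ?a \<otimes>\<^bsub>?HHH\<^esub> ?b" "?d = ?b \<otimes>\<^bsub>?HHH\<^esub> ?a"
    using weak_bialgebra unfolding weak_bialgebra_def Let_def by blast+
  note G = this[THEN arg_cong[where f = ?G]]
  have d: "?G ?d = ?l"
    unfolding tensor_assoc_eq_tsum tensor_map_eq_tsum[where M = H and N = H]
      tensor_tensor_algebra by simp
  have a: "tensor_assoc K H H H (tens K (tensor K H H) H \<Delta>\<^sub>1 \<one>\<^bsub>H\<^esub>) =
    tsum K H H (tensor K H (tensor K H H))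
      (\<lambda>a b. tens K H (tensor K H H) a (tens K H H b \<one>\<^bsub>H\<^esub>)) \<Delta>\<^sub>1"
    unfolding tensor_assoc_eq_tsum tensor_tensor_algebra by simp
  \<comment> \<open>The inner factor of H \<otimes> (H \<otimes> H) is again a
    \<open>tensor_algebra\<close>, so its multiplication is spelled out together with the outer
    one.\<close>
  have m: "X \<otimes>\<^bsub>?HHH\<^esub> Y = tsum K H (tensor K H H) (tensor K H (tensor K H H))
     (\<lambda>a s. tsum K H (tensor K H H) (tensor K H (tensor K H H))
       (\<lambda>a' t. tens K H (tensor K H H) (a \<otimes>\<^bsub>H\<^esub> a')
          (tsum K H H (tensor K H H) (\<lambda>b c. tsum K H H (tensor K H H)
            (\<lambda>b' c'. tens K H H (b \<otimes>\<^bsub>H\<^esub> b') (c \<otimes>\<^bsub>H\<^esub> c')) t) s)) Y) X" for X Y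
    unfolding tensor_algebra_mult_eq_tsum tensor_tensor_algebra tsum_def ..
  show "?l = ?r"
    unfolding d[symmetric] G(1) m tensor_tensor_algebra a by simp
  show "?l = ?r'"
    unfolding d[symmetric] G(2) m tensor_tensor_algebra a by simp
qed

lemma counit_s_eq: "counit_s K H x =
    tsum K H H H (\<lambda>e\<^sub>1 e\<^sub>2. counit H (x \<otimes>\<^bsub>H\<^esub> e\<^sub>2) \<odot>\<^bsub>H\<^esub> e\<^sub>1) \<Delta>\<^sub>1"
  by (simp add: counit_s_def tsum_def)

lemma counit_t_eq: "counit_t K H x =
    tsum K H H H (\<lambda>e\<^sub>1 e\<^sub>2. counit H (e\<^sub>1 \<otimes>\<^bsub>H\<^esub> x) \<odot>\<^bsub>H\<^esub> e\<^sub>2) \<Delta>\<^sub>1"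
  by (simp add: counit_t_def tsum_def)

lemma counit_s_linear: "linear_map K H H (counit_s K H)"
  and counit_t_linear: "linear_map K H H (counit_t K H)"
  unfolding counit_s_eq[abs_def] counit_t_eq[abs_def] by simp_all

lemmas linear_counit_st [simp] = linear_comp[OF counit_s_linear] linear_comp[OF counit_t_linear]
lemmas counit_st_closed [simp] = linear_map_closed[OF counit_s_linear] linear_map_closed[OF counit_t_linear]

lemma coassociative_coact: "right_comodule K H M \<Longrightarrow> coassociative K H M (coact M)"
  by (simp add: right_comodule_def coassociative_def)

lemma comodule_module [simp]: "right_comodule K H M \<Longrightarrow> module K M"
  by (simp add: right_comodule_def)

lemma coact_linear: "right_comodule K H M \<Longrightarrow> linear_map K M (tensor K M H) (coact M)"
  by (simp add: right_comodule_def)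

lemmas linear_coact [simp] = linear_comp[OF coact_linear]
lemmas coact_closed [simp] = linear_map_closed[OF coact_linear]

lemma coact_tsum [simp]:
  assumes "module K A" "module K B" "right_comodule K H M" "bilinear_map K A B M \<beta>"
    "t \<in> carrier (tensor K A B)"
  shows "coact M (tsum K A B M \<beta> t) = tsum K A B (tensor K M H) (\<lambda>a b. coact M (\<beta> a b)) t"
  using assms by (intro linear_tsum[OF _ _ _ _ _ coact_linear]) auto

lemma coact_coassoc:
  assumes "right_comodule K H M" "module K P" "trilinear_map K M H H P \<gamma>" "m \<in> carrier M"
  shows "tsum K M H P (\<lambda>a c. tsum K M H P (\<lambda>a' b. \<gamma> a' b c) (coact M a)) (coact M m) =
    tsum K M H P (\<lambda>a b. tsum K H H P (\<lambda>b' c. \<gamma> a b' c) (comult H b)) (coact M m)"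
  using assms by (intro coassociativeD coact_linear coassociative_coact comodule_module)

lemma coact_counit:
  assumes "right_comodule K H M" "module K P" "linear_map K M P f" "m \<in> carrier M"
  shows "tsum K M H P (\<lambda>a b. counit H b \<odot>\<^bsub>P\<^esub> f a) (coact M m) = f m"
proof -
  note [simp] = assms linear_comp[OF assms(3)] linear_map_closed[OF assms(3)]
  have "tsum K M H M (\<lambda>a b. counit H b \<odot>\<^bsub>M\<^esub> a) (coact M m) = m"
    using assms(1,4) unfolding right_comodule_def tsum_def by blast
  then have "f m = f (tsum K M H M (\<lambda>a b. counit H b \<odot>\<^bsub>M\<^esub> a) (coact M m))"
    by simp
  also have "\<dots> = tsum K M H P (\<lambda>a b. f (counit H b \<odot>\<^bsub>M\<^esub> a)) (coact M m)"
    by (rule linear_tsum) auto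
  finally show ?thesis
    by (simp add: linear_map_smult[OF assms(3)])
qed

end

section \<open>The source and target counital maps\<close>

lemma smult_left_commute:
  assumes "module K M" "a \<in> carrier K" "b \<in> carrier K" "x \<in> carrier M"
  shows "a \<odot>\<^bsub>M\<^esub> (b \<odot>\<^bsub>M\<^esub> x) = b \<odot>\<^bsub>M\<^esub> (a \<odot>\<^bsub>M\<^esub> x)"
proof -
  interpret module K M by fact
  show ?thesis
    using assms by (simp add: smult_assoc1[symmetric] R.m_comm)
qed

context weak_bialg
begin

text \<open>Expanding \<open>\<epsilon>\<^sub>s\<close> at 1_1 gives 1'_1 \<otimes> \<epsilon>(1_1
  1'_2) 1_2. By the second unit axiom this is the iterated coproduct of 1 with \<epsilon> on the
  middle leg, and counitality returns \<Delta>(1).\<close>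

lemma counit_s_comult_one:
  assumes "module K P" "bilinear_map K H H P \<beta>"
  shows "tsum K H H P (\<lambda>a b. \<beta> (counit_s K H a) b) \<Delta>\<^sub>1 =
    tsum K H H P \<beta> \<Delta>\<^sub>1"
proof -
  note \<beta> = bilinear_map_linear[OF assms(2)]
  note [simp] = assms(1) \<beta> \<beta>[THEN linear_comp] bilinear_map_closed[OF assms(2)]
    linear_map_smult[OF \<beta>(1)] linear_tsum[OF _ _ _ _ _ \<beta>(1)]
  have "tsum K H H P (\<lambda>a b. \<beta> (counit_s K H a) b) \<Delta>\<^sub>1 =
    tsum K H H P (\<lambda>a b. tsum K H H P (\<lambda>c d. counit H (a \<otimes>\<^bsub>H\<^esub> d) \<odot>\<^bsub>P\<^esub> \<beta> c b)
      \<Delta>\<^sub>1) \<Delta>\<^sub>1"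
    by (simp add: counit_s_eq)
  also have "\<dots> = tsum K H H P (\<lambda>c d. tsum K H H P (\<lambda>a b. counit H (a \<otimes>\<^bsub>H\<^esub> d) \<odot>\<^bsub>P\<^esub> \<beta> c b)
      \<Delta>\<^sub>1) \<Delta>\<^sub>1"
    by (rule tsum_swap) simp_all
  also have "\<dots> = tsum K H H P (\<lambda>a c. tsum K H H P (\<lambda>a' b. counit H b \<odot>\<^bsub>P\<^esub> \<beta> a' c) (comult H a))
      \<Delta>\<^sub>1"
    by (rule comult_one_mult(2)[symmetric, where \<gamma> = "\<lambda>c x b. counit H x \<odot>\<^bsub>P\<^esub> \<beta> c b"]) simp_all
  also have "\<dots> = tsum K H H P \<beta> \<Delta>\<^sub>1"
    by (simp add: comult_counit_r[where f = "\<lambda>a. \<beta> a _"])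
  finally show ?thesis .
qed

text \<open>Here 1_1 \<otimes> \<epsilon>(1'_1 1_2) 1'_2 already has the shape of the second unit
  axiom with \<epsilon> on the middle leg.\<close>

lemma counit_t_comult_one:
  assumes "module K P" "bilinear_map K H H P \<beta>"
  shows "tsum K H H P (\<lambda>a b. \<beta> a (counit_t K H b)) \<Delta>\<^sub>1 =
    tsum K H H P \<beta> \<Delta>\<^sub>1"
proof -
  note \<beta> = bilinear_map_linear[OF assms(2)]
  note [simp] = assms(1) \<beta> \<beta>[THEN linear_comp] bilinear_map_closed[OF assms(2)]
    linear_map_smult[OF \<beta>(2)] linear_tsum[OF _ _ _ _ _ \<beta>(2)]
  have "tsum K H H P (\<lambda>a b. \<beta> a (counit_t K H b)) \<Delta>\<^sub>1 =
    tsum K H H P (\<lambda>a b. tsum K H H P (\<lambda>c d. counit H (c \<otimes>\<^bsub>H\<^esub> b) \<odot>\<^bsub>P\<^esub> \<beta> a d)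
      \<Delta>\<^sub>1) \<Delta>\<^sub>1"
    by (simp add: counit_t_eq)
  also have "\<dots> = tsum K H H P (\<lambda>a c. tsum K H H P (\<lambda>a' b. counit H b \<odot>\<^bsub>P\<^esub> \<beta> a' c) (comult H a))
      \<Delta>\<^sub>1"
    by (rule comult_one_mult(2)[symmetric, where \<gamma> = "\<lambda>c x b. counit H x \<odot>\<^bsub>P\<^esub> \<beta> c b"]) simp_all
  also have "\<dots> = tsum K H H P \<beta> \<Delta>\<^sub>1"
    by (simp add: comult_counit_r[where f = "\<lambda>a. \<beta> a _"])
  finally show ?thesis .
qed

lemma counit_s_idem [simp]: "x \<in> carrier H \<Longrightarrow> counit_s K H (counit_s K H x) = counit_s K H x"
proof -
  assume x [simp]: "x \<in> carrier H"
  have "counit_s K H (counit_s K H x) =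
      tsum K H H H (\<lambda>a b. counit_s K H (counit H (x \<otimes>\<^bsub>H\<^esub> b) \<odot>\<^bsub>H\<^esub> a)) \<Delta>\<^sub>1"
    unfolding counit_s_eq[of x] by (rule linear_tsum[OF _ _ _ _ _ counit_s_linear]) simp_all
  also have "\<dots> = tsum K H H H (\<lambda>a b. counit H (x \<otimes>\<^bsub>H\<^esub> b) \<odot>\<^bsub>H\<^esub> counit_s K H a) \<Delta>\<^sub>1"
    by (simp add: linear_map_smult[OF counit_s_linear])
  also have "\<dots> = tsum K H H H (\<lambda>a b. counit H (x \<otimes>\<^bsub>H\<^esub> b) \<odot>\<^bsub>H\<^esub> a) \<Delta>\<^sub>1"
    by (rule counit_s_comult_one) simp_all
  finally show ?thesis
    by (simp add: counit_s_eq[of x])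
qed

lemma counit_t_idem [simp]: "x \<in> carrier H \<Longrightarrow> counit_t K H (counit_t K H x) = counit_t K H x"
proof -
  assume x [simp]: "x \<in> carrier H"
  have "counit_t K H (counit_t K H x) =
      tsum K H H H (\<lambda>a b. counit_t K H (counit H (a \<otimes>\<^bsub>H\<^esub> x) \<odot>\<^bsub>H\<^esub> b)) \<Delta>\<^sub>1"
    unfolding counit_t_eq[of x] by (rule linear_tsum[OF _ _ _ _ _ counit_t_linear]) simp_all
  also have "\<dots> = tsum K H H H (\<lambda>a b. counit H (a \<otimes>\<^bsub>H\<^esub> x) \<odot>\<^bsub>H\<^esub> counit_t K H b) \<Delta>\<^sub>1"
    by (simp add: linear_map_smult[OF counit_t_linear])
  also have "\<dots> = tsum K H H H (\<lambda>a b. counit H (a \<otimes>\<^bsub>H\<^esub> x) \<odot>\<^bsub>H\<^esub> b) \<Delta>\<^sub>1"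
    by (rule counit_t_comult_one) simp_all
  finally show ?thesis
    by (simp add: counit_t_eq[of x])
qed

text \<open>Idempotence turns the image of \<open>counit_s\<close> into its set of fixed points. In
  this form x can be replaced by \<open>counit_s K H x\<close> and expanded into legs of
  \<Delta>(1).\<close>

lemma H_s_iff: "x \<in> H_s K H \<longleftrightarrow> x \<in> carrier H \<and> counit_s K H x = x"
  unfolding H_s_def by (auto intro: image_eqI[of _ _ x])

lemma H_t_iff: "x \<in> H_t K H \<longleftrightarrow> x \<in> carrier H \<and> counit_t K H x = x"
  unfolding H_t_def by (auto intro: image_eqI[of _ _ x])

lemma one_H_s: "\<one>\<^bsub>H\<^esub> \<in> H_s K H"
  using comult_counit_r[OF module_H linear_id, of "\<one>\<^bsub>H\<^esub>"] by (simp add: H_s_iff counit_s_eq)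

text \<open>Since x = 1_1 \<epsilon>(x 1_2), its coproduct is 1_1 \<otimes> 1_2 \<epsilon>(x 1_3).
  The second unit axiom rewrites this as 1_1 \<otimes> 1'_1 \<epsilon>(x 1'_2) 1_2, where the primed
  legs add up to x again.\<close>

lemma comult_H_s:
  assumes "module K P" "bilinear_map K H H P \<beta>" and x: "x \<in> H_s K H"
  shows "tsum K H H P \<beta> (comult H x) = tsum K H H P (\<lambda>a b. \<beta> a (x \<otimes>\<^bsub>H\<^esub> b)) \<Delta>\<^sub>1"
proof -
  note \<beta> = bilinear_map_linear[OF assms(2)]
  have [simp]: "x \<in> carrier H" and fx: "counit_s K H x = x"
    using x by (simp_all add: H_s_iff)
  note [simp] = assms(1) \<beta> \<beta>[THEN linear_comp] bilinear_map_closed[OF assms(2)] assms(2)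
    linear_map_smult[OF \<beta>(2)] linear_tsum[OF _ _ _ _ _ \<beta>(2)]
  have "tsum K H H P \<beta> (comult H x) = tsum K H H P \<beta> (comult H (counit_s K H x))"
    by (simp add: fx)
  also have "\<dots> = tsum K H H P (\<lambda>a c. tsum K H H P (\<lambda>a' b. counit H (x \<otimes>\<^bsub>H\<^esub> c) \<odot>\<^bsub>P\<^esub> \<beta> a' b) (comult H a))
      \<Delta>\<^sub>1"
    by (simp add: counit_s_eq linear_map_smult[OF comult_linear])
  also have "\<dots> = tsum K H H P (\<lambda>a b. tsum K H H P (\<lambda>b' c. counit H (x \<otimes>\<^bsub>H\<^esub> c) \<odot>\<^bsub>P\<^esub> \<beta> a (b' \<otimes>\<^bsub>H\<^esub> b))
      \<Delta>\<^sub>1) \<Delta>\<^sub>1"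
    by (rule comult_one_mult(2)[where \<gamma> = "\<lambda>a' b c. counit H (x \<otimes>\<^bsub>H\<^esub> c) \<odot>\<^bsub>P\<^esub> \<beta> a' b"]) simp_all
  also have "\<dots> = tsum K H H P (\<lambda>a b. \<beta> a (counit_s K H x \<otimes>\<^bsub>H\<^esub> b)) \<Delta>\<^sub>1"
    by (simp add: counit_s_eq H.smult_mult_left)
  finally show ?thesis
    by (simp add: fx)
qed

text \<open>Since y = \<epsilon>(1_1 y) 1_2, its coproduct is \<epsilon>(1_1 y) 1_2 \<otimes> 1_3,
  which the second unit axiom rewrites as 1'_1 \<epsilon>(1_1 y) 1_2 \<otimes> 1'_2. The unprimed
  legs add up to y.\<close>

lemma comult_H_t:
  assumes "module K P" "bilinear_map K H H P \<beta>" and y: "y \<in> H_t K H"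
  shows "tsum K H H P \<beta> (comult H y) = tsum K H H P (\<lambda>a b. \<beta> (a \<otimes>\<^bsub>H\<^esub> y) b) \<Delta>\<^sub>1"
proof -
  note \<beta> = bilinear_map_linear[OF assms(2)]
  have [simp]: "y \<in> carrier H" and fy: "counit_t K H y = y"
    using y by (simp_all add: H_t_iff)
  note [simp] = assms(1) \<beta> \<beta>[THEN linear_comp] bilinear_map_closed[OF assms(2)] assms(2)
    linear_map_smult[OF \<beta>(1)] linear_tsum[OF _ _ _ _ _ \<beta>(1)]
  have "tsum K H H P \<beta> (comult H y) = tsum K H H P \<beta> (comult H (counit_t K H y))"
    by (simp add: fy)
  also have "\<dots> = tsum K H H P (\<lambda>a b. tsum K H H P (\<lambda>b' c. counit H (a \<otimes>\<^bsub>H\<^esub> y) \<odot>\<^bsub>P\<^esub> \<beta> b' c) (comult H b))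
      \<Delta>\<^sub>1"
    by (simp add: counit_t_eq linear_map_smult[OF comult_linear])
  also have "\<dots> = tsum K H H P (\<lambda>a c. tsum K H H P (\<lambda>a' b. counit H (a' \<otimes>\<^bsub>H\<^esub> y) \<odot>\<^bsub>P\<^esub> \<beta> b c) (comult H a))
      \<Delta>\<^sub>1"
    by (rule comult_coassoc[symmetric, where \<gamma> = "\<lambda>a b c. counit H (a \<otimes>\<^bsub>H\<^esub> y) \<odot>\<^bsub>P\<^esub> \<beta> b c"]) simp_all
  also have "\<dots> = tsum K H H P (\<lambda>a b. tsum K H H P (\<lambda>b' c. counit H (a \<otimes>\<^bsub>H\<^esub> y) \<odot>\<^bsub>P\<^esub> \<beta> (b' \<otimes>\<^bsub>H\<^esub> b) c)
      \<Delta>\<^sub>1) \<Delta>\<^sub>1"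
    by (rule comult_one_mult(2)[where \<gamma> = "\<lambda>a b c. counit H (a \<otimes>\<^bsub>H\<^esub> y) \<odot>\<^bsub>P\<^esub> \<beta> b c"]) simp_all
  also have "\<dots> = tsum K H H P (\<lambda>b' c. tsum K H H P (\<lambda>a b. counit H (a \<otimes>\<^bsub>H\<^esub> y) \<odot>\<^bsub>P\<^esub> \<beta> (b' \<otimes>\<^bsub>H\<^esub> b) c)
      \<Delta>\<^sub>1) \<Delta>\<^sub>1"
    by (rule tsum_swap) simp_all
  also have "\<dots> = tsum K H H P (\<lambda>a b. \<beta> (a \<otimes>\<^bsub>H\<^esub> counit_t K H y) b) \<Delta>\<^sub>1"
    by (simp add: counit_t_eq H.smult_mult_right)
  finally show ?thesis
    by (simp add: fy)
qed

text \<open>By \<open>comult_H_s\<close> the first leg of \<Delta>(x) is a first leg of \<Delta>(1),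
  which \<open>counit_s\<close> fixes. This is why \<Delta> restricts to a coaction on the unit
  object.\<close>

lemma counit_s_comult_H_s:
  assumes "module K P" "bilinear_map K H H P \<beta>" and x: "x \<in> H_s K H"
  shows "tsum K H H P (\<lambda>a b. \<beta> (counit_s K H a) b) (comult H x) = tsum K H H P \<beta> (comult H x)"
proof -
  note \<beta> = bilinear_map_linear[OF assms(2)]
  have [simp]: "x \<in> carrier H"
    using x by (simp add: H_s_iff)
  note [simp] = assms(1) \<beta> \<beta>[THEN linear_comp] assms(2)
  show ?thesis
    by (simp add: comult_H_s[OF _ _ x] counit_s_comult_one[where \<beta> = "\<lambda>a b. \<beta> a (x \<otimes>\<^bsub>H\<^esub> b)"])
qed

text \<open>Both products carry the coefficient \<epsilon>(1_1 y) \<epsilon>(x 1'_2); one has the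
  factor 1_2 1'_1 and the other 1'_1 1_2. The two unit axioms identify them, both being equal to the
  iterated coproduct of 1.\<close>

lemma H_s_H_t_commute:
  assumes x: "x \<in> H_s K H" and y: "y \<in> H_t K H"
  shows "x \<otimes>\<^bsub>H\<^esub> y = y \<otimes>\<^bsub>H\<^esub> x"
proof -
  have [simp]: "x \<in> carrier H" "y \<in> carrier H" and fx: "counit_s K H x = x" "counit_t K H y = y"
    using x y by (simp_all add: H_s_iff H_t_iff)
  let ?\<gamma> = "\<lambda>a b c. counit H (a \<otimes>\<^bsub>H\<^esub> y) \<odot>\<^bsub>H\<^esub> (counit H (x \<otimes>\<^bsub>H\<^esub> c) \<odot>\<^bsub>H\<^esub> b)"
  have "counit_t K H y \<otimes>\<^bsub>H\<^esub> counit_s K H x = tsum K H H H (\<lambda>b' c. tsum K H H H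
      (\<lambda>a b. ?\<gamma> a (b \<otimes>\<^bsub>H\<^esub> b') c) \<Delta>\<^sub>1) \<Delta>\<^sub>1"
    by (simp add: counit_s_eq counit_t_eq H.smult_mult_left H.smult_mult_right
        smult_left_commute[of K H "counit H (x \<otimes>\<^bsub>H\<^esub> _)"])
  also have "\<dots> = tsum K H H H (\<lambda>a b. tsum K H H H
      (\<lambda>b' c. ?\<gamma> a (b \<otimes>\<^bsub>H\<^esub> b') c) \<Delta>\<^sub>1) \<Delta>\<^sub>1"
    by (rule tsum_swap) simp_all
  also have "\<dots> = tsum K H H H (\<lambda>a b. tsum K H H H
      (\<lambda>b' c. ?\<gamma> a (b' \<otimes>\<^bsub>H\<^esub> b) c) \<Delta>\<^sub>1) \<Delta>\<^sub>1"
    by (rule trans[OF comult_one_mult(1)[symmetric] comult_one_mult(2), of H ?\<gamma>]) simp_all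
  also have "\<dots> = counit_s K H x \<otimes>\<^bsub>H\<^esub> counit_t K H y"
    by (simp add: counit_s_eq counit_t_eq H.smult_mult_left H.smult_mult_right
        smult_left_commute[of K H "counit H (x \<otimes>\<^bsub>H\<^esub> _)"])
  finally show ?thesis
    by (simp add: fx)
qed

text \<open>Both sides equal x y: the left one through \<Delta>(y) = 1_1 y \<otimes> 1_2, the right
  one through \<Delta>(x) = 1_1 \<otimes> x 1_2. It is the exchange on which colinearity of the unit
  morphism rests.\<close>

lemma H_s_H_t_counit:
  assumes x: "x \<in> H_s K H" and y: "y \<in> H_t K H"
  shows "tsum K H H H (\<lambda>a b. counit H (x \<otimes>\<^bsub>H\<^esub> b) \<odot>\<^bsub>H\<^esub> a) (comult H y) =
    tsum K H H H (\<lambda>a b. counit H (a \<otimes>\<^bsub>H\<^esub> y) \<odot>\<^bsub>H\<^esub> b) (comult H x)"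
proof -
  have [simp]: "x \<in> carrier H" "y \<in> carrier H" and fx: "counit_s K H x = x" "counit_t K H y = y"
    using x y by (simp_all add: H_s_iff H_t_iff)
  have "tsum K H H H (\<lambda>a b. counit H (x \<otimes>\<^bsub>H\<^esub> b) \<odot>\<^bsub>H\<^esub> a) (comult H y) = counit_s K H x \<otimes>\<^bsub>H\<^esub> y"
    by (simp add: comult_H_t[OF _ _ y] counit_s_eq H.smult_mult_left)
  also have "\<dots> = x \<otimes>\<^bsub>H\<^esub> counit_t K H y"
    by (simp add: fx)
  also have "\<dots> = tsum K H H H (\<lambda>a b. counit H (a \<otimes>\<^bsub>H\<^esub> y) \<odot>\<^bsub>H\<^esub> b) (comult H x)"
    by (simp add: comult_H_s[OF _ _ x] counit_t_eq H.smult_mult_right)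
  finally show ?thesis .
qed

end

section \<open>Products of comodules\<close>

lemma with_coact_simps:
  "carrier (with_coact V \<rho>) = carrier V"
  "mult (with_coact V \<rho>) = mult V"
  "one (with_coact V \<rho>) = one V"
  "zero (with_coact V \<rho>) = zero V"
  "add (with_coact V \<rho>) = add V"
  "smult (with_coact V \<rho>) = smult V"
  "coact (with_coact V \<rho>) = restrict \<rho> (carrier V)"
  by (simp_all add: with_coact_def module.defs comodule.defs)

lemma subspace_module_simps:
  "carrier (subspace_module K V S) = S"
  "zero (subspace_module K V S) = \<zero>\<^bsub>V\<^esub>"
  "\<lbrakk>x \<in> S; y \<in> S\<rbrakk> \<Longrightarrow> x \<oplus>\<^bsub>subspace_module K V S\<^esub> y = x \<oplus>\<^bsub>V\<^esub> y"
  "\<lbrakk>a \<in> carrier K; x \<in> S\<rbrakk> \<Longrightarrow> a \<odot>\<^bsub>subspace_module K V S\<^esub> x = a \<odot>\<^bsub>V\<^esub> x"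
  by (simp_all add: subspace_module_def make_space_def)

text \<open>Common frame for the unit object and for the product of two comodules. The map \<rho> is
  coassociative on the whole of V, but its counit law is required on the fixed points of Q only. The
  condition \<open>Q_\<rho>\<close> places the values of \<rho> on S in the part of V \<otimes> H
  fixed by Q \<otimes> id, where \<open>corestrict\<close> is meaningful.\<close>

locale subcomodule = weak_bialg K H
  for K :: "('k, 'z) ring_scheme" and H :: "('k, 'h, 'w) bialgebra_scheme" +
  fixes V :: "('k, 'a, 'm) module_scheme" and \<rho> and Q and S
  assumes V [simp]: "module K V"
    and \<rho>_linear: "linear_map K V (tensor K V H) \<rho>"
    and \<rho>_coassoc: "coassociative K H V \<rho>"
    and Q_linear: "linear_map K V V Q"
    and S_eq: "S = {x \<in> carrier V. Q x = x}"
    and Q_idem: "x \<in> carrier V \<Longrightarrow> Q (Q x) = Q x"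
    and Q_\<rho>: "x \<in> S \<Longrightarrow> tensor_map K V H Q (\<lambda>x. x) (\<rho> x) = \<rho> x"
    and \<rho>_counit: "x \<in> S \<Longrightarrow> tsum K V H V (\<lambda>v h. counit H h \<odot>\<^bsub>V\<^esub> v) (\<rho> x) = x"
begin

definition "C = with_coact (subspace_module K V S) (\<lambda>x. corestrict K V S H (\<rho> x))"

lemma C_carrier: "carrier C = S"
  and C_zero: "\<zero>\<^bsub>C\<^esub> = \<zero>\<^bsub>V\<^esub>"
  and C_add: "\<lbrakk>x \<in> carrier C; y \<in> carrier C\<rbrakk> \<Longrightarrow> x \<oplus>\<^bsub>C\<^esub> y = x \<oplus>\<^bsub>V\<^esub> y"
  and C_smult: "\<lbrakk>a \<in> carrier K; x \<in> carrier C\<rbrakk> \<Longrightarrow> a \<odot>\<^bsub>C\<^esub> x = a \<odot>\<^bsub>V\<^esub> x"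
  and C_coact: "x \<in> carrier C \<Longrightarrow> coact C x = corestrict K V S H (\<rho> x)"
  by (simp_all add: C_def with_coact_simps subspace_module_simps)

lemma C_Q_\<rho>: "x \<in> carrier C \<Longrightarrow> tensor_map K V H Q (\<lambda>x. x) (\<rho> x) = \<rho> x"
  and C_counit: "x \<in> carrier C \<Longrightarrow> tsum K V H V (\<lambda>v h. counit H h \<odot>\<^bsub>V\<^esub> v) (\<rho> x) = x"
  by (simp_all only: C_carrier Q_\<rho> \<rho>_counit)

lemma tensor_subspace: "tensor K (subspace_module K V S) N = tensor K C N"
  by (rule tensor_record_cong) (simp_all add: C_def with_coact_simps)

lemma C_subset [simp]: "x \<in> carrier C \<Longrightarrow> x \<in> carrier V"
  and Q_C [simp]: "x \<in> carrier C \<Longrightarrow> Q x = x"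
  and Q_in_C [simp]: "x \<in> carrier V \<Longrightarrow> Q x \<in> carrier C"
  using Q_idem linear_map_closed[OF Q_linear] unfolding C_carrier by (auto simp only: S_eq)

lemma module_C [simp]: "module K C"
proof (rule module_image[where F = V and c = Q])
  show "carrier C = Q ` carrier V"
    by (auto intro: rev_image_eqI[OF C_subset])
qed (use linear_map_zero[OF V V Q_linear] in
    \<open>simp_all add: C_zero C_add C_smult linear_map_add[OF Q_linear] linear_map_smult[OF Q_linear]\<close>)

lemma C_incl: "linear_map K C V (\<lambda>x. x)"
  by (rule linear_mapI) (simp_all add: C_add C_smult)

lemma C_retract: "linear_map K V C Q"
  by (rule linear_mapI)
    (simp_all add: C_add C_smult linear_map_add[OF Q_linear] linear_map_smult[OF Q_linear])

lemmas sub_simps = linear_comp[OF Q_linear] linear_comp[OF C_retract] linear_comp[OF C_incl]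
  linear_comp[OF \<rho>_linear] linear_map_closed[OF \<rho>_linear]

text \<open>Q \<otimes> id is a left inverse of the map induced by the inclusion of S. This gives
  injectivity and identifies the preimage that \<open>inv_into\<close> selects.\<close>

lemma corestrict_eq:
  assumes "t \<in> carrier (tensor K V H)" "tensor_map K V H Q (\<lambda>x. x) t = t"
  shows "corestrict K V S H t = tsum K V H (tensor K C H) (\<lambda>v h. tens K C H (Q v) h) t"
  unfolding corestrict_def tensor_subspace
proof (rule inv_into_f_eq)
  note [simp] = sub_simps assms(1)
  let ?R = "tsum K V H (tensor K C H) (\<lambda>v h. tens K C H (Q v) h)"
  let ?incl = "tensor_map K V H (\<lambda>x. x) (\<lambda>x. x)"
  show "inj_on ?incl (carrier (tensor K C H))"
  proof (rule inj_on_inverseI)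
    fix y assume [simp]: "y \<in> carrier (tensor K C H)"
    show "?R (?incl y) = y"
      unfolding tensor_map_eq_tsum[where M = C and N = H] by (simp add: tsum_tens_id)
  qed
  show "?R t \<in> carrier (tensor K C H)"
    by simp
  have "?incl (?R t) = tsum K V H (tensor K V H) (\<lambda>v h. tens K V H (Q v) h) t"
    unfolding tensor_map_eq_tsum[where M = C and N = H] by simp
  also have "\<dots> = tensor_map K V H Q (\<lambda>x. x) t"
    by (rule tensor_map_eq_tsum[symmetric])
  finally show "?incl (?R t) = t"
    by (simp only: assms(2))
qed

lemma coact_C:
  assumes "x \<in> carrier C"
  shows "coact C x = tsum K V H (tensor K C H) (\<lambda>v h. tens K C H (Q v) h) (\<rho> x)"
  using corestrict_eq[of "\<rho> x"] C_Q_\<rho>[of x] assms by (simp add: C_coact sub_simps)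

lemma coact_C_linear: "linear_map K C (tensor K C H) (coact C)"
proof -
  have "linear_map K C (tensor K C H) (\<lambda>x. tsum K V H (tensor K C H) (\<lambda>v h. tens K C H (Q v) h) (\<rho> x))"
    by (simp add: sub_simps)
  then show ?thesis
    by (rule linear_map_cong[OF _ module_C]) (simp add: coact_C)
qed

lemma tsum_coact_C:
  assumes "module K P" "bilinear_map K C H P \<beta>" "x \<in> carrier C"
  shows "tsum K C H P \<beta> (coact C x) = tsum K V H P (\<lambda>v h. \<beta> (Q v) h) (\<rho> x)"
proof -
  note [simp] = sub_simps assms bilinear_map_linear[OF assms(2)]
    linear_comp[OF bilinear_map_linear(1)[OF assms(2)]]
  show ?thesis
    by (simp add: coact_C)
qed

text \<open>Q \<otimes> id leaves \<open>\<rho> x\<close> unchanged, so Q may be inserted in front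
  of \<beta>; the result is a sum over the coaction of C. Together with \<open>tsum_coact_C\<close>
  it moves computations between V and C.\<close>

lemma tsum_\<rho>:
  assumes "module K P" "bilinear_map K V H P \<beta>" "x \<in> carrier C"
  shows "tsum K V H P \<beta> (\<rho> x) = tsum K C H P \<beta> (coact C x)"
proof -
  note [simp] = sub_simps assms(1,3) bilinear_map_linear[OF assms(2)]
    linear_comp[OF bilinear_map_linear(1)[OF assms(2)]]
    assms(2)
  have \<beta>C: "bilinear_map K C H P \<beta>"
    by (rule bilinear_mapI) simp_all
  have "tsum K V H P \<beta> (\<rho> x) = tsum K V H P \<beta> (tensor_map K V H Q (\<lambda>x. x) (\<rho> x))"
    using assms(3) by (simp add: C_Q_\<rho>)
  also have "\<dots> = tsum K V H P (\<lambda>v h. \<beta> (Q v) h) (\<rho> x)"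
    unfolding tensor_map_eq_tsum[where M = V and N = H] by simp
  finally show ?thesis
    by (simp only: tsum_coact_C[OF assms(1) \<beta>C assms(3)])
qed

text \<open>Sums over the coaction of C become sums over \<rho> with Q inserted. Coassociativity and
  the counit law are applied there, and the result is translated back.\<close>

lemma C_comodule: "right_comodule K H C"
proof -
  note [simp] = sub_simps linear_map_closed[OF coact_C_linear] linear_comp[OF coact_C_linear]
  let ?T = "tensor K C (tensor K H H)"
  have "tensor_assoc K C H H (tensor_map K (tensor K C H) H (coact C) (\<lambda>x. x) (coact C x)) =
      tensor_map K C (tensor K H H) (\<lambda>x. x) (comult H) (coact C x)"
    (is "?L = ?R") if x [simp]: "x \<in> carrier C" for x
  proof -
    have "?L = tsum K C H ?T (\<lambda>a c. tsum K C H ?T (\<lambda>a' b. tens K C (tensor K H H) a' (tens K H H b c))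
        (coact C a)) (coact C x)"
      unfolding tensor_assoc_eq_tsum tensor_map_eq_tsum[where M = C and N = H] by simp
    also have "\<dots> = tsum K C H ?T (\<lambda>a c. tsum K V H ?T (\<lambda>a' b. tens K C (tensor K H H) (Q a') (tens K H H b c))
        (\<rho> a)) (coact C x)"
      by (simp add: tsum_coact_C)
    also have "\<dots> = tsum K V H ?T (\<lambda>a c. tsum K V H ?T (\<lambda>a' b. tens K C (tensor K H H) (Q a') (tens K H H b c))
        (\<rho> a)) (\<rho> x)"
      by (rule tsum_\<rho>[symmetric]) simp_all
    also have "\<dots> = tsum K V H ?T (\<lambda>a b. tsum K H H ?T (\<lambda>b' c. tens K C (tensor K H H) (Q a) (tens K H H b' c))
        (comult H b)) (\<rho> x)"
      by (rule coassociativeD[OF V \<rho>_linear \<rho>_coassoc,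
            where \<gamma> = "\<lambda>a b c. tens K C (tensor K H H) (Q a) (tens K H H b c)"]) simp_all
    also have "\<dots> = tsum K C H ?T (\<lambda>a b. tsum K H H ?T (\<lambda>b' c. tens K C (tensor K H H) a (tens K H H b' c))
        (comult H b)) (coact C x)"
      by (rule tsum_coact_C[symmetric]) simp_all
    also have "\<dots> = ?R"
      unfolding tensor_map_eq_tsum[where M = C and N = H]
      by (simp del: tens_tsum_r add: tens_tsum_r[symmetric] tsum_tens_id)
    finally show ?thesis .
  qed
  moreover have "tsum K C H C (\<lambda>v h. counit H h \<odot>\<^bsub>C\<^esub> v) (coact C x) = x"
    if x [simp]: "x \<in> carrier C" for x
  proof -
    have "tsum K C H C (\<lambda>v h. counit H h \<odot>\<^bsub>C\<^esub> v) (coact C x) =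
        tsum K V H C (\<lambda>v h. counit H h \<odot>\<^bsub>C\<^esub> Q v) (\<rho> x)"
      by (rule tsum_coact_C) simp_all
    also have "\<dots> = tsum K V H C (\<lambda>v h. Q (counit H h \<odot>\<^bsub>V\<^esub> v)) (\<rho> x)"
      by (simp add: linear_map_smult[OF C_retract])
    also have "\<dots> = Q (tsum K V H V (\<lambda>v h. counit H h \<odot>\<^bsub>V\<^esub> v) (\<rho> x))"
      by (rule linear_tsum[symmetric, OF _ _ _ _ _ C_retract]) simp_all
    finally show ?thesis
      using x by (simp add: C_counit)
  qed
  ultimately show ?thesis
    using coact_C_linear module_C unfolding right_comodule_def tsum_def by blast
qed

end

section \<open>The counital part of a coassociative map\<close>

context weak_bialg
begin

context
  fixes V :: "('k, 'a, 'm) module_scheme" and \<rho>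
  assumes V [simp]: "module K V" and \<rho>_linear: "linear_map K V (tensor K V H) \<rho>"
    and \<rho>_coassoc: "coassociative K H V \<rho>"
begin

abbreviation "counital_part \<equiv> \<lambda>v. tsum K V H V (\<lambda>s h. counit H h \<odot>\<^bsub>V\<^esub> s) (\<rho> v)"

text \<open>Coassociativity puts \<epsilon> on the middle one of three legs, where it cancels
  against the last one.\<close>

lemma tsum_counital_part:
  assumes "module K P" "bilinear_map K V H P \<beta>" "v \<in> carrier V"
  shows "tsum K V H P (\<lambda>s h. \<beta> (counital_part s) h) (\<rho> v) = tsum K V H P \<beta> (\<rho> v)"
proof -
  note \<beta> = bilinear_map_linear[OF assms(2)]
  note [simp] = assms linear_comp[OF \<rho>_linear] linear_map_closed[OF \<rho>_linear] \<beta> \<beta>[THEN linear_comp]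
    linear_map_smult[OF \<beta>(1)] linear_tsum[OF _ _ _ _ _ \<beta>(1)] bilinear_map_closed[OF assms(2)]
  have "tsum K V H P (\<lambda>s h. \<beta> (counital_part s) h) (\<rho> v) =
      tsum K V H P (\<lambda>a c. tsum K V H P (\<lambda>a' b. counit H b \<odot>\<^bsub>P\<^esub> \<beta> a' c) (\<rho> a)) (\<rho> v)"
    by simp
  also have "\<dots> = tsum K V H P (\<lambda>a b. tsum K H H P (\<lambda>b' c. counit H b' \<odot>\<^bsub>P\<^esub> \<beta> a c) (comult H b)) (\<rho> v)"
    by (rule coassociativeD[OF V \<rho>_linear \<rho>_coassoc,
          where \<gamma> = "\<lambda>a b c. counit H b \<odot>\<^bsub>P\<^esub> \<beta> a c"]) simp_all
  also have "\<dots> = tsum K V H P \<beta> (\<rho> v)"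
    by (simp add: comult_counit_l[where f = "\<beta> _"])
  finally show ?thesis .
qed

text \<open>Here coassociativity puts \<epsilon> on the last leg. So v and v_0 \<epsilon>(v_1) have
  the same image under \<rho>, even where they differ.\<close>

lemma coaction_counital_part:
  assumes "v \<in> carrier V"
  shows "\<rho> (counital_part v) = \<rho> v"
proof -
  note [simp] = assms linear_comp[OF \<rho>_linear] linear_map_closed[OF \<rho>_linear]
  have "\<rho> (counital_part v) = tsum K V H (tensor K V H) (\<lambda>s h. \<rho> (counit H h \<odot>\<^bsub>V\<^esub> s)) (\<rho> v)"
    by (rule linear_tsum[OF _ _ _ _ _ \<rho>_linear]) simp_all
  also have "\<dots> = tsum K V H (tensor K V H) (\<lambda>a c. tsum K V H (tensor K V H)
      (\<lambda>a' b. counit H c \<odot>\<^bsub>tensor K V H\<^esub> tens K V H a' b) (\<rho> a)) (\<rho> v)"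
    by (simp add: linear_map_smult[OF \<rho>_linear] tsum_tens_id del: smult_tsum add: smult_tsum[symmetric])
  also have "\<dots> = tsum K V H (tensor K V H) (\<lambda>a b. tsum K H H (tensor K V H)
      (\<lambda>b' c. counit H c \<odot>\<^bsub>tensor K V H\<^esub> tens K V H a b') (comult H b)) (\<rho> v)"
    by (rule coassociativeD[OF V \<rho>_linear \<rho>_coassoc,
          where \<gamma> = "\<lambda>a b c. counit H c \<odot>\<^bsub>tensor K V H\<^esub> tens K V H a b"]) simp_all
  also have "\<dots> = \<rho> v"
    by (simp add: comult_counit_r[where f = "tens K V H _"] tsum_tens_id)
  finally show ?thesis .
qed

end

section \<open>The coaction on a product\<close>

lemma prod_coact_eq: "prod_coact K H M N t =
    tsum K M N (tensor K (tensor K M N) H) (\<lambda>m n.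
      tsum K M H (tensor K (tensor K M N) H) (\<lambda>m\<^sub>0 m\<^sub>1.
        tsum K N H (tensor K (tensor K M N) H) (\<lambda>n\<^sub>0 n\<^sub>1.
          tens K (tensor K M N) H (tens K M N m\<^sub>0 n\<^sub>0) (m\<^sub>1 \<otimes>\<^bsub>H\<^esub> n\<^sub>1)) (coact N n)) (coact M m)) t"
  by (simp add: prod_coact_def Let_def tsum_def)

lemma prod_proj_eq: "prod_proj K H M N t =
    tsum K M N (tensor K M N) (\<lambda>m n. tsum K M H (tensor K M N) (\<lambda>m\<^sub>0 m\<^sub>1.
        tsum K N H (tensor K M N) (\<lambda>n\<^sub>0 n\<^sub>1.
          counit H (m\<^sub>1 \<otimes>\<^bsub>H\<^esub> n\<^sub>1) \<odot>\<^bsub>tensor K M N\<^esub> tens K M N m\<^sub>0 n\<^sub>0) (coact N n)) (coact M m)) t"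
  by (simp add: prod_proj_def Let_def tsum_def)

context
  fixes M :: "('k, 'a, 'h) comodule" and N :: "('k, 'b, 'h) comodule"
  assumes M [simp]: "right_comodule K H M" and N [simp]: "right_comodule K H N"
begin

abbreviation "MN \<equiv> tensor K M N"

lemma prod_coact_linear: "linear_map K MN (tensor K MN H) (prod_coact K H M N)"
  unfolding prod_coact_eq[abs_def] by simp

lemma prod_coact_tens:
  "\<lbrakk>m \<in> carrier M; n \<in> carrier N\<rbrakk> \<Longrightarrow> prod_coact K H M N (tens K M N m n) =
    tsum K M H (tensor K MN H) (\<lambda>m\<^sub>0 m\<^sub>1. tsum K N H (tensor K MN H) (\<lambda>n\<^sub>0 n\<^sub>1.
      tens K MN H (tens K M N m\<^sub>0 n\<^sub>0) (m\<^sub>1 \<otimes>\<^bsub>H\<^esub> n\<^sub>1)) (coact N n)) (coact M m)"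
  unfolding prod_coact_eq by simp

lemma prod_proj_linear: "linear_map K MN MN (prod_proj K H M N)"
  unfolding prod_proj_eq[abs_def] by simp

lemma prod_proj_tens:
  "\<lbrakk>m \<in> carrier M; n \<in> carrier N\<rbrakk> \<Longrightarrow> prod_proj K H M N (tens K M N m n) =
    tsum K M H MN (\<lambda>m\<^sub>0 m\<^sub>1. tsum K N H MN (\<lambda>n\<^sub>0 n\<^sub>1.
      counit H (m\<^sub>1 \<otimes>\<^bsub>H\<^esub> n\<^sub>1) \<odot>\<^bsub>MN\<^esub> tens K M N m\<^sub>0 n\<^sub>0) (coact N n)) (coact M m)"
  unfolding prod_proj_eq by simp

text \<open>On m \<otimes> n both sides read \<epsilon>(m_1 n_1) m_0 \<otimes> n_0. The projection
  is therefore the counital part of the product coaction, so its idempotence and its invisibility to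
  the coaction become general facts about coassociative maps.\<close>

lemma prod_proj_counit:
  assumes "t \<in> carrier MN"
  shows "prod_proj K H M N t = tsum K MN H MN (\<lambda>s h. counit H h \<odot>\<^bsub>MN\<^esub> s) (prod_coact K H M N t)"
proof (rule tensor_ext[OF _ _ _ prod_proj_linear _ _ assms])
  show "linear_map K MN MN (\<lambda>t. tsum K MN H MN (\<lambda>s h. counit H h \<odot>\<^bsub>MN\<^esub> s) (prod_coact K H M N t))"
    by (simp add: linear_comp[OF prod_coact_linear])
qed (simp_all add: prod_proj_tens prod_coact_tens)

lemma tsum_prod_coact:
  assumes "module K P" "bilinear_map K MN H P \<beta>" "m \<in> carrier M" "n \<in> carrier N"
  shows "tsum K MN H P \<beta> (prod_coact K H M N (tens K M N m n)) =
    tsum K M H P (\<lambda>m\<^sub>0 m\<^sub>1. tsum K N H P (\<lambda>n\<^sub>0 n\<^sub>1. \<beta> (tens K M N m\<^sub>0 n\<^sub>0) (m\<^sub>1 \<otimes>\<^bsub>H\<^esub> n\<^sub>1)) (coact N n)) (coact M m)"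
proof -
  note [simp] = assms bilinear_map_linear[OF assms(2)] bilinear_map_linear[OF assms(2), THEN linear_comp]
  show ?thesis by (simp add: prod_coact_tens)
qed

text \<open>The legs of m and of n are regrouped by the coassociativity of M and N separately;
  multiplicativity of \<Delta> then merges the two coproducts in H into the coproduct of m_1
  n_1.\<close>

lemma prod_coact_coassoc: "coassociative K H MN (prod_coact K H M N)"
  unfolding coassociative_def
proof
  let ?pc = "prod_coact K H M N"
  let ?T = "tensor K MN (tensor K H H)"
  let ?t = "tens K MN (tensor K H H)"
  note [simp] = linear_comp[OF prod_coact_linear] linear_map_closed[OF prod_coact_linear]
  have eqs: "tensor_assoc K MN H H (tensor_map K (tensor K MN H) H ?pc (\<lambda>x. x) (?pc v)) =
      tsum K MN H ?T (\<lambda>a c. tsum K MN H ?T (\<lambda>a' b. ?t a' (tens K H H b c)) (?pc a)) (?pc v)"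
    "tensor_map K MN (tensor K H H) (\<lambda>x. x) (comult H) (?pc v) =
      tsum K MN H ?T (\<lambda>a h. ?t a (comult H h)) (?pc v)"
    if "v \<in> carrier MN" for v
    unfolding tensor_assoc_eq_tsum tensor_map_eq_tsum[where M = MN and N = H] using that by simp_all
  fix v assume v: "v \<in> carrier MN"
  show "tensor_assoc K MN H H (tensor_map K (tensor K MN H) H ?pc (\<lambda>x. x) (?pc v)) =
        tensor_map K MN (tensor K H H) (\<lambda>x. x) (comult H) (?pc v)"
    unfolding eqs[OF v]
  proof (rule tensor_ext[OF _ _ _ _ _ _ v, where P = ?T])
    fix m n assume [simp]: "m \<in> carrier M" "n \<in> carrier N"
    let ?g = "\<lambda>a b h h' k k'. ?t (tens K M N a b) (tens K H H (h \<otimes>\<^bsub>H\<^esub> k) (h' \<otimes>\<^bsub>H\<^esub> k'))"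
    have "tsum K MN H ?T (\<lambda>a c. tsum K MN H ?T (\<lambda>a' b. ?t a' (tens K H H b c)) (?pc a)) (?pc (tens K M N m n)) =
      tsum K M H ?T (\<lambda>m\<^sub>0 m\<^sub>1. tsum K N H ?T (\<lambda>n\<^sub>0 n\<^sub>1. tsum K M H ?T (\<lambda>a h. tsum K N H ?T (\<lambda>b k.
        ?g a b h m\<^sub>1 k n\<^sub>1) (coact N n\<^sub>0)) (coact M m\<^sub>0)) (coact N n)) (coact M m)"
      by (simp add: tsum_prod_coact)
    \<comment> \<open>The two sums belonging to m, and the two belonging to n, must be adjacent
      before coassociativity of either comodule applies.\<close>
    also have "\<dots> = tsum K M H ?T (\<lambda>m\<^sub>0 m\<^sub>1. tsum K M H ?T (\<lambda>a h. tsum K N H ?T (\<lambda>n\<^sub>0 n\<^sub>1. tsum K N H ?T (\<lambda>b k.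
        ?g a b h m\<^sub>1 k n\<^sub>1) (coact N n\<^sub>0)) (coact N n)) (coact M m\<^sub>0)) (coact M m)"
      by (intro tsum_cong tsum_swap refl) simp_all
    also have "\<dots> = tsum K M H ?T (\<lambda>m\<^sub>0 m\<^sub>1. tsum K M H ?T (\<lambda>a h. tsum K N H ?T (\<lambda>b n\<^sub>1. tsum K H H ?T (\<lambda>k k'.
        ?g a b h m\<^sub>1 k k') (comult H n\<^sub>1)) (coact N n)) (coact M m\<^sub>0)) (coact M m)"
      by (intro tsum_cong refl coact_coassoc[OF N, where \<gamma> = "\<lambda>b k k'. ?g _ b _ _ k k'"]) simp_all
    also have "\<dots> = tsum K M H ?T (\<lambda>a m\<^sub>1. tsum K H H ?T (\<lambda>h h'. tsum K N H ?T (\<lambda>b n\<^sub>1. tsum K H H ?T (\<lambda>k k'.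
        ?g a b h h' k k') (comult H n\<^sub>1)) (coact N n)) (comult H m\<^sub>1)) (coact M m)"
      by (rule coact_coassoc[OF M, where \<gamma> = "\<lambda>a h h'. tsum K N H ?T (\<lambda>b n\<^sub>1. tsum K H H ?T (\<lambda>k k'.
        ?g a b h h' k k') (comult H n\<^sub>1)) (coact N n)"]) simp_all
    also have "\<dots> = tsum K M H ?T (\<lambda>a m\<^sub>1. tsum K N H ?T (\<lambda>b n\<^sub>1. tsum K H H ?T (\<lambda>h h'. tsum K H H ?T (\<lambda>k k'.
        ?g a b h h' k k') (comult H n\<^sub>1)) (comult H m\<^sub>1)) (coact N n)) (coact M m)"
      by (intro tsum_cong tsum_swap refl) simp_all
    also have "\<dots> = tsum K M H ?T (\<lambda>a m\<^sub>1. tsum K N H ?T (\<lambda>b n\<^sub>1.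
        ?t (tens K M N a b) (tsum K H H (tensor K H H) (tens K H H) (comult H (m\<^sub>1 \<otimes>\<^bsub>H\<^esub> n\<^sub>1)))) (coact N n)) (coact M m)"
      by (simp add: comult_mult)
    also have "\<dots> = tsum K MN H ?T (\<lambda>a h. ?t a (comult H h)) (?pc (tens K M N m n))"
      by (simp add: tsum_prod_coact tsum_tens_id del: tens_tsum_r)
    finally show "tsum K MN H ?T (\<lambda>a c. tsum K MN H ?T (\<lambda>a' b. ?t a' (tens K H H b c)) (?pc a)) (?pc (tens K M N m n)) =
      tsum K MN H ?T (\<lambda>a h. ?t a (comult H h)) (?pc (tens K M N m n))" .
  qed simp_all
qed

lemma tsum_prod_proj:
  assumes "module K P" "bilinear_map K MN H P \<beta>" "t \<in> carrier MN"
  shows "tsum K MN H P (\<lambda>s h. \<beta> (prod_proj K H M N s) h) (prod_coact K H M N t) =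
    tsum K MN H P \<beta> (prod_coact K H M N t)"
proof -
  have "tsum K MN H P (\<lambda>s h. \<beta> (prod_proj K H M N s) h) (prod_coact K H M N t) =
    tsum K MN H P (\<lambda>s h. \<beta> (tsum K MN H MN (\<lambda>s h. counit H h \<odot>\<^bsub>MN\<^esub> s) (prod_coact K H M N s)) h)
      (prod_coact K H M N t)"
    using linear_map_closed[OF prod_coact_linear assms(3)]
    by (intro tsum_cong refl) (simp_all only: prod_proj_counit tensor_module comodule_module M N module_H)
  then show ?thesis
    using tsum_counital_part[OF _ prod_coact_linear prod_coact_coassoc assms] by simp
qed

lemma prod_coact_proj:
  "t \<in> carrier MN \<Longrightarrow> prod_coact K H M N (prod_proj K H M N t) = prod_coact K H M N t"
  using coaction_counital_part[OF _ prod_coact_linear prod_coact_coassoc, of t]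
  by (simp add: prod_proj_counit)

lemma prod_proj_idem:
  "t \<in> carrier MN \<Longrightarrow> prod_proj K H M N (prod_proj K H M N t) = prod_proj K H M N t"
proof -
  assume t: "t \<in> carrier MN"
  have "prod_proj K H M N (prod_proj K H M N t) = tsum K MN H MN (\<lambda>s h. counit H h \<odot>\<^bsub>MN\<^esub> s)
      (prod_coact K H M N (prod_proj K H M N t))"
    by (intro prod_proj_counit linear_map_closed[OF prod_proj_linear t])
  also have "\<dots> = prod_proj K H M N t"
    unfolding prod_coact_proj[OF t] by (rule prod_proj_counit[OF t, symmetric])
  finally show ?thesis .
qed

lemma subcomodule_prod:
  "subcomodule K H MN (prod_coact K H M N) (prod_proj K H M N)
    {x \<in> carrier MN. prod_proj K H M N x = x}"
proof (intro subcomodule.intro subcomodule_axioms.intro weak_bialg_axioms)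
  fix x assume x: "x \<in> {x \<in> carrier MN. prod_proj K H M N x = x}"
  then have [simp]: "x \<in> carrier MN" by simp
  show "tensor_map K MN H (prod_proj K H M N) (\<lambda>x. x) (prod_coact K H M N x) = prod_coact K H M N x"
    using linear_map_closed[OF prod_coact_linear, of x]
    by (simp add: tensor_map_eq_tsum[where M = MN and N = H] tsum_prod_proj[where \<beta> = "tens K MN H"]
        tsum_tens_id)
  show "tsum K MN H MN (\<lambda>v h. counit H h \<odot>\<^bsub>MN\<^esub> v) (prod_coact K H M N x) = x"
    using x by (simp add: prod_proj_counit)
qed (simp_all add: prod_coact_linear prod_coact_coassoc prod_proj_linear prod_proj_idem)

lemma comodule_prod_eq: "comodule_prod K H M N = subcomodule.C K H MN (prod_coact K H M N)
    {x \<in> carrier MN. prod_proj K H M N x = x}"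
  unfolding subcomodule.C_def[OF subcomodule_prod] comodule_prod_def Let_def ..

lemma carrier_comodule_prod:
  "x \<in> carrier (comodule_prod K H M N) \<longleftrightarrow> x \<in> carrier MN \<and> prod_proj K H M N x = x"
  by (simp add: comodule_prod_eq subcomodule.C_carrier[OF subcomodule_prod])

lemmas comodule_prod_comodule [simp] =
  subcomodule.C_comodule[OF subcomodule_prod, folded comodule_prod_eq]
lemmas comodule_prod_incl = subcomodule.C_incl[OF subcomodule_prod, folded comodule_prod_eq]
lemmas prod_proj_retract = subcomodule.C_retract[OF subcomodule_prod, folded comodule_prod_eq]
lemmas tsum_prod_coact_comodule_prod =
  subcomodule.tsum_\<rho>[OF subcomodule_prod, folded comodule_prod_eq]

end

section \<open>The unit comodule\<close>

lemma subcomodule_unit: "subcomodule K H H (comult H) (counit_s K H) (H_s K H)"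
proof (intro subcomodule.intro subcomodule_axioms.intro weak_bialg_axioms)
  show "H_s K H = {x \<in> carrier H. counit_s K H x = x}"
    by (auto simp: H_s_iff)
  fix x assume x: "x \<in> H_s K H"
  then have [simp]: "x \<in> carrier H" by (simp add: H_s_iff)
  show "tensor_map K H H (counit_s K H) (\<lambda>x. x) (comult H x) = comult H x"
    by (simp add: tensor_map_eq_tsum[where M = H and N = H] tsum_tens_id
        counit_s_comult_H_s[where \<beta> = "tens K H H", OF _ _ x])
  show "tsum K H H H (\<lambda>v h. counit H h \<odot>\<^bsub>H\<^esub> v) (comult H x) = x"
    by (rule comult_counit_r) simp_all
qed (simp_all add: comult_linear coassociative_comult counit_s_linear)

lemma unit_comodule_eq: "unit_comodule K H = subcomodule.C K H H (comult H) (H_s K H)"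
  unfolding subcomodule.C_def[OF subcomodule_unit] unit_comodule_def ..

lemma carrier_unit_comodule: "carrier (unit_comodule K H) = H_s K H"
  by (simp add: unit_comodule_eq subcomodule.C_carrier[OF subcomodule_unit])

lemmas unit_comodule_comodule [simp] =
  subcomodule.C_comodule[OF subcomodule_unit, folded unit_comodule_eq]
lemmas unit_comodule_incl = subcomodule.C_incl[OF subcomodule_unit, folded unit_comodule_eq]
lemmas unit_comodule_retract = subcomodule.C_retract[OF subcomodule_unit, folded unit_comodule_eq]
lemmas tsum_coact_unit_comodule =
  subcomodule.tsum_coact_C[OF subcomodule_unit, folded unit_comodule_eq]
lemmas tsum_comult_unit_comodule =
  subcomodule.tsum_\<rho>[OF subcomodule_unit, folded unit_comodule_eq]

section \<open>Colinear maps\<close>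

text \<open>The condition of \<open>comodule_hom\<close> without extensionality, which concerns the
  encoding of functions only.\<close>

definition colinear :: "('k, 'a, 'h) comodule \<Rightarrow> ('k, 'b, 'h) comodule \<Rightarrow> ('a \<Rightarrow> 'b) \<Rightarrow> bool" where
  "colinear M N f \<longleftrightarrow> linear_map K M N f \<and>
     (\<forall>m\<in>carrier M. coact N (f m) = tensor_map K N H f (\<lambda>x. x) (coact M m))"

lemma comodule_hom_iff: "f \<in> comodule_hom K H M N \<longleftrightarrow> f \<in> extensional (carrier M) \<and> colinear M N f"
  by (auto simp: comodule_hom_def colinear_def)

lemma colinear_linear: "colinear M N f \<Longrightarrow> linear_map K M N f"
  by (simp add: colinear_def)

lemma colinear_coact:
  "\<lbrakk>colinear M N f; m \<in> carrier M\<rbrakk>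
   \<Longrightarrow> coact N (f m) = tsum K M H (tensor K N H) (\<lambda>a h. tens K N H (f a) h) (coact M m)"
  by (simp add: colinear_def tensor_map_eq_tsum[where M = M and N = H])

lemma colinearI:
  assumes "linear_map K M N f"
    and "\<And>m. m \<in> carrier M \<Longrightarrow>
      coact N (f m) = tsum K M H (tensor K N H) (\<lambda>a h. tens K N H (f a) h) (coact M m)"
  shows "colinear M N f"
  unfolding colinear_def tensor_map_eq_tsum[where M = M and N = H] using assms by blast

lemma tsum_colinear:
  assumes "right_comodule K H M" "right_comodule K H N" and f: "colinear M N f"
    and "module K P" "bilinear_map K N H P \<beta>" "m \<in> carrier M"
  shows "tsum K N H P \<beta> (coact N (f m)) = tsum K M H P (\<lambda>a h. \<beta> (f a) h) (coact M m)"
proof -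
  note lf = colinear_linear[OF f]
  note [simp] = assms linear_comp[OF lf] linear_map_closed[OF lf] bilinear_map_linear[OF assms(5)]
    linear_comp[OF bilinear_map_linear(1)[OF assms(5)]]
  show ?thesis
    by (simp add: colinear_coact[OF f])
qed

text \<open>The projection depends on m and n only through their coactions, and f and g commute with
  these.\<close>

lemma prod_proj_natural:
  assumes M: "right_comodule K H M" and N: "right_comodule K H N"
    and M': "right_comodule K H M'" and N': "right_comodule K H N'"
    and f: "colinear M M' f" and g: "colinear N N' g" and "t \<in> carrier (tensor K M N)"
  shows "prod_proj K H M' N' (tensor_map K M' N' f g t) = tensor_map K M' N' f g (prod_proj K H M N t)"
proof -
  note lf = colinear_linear[OF f] and lg = colinear_linear[OF g]
  note [simp] = M N M' N' assms(7) linear_comp[OF lf] linear_comp[OF lg] linear_map_closed[OF lf]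
    linear_map_closed[OF lg] linear_comp[OF prod_proj_linear]
  let ?T = "tensor K M N" and ?T' = "tensor K M' N'"
  show ?thesis
    unfolding tensor_map_eq_tsum[where M = M and N = N]
    by (rule tensor_ext[OF _ _ _ _ _ _ assms(7), where P = ?T'])
      (simp_all add: prod_proj_tens tsum_colinear[OF M M' f] tsum_colinear[OF N N' g])
qed

lemma tensor_map_comodule_prod:
  assumes "right_comodule K H M" "right_comodule K H N"
    and "right_comodule K H M'" "right_comodule K H N'"
    and f: "colinear M M' f" and g: "colinear N N' g" and x: "x \<in> carrier (comodule_prod K H M N)"
  shows "tensor_map K M' N' f g x \<in> carrier (comodule_prod K H M' N')"
proof -
  note lf = colinear_linear[OF f] and lg = colinear_linear[OF g]
  note [simp] = assms(1-4) linear_comp[OF lf] linear_comp[OF lg] linear_map_closed[OF lf]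
    linear_map_closed[OF lg]
  have x': "x \<in> carrier (tensor K M N)" "prod_proj K H M N x = x"
    using x by (simp_all add: carrier_comodule_prod)
  then have "tensor_map K M' N' f g x \<in> carrier (tensor K M' N')"
    unfolding tensor_map_eq_tsum[where M = M and N = N] by simp
  then show ?thesis
    using prod_proj_natural[OF assms(1-6) x'(1)] x'(2) by (simp add: carrier_comodule_prod)
qed

end

context weak_bialg
begin

section \<open>The associator\<close>

context
  fixes M :: "('k, 'a, 'h) comodule" and N :: "('k, 'b, 'h) comodule" and L :: "('k, 'c, 'h) comodule"
  assumes M [simp]: "right_comodule K H M" and N [simp]: "right_comodule K H N"
    and L [simp]: "right_comodule K H L"
begin

abbreviation "P_MN \<equiv> prod_proj K H M N"
abbreviation "P_NL \<equiv> prod_proj K H N L"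
abbreviation "prod_MN \<equiv> comodule_prod K H M N"
abbreviation "prod_NL \<equiv> comodule_prod K H N L"
abbreviation "incl_l \<equiv> tensor_map K (tensor K M N) L (\<lambda>x. x) (\<lambda>x. x)"
abbreviation "incl_r \<equiv> tensor_map K M (tensor K N L) (\<lambda>x. x) (\<lambda>x. x)"

lemmas incl_l_eq = tensor_map_eq_tsum[where M = prod_MN and N = L and M' = "tensor K M N" and N' = L]
lemmas incl_r_eq = tensor_map_eq_tsum[where M = M and N = prod_NL and M' = M and N' = "tensor K N L"]

lemmas prod_incl [simp] =
  linear_comp[OF comodule_prod_incl[OF M N]] linear_comp[OF comodule_prod_incl[OF N L]]
  linear_comp[OF prod_proj_retract[OF M N]] linear_comp[OF prod_proj_retract[OF N L]]
  linear_map_closed[OF prod_proj_retract[OF M N]] linear_map_closed[OF prod_proj_retract[OF N L]]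
  linear_map_closed[OF comodule_prod_incl[OF M N]] linear_map_closed[OF comodule_prod_incl[OF N L]]

lemma prod_proj_fixed:
  "s \<in> carrier prod_MN \<Longrightarrow> P_MN s = s"
  by (simp add: carrier_comodule_prod)

text \<open>Both sides reduce to \<epsilon>(a_1 b_1 c_1) a_0 \<otimes> (b_0 \<otimes> c_0). The
  inner projections leave no trace, because the outer ones use only the coactions of P(a \<otimes>
  b) and P(b \<otimes> c), and these come from the product coactions of a \<otimes> b and b
  \<otimes> c.\<close>

lemma assoc_prod_proj_tens:
  assumes [simp]: "a \<in> carrier M" "b \<in> carrier N" "c \<in> carrier L"
  shows "tensor_assoc K M N L (incl_l (prod_proj K H prod_MN L (tens K prod_MN L (P_MN (tens K M N a b)) c))) =
    incl_r (prod_proj K H M prod_NL (tens K M prod_NL a (P_NL (tens K N L b c))))"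
    (is "?l = ?r")
proof -
  let ?T = "tensor K M (tensor K N L)"
  let ?t = "\<lambda>a b c. tens K M (tensor K N L) a (tens K N L b c)"
  note [simp] = linear_map_closed[OF prod_coact_linear]
  define s where "s = P_MN (tens K M N a b)"
  define r where "r = P_NL (tens K N L b c)"
  have [simp]: "s \<in> carrier prod_MN" "r \<in> carrier prod_NL"
    by (simp_all add: s_def r_def)
  have s: "prod_coact K H M N s = prod_coact K H M N (tens K M N a b)"
    and r: "prod_coact K H N L r = prod_coact K H N L (tens K N L b c)"
    by (simp_all add: s_def r_def prod_coact_proj)
  have "?l = tsum K prod_MN H ?T (\<lambda>s h. tsum K L H ?T (\<lambda>c k. counit H (h \<otimes>\<^bsub>H\<^esub> k) \<odot>\<^bsub>?T\<^esub>
      tsum K M N ?T (\<lambda>a b. ?t a b c) s) (coact L c)) (coact prod_MN s)"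
    unfolding incl_l_eq tensor_assoc_eq_tsum s_def[symmetric] by (simp add: prod_proj_tens)
  also have "\<dots> = tsum K (tensor K M N) H ?T (\<lambda>s h. tsum K L H ?T (\<lambda>c k. counit H (h \<otimes>\<^bsub>H\<^esub> k) \<odot>\<^bsub>?T\<^esub>
      tsum K M N ?T (\<lambda>a b. ?t a b c) s) (coact L c)) (prod_coact K H M N s)"
    by (rule tsum_prod_coact_comodule_prod[symmetric]) simp_all
  also have "\<dots> = tsum K M H ?T (\<lambda>a h. tsum K N H ?T (\<lambda>b i. tsum K L H ?T (\<lambda>c k.
      counit H (h \<otimes>\<^bsub>H\<^esub> (i \<otimes>\<^bsub>H\<^esub> k)) \<odot>\<^bsub>?T\<^esub> ?t a b c) (coact L c)) (coact N b)) (coact M a)"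
    unfolding s by (simp add: tsum_prod_coact H.m_assoc)
  also have "\<dots> = tsum K M H ?T (\<lambda>a h. tsum K (tensor K N L) H ?T (\<lambda>s k.
      counit H (h \<otimes>\<^bsub>H\<^esub> k) \<odot>\<^bsub>?T\<^esub> tens K M (tensor K N L) a s) (prod_coact K H N L r)) (coact M a)"
    unfolding r by (simp add: tsum_prod_coact)
  also have "\<dots> = tsum K M H ?T (\<lambda>a h. tsum K prod_NL H ?T (\<lambda>s k.
      counit H (h \<otimes>\<^bsub>H\<^esub> k) \<odot>\<^bsub>?T\<^esub> tens K M (tensor K N L) a s) (coact prod_NL r)) (coact M a)"
    by (intro tsum_cong refl tsum_prod_coact_comodule_prod) simp_all
  also have "\<dots> = ?r"
    unfolding incl_r_eq r_def[symmetric] by (simp add: prod_proj_tens)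
  finally show ?thesis .
qed

text \<open>On the monoidal product this is the preimage that \<^const>\<open>prod_assoc\<close> selects; the formula makes
  sense, and is linear, on the whole of \<open>(M \<otimes> N) \<otimes> L\<close>.\<close>

definition "assoc_proj z = prod_proj K H M prod_NL
   (tsum K M (tensor K N L) (tensor K M prod_NL) (\<lambda>a t. tens K M prod_NL a (P_NL t))
     (tensor_assoc K M N L z))"

lemma assoc_linear: "linear_map K (tensor K (tensor K M N) L) (tensor K M (tensor K N L)) (tensor_assoc K M N L)"
  unfolding tensor_assoc_eq_tsum[abs_def] by simp

lemma assoc_proj_linear:
  "linear_map K (tensor K (tensor K M N) L) (tensor K M prod_NL) assoc_proj"
  unfolding assoc_proj_def[abs_def]
  by (simp add: linear_comp[OF prod_proj_linear] linear_comp[OF assoc_linear])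

lemma assoc_proj_in: "z \<in> carrier (tensor K (tensor K M N) L) \<Longrightarrow>
    assoc_proj z \<in> carrier (comodule_prod K H M prod_NL)"
  unfolding assoc_proj_def
  by (intro linear_map_closed[OF prod_proj_retract])
    (simp_all add: linear_map_closed[OF assoc_linear])

lemma incl_l_linear: "linear_map K (tensor K prod_MN L) (tensor K (tensor K M N) L) incl_l"
  and incl_r_linear: "linear_map K (tensor K M prod_NL) (tensor K M (tensor K N L)) incl_r"
  unfolding incl_l_eq[abs_def] incl_r_eq[abs_def] by simp_all

text \<open>The element t ranges over all of M \<otimes> N because a monoidal product is in general
  not spanned by the pure tensors lying in it. Linearity in t reduces the claim to
  \<open>assoc_prod_proj_tens\<close>.\<close>

lemma assoc_proj_tens:
  assumes "t \<in> carrier (tensor K M N)" "c \<in> carrier L"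
  shows "incl_r (assoc_proj (tens K (tensor K M N) L t c)) =
    tensor_assoc K M N L (incl_l (prod_proj K H prod_MN L (tens K prod_MN L (P_MN t) c)))"
proof (rule tensor_ext[OF _ _ _ _ _ _ assms(1), where P = "tensor K M (tensor K N L)"])
  fix a b assume [simp]: "a \<in> carrier M" "b \<in> carrier N"
  have "assoc_proj (tens K (tensor K M N) L (tens K M N a b) c) =
    prod_proj K H M prod_NL (tens K M prod_NL a (P_NL (tens K N L b c)))"
    unfolding assoc_proj_def tensor_assoc_eq_tsum using assms(2) by simp
  then show "incl_r (assoc_proj (tens K (tensor K M N) L (tens K M N a b) c)) =
    tensor_assoc K M N L (incl_l (prod_proj K H prod_MN L (tens K prod_MN L (P_MN (tens K M N a b)) c)))"
    using assms(2) by (simp add: assoc_prod_proj_tens)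
qed (use assms(2) in \<open>simp_all add: linear_comp[OF incl_r_linear] linear_comp[OF assoc_proj_linear]
    linear_comp[OF assoc_linear] linear_comp[OF incl_l_linear] linear_comp[OF prod_proj_linear]\<close>)

lemma incl_assoc_proj:
  assumes "x \<in> carrier (tensor K prod_MN L)"
  shows "incl_r (assoc_proj (incl_l x)) = tensor_assoc K M N L (incl_l (prod_proj K H prod_MN L x))"
proof (rule tensor_ext[OF _ _ _ _ _ _ assms, where P = "tensor K M (tensor K N L)"])
  fix s c assume [simp]: "s \<in> carrier prod_MN" "c \<in> carrier L"
  have "incl_l (tens K prod_MN L s c) = tens K (tensor K M N) L s c"
    unfolding incl_l_eq by simp
  then show "incl_r (assoc_proj (incl_l (tens K prod_MN L s c))) =
    tensor_assoc K M N L (incl_l (prod_proj K H prod_MN L (tens K prod_MN L s c)))"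
    by (simp add: assoc_proj_tens prod_proj_fixed)
qed (simp_all add: linear_comp[OF incl_r_linear] linear_comp[OF assoc_proj_linear]
    linear_comp[OF assoc_linear] linear_comp[OF incl_l_linear] linear_comp[OF prod_proj_linear])

text \<open>\<open>inv_into\<close> returns an element with these properties as soon as one exists.
  Since the outer projection fixes x, \<open>incl_assoc_proj\<close> shows that
  \<open>assoc_proj (incl_l x)\<close> is one.\<close>

lemma prod_assoc_props:
  assumes "x \<in> carrier (comodule_prod K H prod_MN L)"
  shows "prod_assoc K H M N L x \<in> carrier (comodule_prod K H M prod_NL)"
    and "incl_r (prod_assoc K H M N L x) = tensor_assoc K M N L (incl_l x)"
proof -
  have x: "x \<in> carrier (tensor K prod_MN L)" "prod_proj K H prod_MN L x = x"
    using assms by (simp_all add: carrier_comodule_prod)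
  have "incl_r (assoc_proj (incl_l x)) = tensor_assoc K M N L (incl_l x)"
    using incl_assoc_proj[OF x(1)] x(2) by simp
  moreover have "assoc_proj (incl_l x) \<in> carrier (comodule_prod K H M prod_NL)"
    using x(1) by (intro assoc_proj_in linear_map_closed[OF incl_l_linear])
  ultimately have im: "tensor_assoc K M N L (incl_l x) \<in> incl_r ` carrier (comodule_prod K H M prod_NL)"
    by (metis image_eqI)
  have eq: "prod_assoc K H M N L x =
      inv_into (carrier (comodule_prod K H M prod_NL)) incl_r (tensor_assoc K M N L (incl_l x))"
    using assms by (simp add: prod_assoc_def)
  show "prod_assoc K H M N L x \<in> carrier (comodule_prod K H M prod_NL)"
    unfolding eq by (rule inv_into_into[OF im])
  show "incl_r (prod_assoc K H M N L x) = tensor_assoc K M N L (incl_l x)"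
    unfolding eq by (rule f_inv_into_f[OF im])
qed

end

end

section \<open>From comodule algebras to algebras in the category of comodules\<close>

text \<open>The product and the unit are parameters because the fields \<^const>\<open>mult\<close> and \<^const>\<open>one\<close> of the
  comodule underlying an algebra in the category are undefined.  The assumption \<open>coact_e\<close> expresses
  \<open>\<rho>(e) \<in> A \<otimes> H\<^sub>t\<close>.\<close>

locale comod_alg = weak_bialg K H
  for K :: "('k, 'z) ring_scheme" and H :: "('k, 'h, 'w) bialgebra_scheme" +
  fixes A :: "('k, 'a, 'h) comodule" and mul :: "'a \<Rightarrow> 'a \<Rightarrow> 'a" and e :: 'a
  assumes A [simp]: "right_comodule K H A"
    and mul_bilinear: "bilinear_map K A A A mul"
    and mul_assoc: "\<lbrakk>a \<in> carrier A; b \<in> carrier A; c \<in> carrier A\<rbrakk> \<Longrightarrow> mul (mul a b) c = mul a (mul b c)"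
    and e_closed [simp]: "e \<in> carrier A"
    and mul_one: "a \<in> carrier A \<Longrightarrow> mul e a = a" "a \<in> carrier A \<Longrightarrow> mul a e = a"
    and coact_mul: "\<lbrakk>a \<in> carrier A; b \<in> carrier A\<rbrakk> \<Longrightarrow> coact A (mul a b) =
      tsum K A H (tensor K A H) (\<lambda>a\<^sub>0 a\<^sub>1. tsum K A H (tensor K A H)
        (\<lambda>b\<^sub>0 b\<^sub>1. tens K A H (mul a\<^sub>0 b\<^sub>0) (a\<^sub>1 \<otimes>\<^bsub>H\<^esub> b\<^sub>1)) (coact A b)) (coact A a)"
    and coact_e: "tsum K A H (tensor K A H) (\<lambda>a h. tens K A H a (counit_t K H h)) (coact A e) = coact A e"
begin

lemma mul_closed [simp]: "\<lbrakk>a \<in> carrier A; b \<in> carrier A\<rbrakk> \<Longrightarrow> mul a b \<in> carrier A"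
  by (rule bilinear_map_closed[OF mul_bilinear])

lemmas linear_mul [simp] = mul_bilinear bilinear_map_linear[OF mul_bilinear]
  linear_comp[OF bilinear_map_linear(1)[OF mul_bilinear]]
  linear_comp[OF bilinear_map_linear(2)[OF mul_bilinear]]

lemmas smult_mul = linear_map_smult[OF bilinear_map_linear(1)[OF mul_bilinear]]
  linear_map_smult[OF bilinear_map_linear(2)[OF mul_bilinear]]

lemma mul_tsum:
  assumes "module K X" "module K Y" "bilinear_map K X Y A \<beta>" "t \<in> carrier (tensor K X Y)" "c \<in> carrier A"
  shows "mul (tsum K X Y A \<beta> t) c = tsum K X Y A (\<lambda>x y. mul (\<beta> x y) c) t"
    and "mul c (tsum K X Y A \<beta> t) = tsum K X Y A (\<lambda>x y. mul c (\<beta> x y)) t"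
  using assms
  by (intro linear_tsum[OF _ _ _ _ _ bilinear_map_linear(1)[OF mul_bilinear]]
      linear_tsum[OF _ _ _ _ _ bilinear_map_linear(2)[OF mul_bilinear]]; simp)+

lemma tsum_coact_mul:
  assumes "module K P" "bilinear_map K A H P \<beta>" "a \<in> carrier A" "b \<in> carrier A"
  shows "tsum K A H P \<beta> (coact A (mul a b)) =
    tsum K A H P (\<lambda>a\<^sub>0 a\<^sub>1. tsum K A H P (\<lambda>b\<^sub>0 b\<^sub>1. \<beta> (mul a\<^sub>0 b\<^sub>0) (a\<^sub>1 \<otimes>\<^bsub>H\<^esub> b\<^sub>1)) (coact A b)) (coact A a)"
proof -
  note [simp] = assms bilinear_map_linear[OF assms(2)] bilinear_map_linear[OF assms(2), THEN linear_comp]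
  show ?thesis by (simp add: coact_mul)
qed

lemma tsum_coact_e:
  assumes "module K P" "bilinear_map K A H P \<beta>"
  shows "tsum K A H P (\<lambda>a h. \<beta> a (counit_t K H h)) (coact A e) = tsum K A H P \<beta> (coact A e)"
proof -
  note [simp] = assms bilinear_map_linear[OF assms(2)] bilinear_map_linear[OF assms(2), THEN linear_comp]
  have "tsum K A H P \<beta> (tsum K A H (tensor K A H) (\<lambda>a h. tens K A H a (counit_t K H h)) (coact A e)) =
      tsum K A H P (\<lambda>a h. \<beta> a (counit_t K H h)) (coact A e)"
    by simp
  then show ?thesis by (simp only: coact_e)
qed

abbreviation "AA \<equiv> tensor K A A"
abbreviation "PA \<equiv> prod_proj K H A A"
abbreviation "prod_AA \<equiv> comodule_prod K H A A"
abbreviation "unit_obj \<equiv> unit_comodule K H"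

definition "\<mu> t = tsum K A A A mul t"

lemma \<mu>_linear: "linear_map K AA A \<mu>"
  unfolding \<mu>_def[abs_def] by simp

lemmas linear_\<mu> [simp] = linear_comp[OF \<mu>_linear]
lemmas \<mu>_closed [simp] = linear_map_closed[OF \<mu>_linear]

lemma \<mu>_tens [simp]: "\<lbrakk>a \<in> carrier A; b \<in> carrier A\<rbrakk> \<Longrightarrow> \<mu> (tens K A A a b) = mul a b"
  unfolding \<mu>_def by simp

lemma \<mu>_tsum [simp]:
  "\<lbrakk>module K X; module K Y; bilinear_map K X Y AA \<beta>; t \<in> carrier (tensor K X Y)\<rbrakk>
   \<Longrightarrow> \<mu> (tsum K X Y AA \<beta> t) = tsum K X Y A (\<lambda>x y. \<mu> (\<beta> x y)) t"
  by (rule linear_tsum[OF _ _ _ _ _ \<mu>_linear]) simp_all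

lemma prod_AA_simps [simp]:
  "linear_map K X prod_AA g \<Longrightarrow> linear_map K X AA (\<lambda>x. g x)"
  "linear_map K X AA f \<Longrightarrow> linear_map K X prod_AA (\<lambda>x. PA (f x))"
  "t \<in> carrier AA \<Longrightarrow> PA t \<in> carrier prod_AA"
  "s \<in> carrier prod_AA \<Longrightarrow> s \<in> carrier AA"
  using linear_comp[OF comodule_prod_incl[OF A A], of X g]
    linear_comp[OF prod_proj_retract[OF A A], of X f]
    linear_map_closed[OF prod_proj_retract[OF A A], of t]
    linear_map_closed[OF comodule_prod_incl[OF A A], of s]
  by simp_all

lemma coact_\<mu>:
  assumes "t \<in> carrier AA"
  shows "coact A (\<mu> t) = tsum K AA H (tensor K A H) (\<lambda>s h. tens K A H (\<mu> s) h) (prod_coact K H A A t)"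
proof (rule tensor_ext[OF _ _ _ _ _ _ assms, where P = "tensor K A H"])
  fix a b assume "a \<in> carrier A" "b \<in> carrier A"
  then show "coact A (\<mu> (tens K A A a b)) =
      tsum K AA H (tensor K A H) (\<lambda>s h. tens K A H (\<mu> s) h) (prod_coact K H A A (tens K A A a b))"
    by (simp add: coact_mul tsum_prod_coact)
qed (simp_all add: linear_comp[OF prod_coact_linear])

lemma \<mu>_prod_proj:
  assumes "t \<in> carrier AA"
  shows "\<mu> (PA t) = \<mu> t"
proof -
  note [simp] = assms linear_map_closed[OF prod_coact_linear]
  have "\<mu> (PA t) = tsum K A H A (\<lambda>a h. counit H h \<odot>\<^bsub>A\<^esub> a) (coact A (\<mu> t))"
    by (simp add: prod_proj_counit coact_\<mu> linear_map_smult[OF \<mu>_linear])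
  also have "\<dots> = \<mu> t"
    by (rule coact_counit) simp_all
  finally show ?thesis .
qed

definition "m = restrict \<mu> (carrier prod_AA)"

lemma m_eq: "t \<in> carrier prod_AA \<Longrightarrow> m t = \<mu> t"
  by (simp add: m_def)

lemma m_linear: "linear_map K prod_AA A m"
proof -
  have "linear_map K prod_AA A \<mu>"
    using linear_comp[OF \<mu>_linear comodule_prod_incl[OF A A]] by simp
  then show ?thesis
    by (rule linear_map_cong) (simp_all add: m_eq)
qed

lemma m_colinear: "colinear prod_AA A m"
proof (rule colinearI[OF m_linear])
  fix t assume t: "t \<in> carrier prod_AA"
  have "coact A (m t) = tsum K AA H (tensor K A H) (\<lambda>s h. tens K A H (\<mu> s) h) (prod_coact K H A A t)"
    using t by (simp add: m_eq coact_\<mu>)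
  also have "\<dots> = tsum K prod_AA H (tensor K A H) (\<lambda>s h. tens K A H (\<mu> s) h) (coact prod_AA t)"
    using t by (intro tsum_prod_coact_comodule_prod) simp_all
  also have "\<dots> = tsum K prod_AA H (tensor K A H) (\<lambda>s h. tens K A H (m s) h) (coact prod_AA t)"
    using t by (intro tsum_cong) (simp_all add: m_eq)
  finally show "coact A (m t) = tsum K prod_AA H (tensor K A H) (\<lambda>s h. tens K A H (m s) h) (coact prod_AA t)" .
qed

text \<open>Defined and linear on all of H, with \<open>u\<close> as its restriction: in the sums
  below the argument is often a leg of a coproduct, of which only membership in H is known.\<close>

definition "u' x = tsum K A H A (\<lambda>a h. counit H (x \<otimes>\<^bsub>H\<^esub> h) \<odot>\<^bsub>A\<^esub> a) (coact A e)"

lemma u'_linear: "linear_map K H A u'"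
  unfolding u'_def[abs_def] by simp

lemma u'_closed [simp]: "x \<in> carrier H \<Longrightarrow> u' x \<in> carrier A"
  by (rule linear_map_closed[OF u'_linear])

definition "u = restrict u' (H_s K H)"

lemma unit_obj_simps [simp]:
  "linear_map K X unit_obj f \<Longrightarrow> linear_map K X H (\<lambda>x. f x)"
  "x \<in> carrier unit_obj \<Longrightarrow> x \<in> carrier H"
  using linear_comp[OF unit_comodule_incl, of X f] by (auto simp: carrier_unit_comodule H_s_iff)

lemma u_eq: "x \<in> carrier unit_obj \<Longrightarrow> u x = u' x"
  by (simp add: u_def carrier_unit_comodule)

lemma u_linear: "linear_map K unit_obj A u"
proof -
  have "linear_map K unit_obj A u'"
    using linear_comp[OF u'_linear unit_comodule_incl] by simp
  then show ?thesis
    by (rule linear_map_cong) (simp_all add: u_eq)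
qed

text \<open>The coaction of u(x) is e_0 \<otimes> e_1 \<epsilon>(x e_2), whereas u(x_1) \<otimes>
  x_2 is e_0 \<otimes> \<epsilon>(x_1 e_1) x_2. With the second leg of the coaction of e in
  \<open>H_t\<close>, these agree by \<open>H_s_H_t_counit\<close>.\<close>

lemma u_colinear: "colinear unit_obj A u"
proof (rule colinearI[OF u_linear])
  fix x assume x: "x \<in> carrier unit_obj"
  then have xs: "x \<in> H_s K H" and [simp]: "x \<in> carrier H"
    by (simp_all add: carrier_unit_comodule H_s_iff)
  let ?P = "tensor K A H"
  note [simp] = linear_comp[OF u'_linear] x
  have "coact A (u x) = tsum K A H ?P (\<lambda>a c. tsum K A H ?P
      (\<lambda>a' b. counit H (x \<otimes>\<^bsub>H\<^esub> c) \<odot>\<^bsub>?P\<^esub> tens K A H a' b) (coact A a)) (coact A e)"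
    using x by (simp add: u_eq u'_def linear_map_smult[OF coact_linear] tsum_tens_id
        del: smult_tsum add: smult_tsum[symmetric])
  also have "\<dots> = tsum K A H ?P (\<lambda>a h. tsum K H H ?P
      (\<lambda>b c. counit H (x \<otimes>\<^bsub>H\<^esub> c) \<odot>\<^bsub>?P\<^esub> tens K A H a b) (comult H h)) (coact A e)"
    by (rule coact_coassoc[where \<gamma> = "\<lambda>a b c. counit H (x \<otimes>\<^bsub>H\<^esub> c) \<odot>\<^bsub>?P\<^esub> tens K A H a b"]) simp_all
  also have "\<dots> = tsum K A H ?P (\<lambda>a h. tens K A H a
      (tsum K H H H (\<lambda>b c. counit H (x \<otimes>\<^bsub>H\<^esub> c) \<odot>\<^bsub>H\<^esub> b) (comult H h))) (coact A e)"
    by (simp add: linear_map_smult[OF bilinear_map_linear(2)[OF tens_bilinear]])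
  \<comment> \<open>\<open>coact_e\<close> permits \<open>counit_t\<close> on the second leg of the
    coaction of e, which turns that leg into an element of \<open>H_t\<close>. It is removed again
    after the exchange.\<close>
  also have "\<dots> = tsum K A H ?P (\<lambda>a h. tens K A H a
      (tsum K H H H (\<lambda>b c. counit H (x \<otimes>\<^bsub>H\<^esub> c) \<odot>\<^bsub>H\<^esub> b) (comult H (counit_t K H h)))) (coact A e)"
    by (rule tsum_coact_e[symmetric]) simp_all
  also have "\<dots> = tsum K A H ?P (\<lambda>a h. tens K A H a
      (tsum K H H H (\<lambda>b c. counit H (b \<otimes>\<^bsub>H\<^esub> counit_t K H h) \<odot>\<^bsub>H\<^esub> c) (comult H x))) (coact A e)"
    by (intro tsum_cong refl arg_cong[where f = "tens K A H _"] H_s_H_t_counit[OF xs])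
      (simp_all add: H_t_iff)
  also have "\<dots> = tsum K A H ?P (\<lambda>a h. tens K A H a
      (tsum K H H H (\<lambda>b c. counit H (b \<otimes>\<^bsub>H\<^esub> h) \<odot>\<^bsub>H\<^esub> c) (comult H x))) (coact A e)"
    by (rule tsum_coact_e) simp_all
  also have "\<dots> = tsum K A H ?P (\<lambda>a h. tsum K H H ?P
      (\<lambda>b c. counit H (b \<otimes>\<^bsub>H\<^esub> h) \<odot>\<^bsub>?P\<^esub> tens K A H a c) (comult H x)) (coact A e)"
    by (simp add: linear_map_smult[OF bilinear_map_linear(2)[OF tens_bilinear]])
  also have "\<dots> = tsum K H H ?P (\<lambda>b c. tsum K A H ?P
      (\<lambda>a h. counit H (b \<otimes>\<^bsub>H\<^esub> h) \<odot>\<^bsub>?P\<^esub> tens K A H a c) (coact A e)) (comult H x)"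
    by (rule tsum_swap) simp_all
  also have "\<dots> = tsum K H H ?P (\<lambda>b c. tens K A H (u' b) c) (comult H x)"
    by (simp add: u'_def linear_map_smult[OF bilinear_map_linear(1)[OF tens_bilinear]])
  also have "\<dots> = tsum K unit_obj H ?P (\<lambda>b c. tens K A H (u' b) c) (coact unit_obj x)"
    by (rule tsum_comult_unit_comodule) simp_all
  also have "\<dots> = tsum K unit_obj H ?P (\<lambda>b c. tens K A H (u b) c) (coact unit_obj x)"
    by (intro tsum_cong) (simp_all add: u_eq)
  finally show "coact A (u x) = tsum K unit_obj H ?P (\<lambda>b c. tens K A H (u b) c) (coact unit_obj x)" .
qed

lemma mul_eq_counit:
  assumes "a \<in> carrier A" "b \<in> carrier A"
  shows "mul a b = tsum K A H A (\<lambda>a\<^sub>0 a\<^sub>1. tsum K A H A (\<lambda>b\<^sub>0 b\<^sub>1.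
    counit H (a\<^sub>1 \<otimes>\<^bsub>H\<^esub> b\<^sub>1) \<odot>\<^bsub>A\<^esub> mul a\<^sub>0 b\<^sub>0) (coact A b)) (coact A a)"
  using \<mu>_prod_proj[of "tens K A A a b"] assms
  by (simp add: prod_proj_tens linear_map_smult[OF \<mu>_linear])

text \<open>For a = e a, the axiom in the form \<epsilon>(x e_1 a_1) = \<epsilon>(x e_2)
  \<epsilon>(e_1 a_1) leaves e_1 next to e_0. Coassociativity then lets \<epsilon>(x e_2) assemble
  u'(x), and the remaining factor is the one in \<open>mul_eq_counit\<close> for the product of
  u'(x) and a.\<close>

lemma mul_u'_l:
  assumes [simp]: "x \<in> carrier H" "a \<in> carrier A"
  shows "mul (u' x) a = tsum K A H A (\<lambda>a\<^sub>0 a\<^sub>1. counit H (x \<otimes>\<^bsub>H\<^esub> a\<^sub>1) \<odot>\<^bsub>A\<^esub> a\<^sub>0) (coact A a)"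
proof -
  let ?g = "\<lambda>a' h\<^sub>1 h\<^sub>2 a\<^sub>0 a\<^sub>1. counit H (x \<otimes>\<^bsub>H\<^esub> h\<^sub>2) \<odot>\<^bsub>A\<^esub> (counit H (h\<^sub>1 \<otimes>\<^bsub>H\<^esub> a\<^sub>1) \<odot>\<^bsub>A\<^esub> mul a' a\<^sub>0)"
  interpret A: module K A by simp
  have "tsum K A H A (\<lambda>a\<^sub>0 a\<^sub>1. counit H (x \<otimes>\<^bsub>H\<^esub> a\<^sub>1) \<odot>\<^bsub>A\<^esub> a\<^sub>0) (coact A a) =
      tsum K A H A (\<lambda>a\<^sub>0 a\<^sub>1. counit H (x \<otimes>\<^bsub>H\<^esub> a\<^sub>1) \<odot>\<^bsub>A\<^esub> a\<^sub>0) (coact A (mul e a))"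
    by (simp add: mul_one)
  also have "\<dots> = tsum K A H A (\<lambda>e\<^sub>0 e\<^sub>1. tsum K A H A (\<lambda>a\<^sub>0 a\<^sub>1. counit H ((x \<otimes>\<^bsub>H\<^esub> e\<^sub>1) \<otimes>\<^bsub>H\<^esub> a\<^sub>1) \<odot>\<^bsub>A\<^esub> mul e\<^sub>0 a\<^sub>0)
      (coact A a)) (coact A e)"
    by (simp add: tsum_coact_mul H.m_assoc)
  also have "\<dots> = tsum K A H A (\<lambda>e\<^sub>0 e\<^sub>1. tsum K A H A (\<lambda>a\<^sub>0 a\<^sub>1. tsum K H H A (\<lambda>h\<^sub>1 h\<^sub>2.
      ?g e\<^sub>0 h\<^sub>1 h\<^sub>2 a\<^sub>0 a\<^sub>1) (comult H e\<^sub>1)) (coact A a)) (coact A e)"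
    by (simp add: counit_mult(2) A.smult_assoc1)
  also have "\<dots> = tsum K A H A (\<lambda>e\<^sub>0 e\<^sub>1. tsum K H H A (\<lambda>h\<^sub>1 h\<^sub>2. tsum K A H A (\<lambda>a\<^sub>0 a\<^sub>1.
      ?g e\<^sub>0 h\<^sub>1 h\<^sub>2 a\<^sub>0 a\<^sub>1) (coact A a)) (comult H e\<^sub>1)) (coact A e)"
    by (intro tsum_cong refl tsum_swap) simp_all
  also have "\<dots> = tsum K A H A (\<lambda>e\<^sub>0 h\<^sub>2. tsum K A H A (\<lambda>e' h\<^sub>1. tsum K A H A (\<lambda>a\<^sub>0 a\<^sub>1.
      ?g e' h\<^sub>1 h\<^sub>2 a\<^sub>0 a\<^sub>1) (coact A a)) (coact A e\<^sub>0)) (coact A e)"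
    by (rule coact_coassoc[symmetric, where \<gamma> = "\<lambda>e' h\<^sub>1 h\<^sub>2. tsum K A H A (\<lambda>a\<^sub>0 a\<^sub>1.
      ?g e' h\<^sub>1 h\<^sub>2 a\<^sub>0 a\<^sub>1) (coact A a)"]) simp_all
  also have "\<dots> = mul (u' x) a"
    by (simp add: mul_eq_counit[of "u' x"]) (simp add: u'_def linear_map_smult[OF coact_linear])
  finally show ?thesis by simp
qed

text \<open>For a = a e the other form, \<epsilon>(a_1 e_1 x) = \<epsilon>(a_1 e_1) \<epsilon>(e_2
  x), assembles e_0 \<epsilon>(e_1 x) instead of u'(x). The two agree because e_1 may be taken in
  \<open>H_t\<close>, which commutes with x; this is where x must lie in \<open>H_s\<close>.\<close>

lemma mul_u'_r:
  assumes [simp]: "a \<in> carrier A" and x: "x \<in> H_s K H"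
  shows "mul a (u' x) = tsum K A H A (\<lambda>a\<^sub>0 a\<^sub>1. counit H (a\<^sub>1 \<otimes>\<^bsub>H\<^esub> x) \<odot>\<^bsub>A\<^esub> a\<^sub>0) (coact A a)"
proof -
  let ?g = "\<lambda>e' h\<^sub>1 h\<^sub>2 a\<^sub>0 a\<^sub>1. counit H (a\<^sub>1 \<otimes>\<^bsub>H\<^esub> h\<^sub>1) \<odot>\<^bsub>A\<^esub> (counit H (h\<^sub>2 \<otimes>\<^bsub>H\<^esub> x) \<odot>\<^bsub>A\<^esub> mul a\<^sub>0 e')"
  interpret A: module K A by simp
  have [simp]: "x \<in> carrier H"
    using x by (simp add: H_s_iff)
  have u': "u' x = tsum K A H A (\<lambda>a h. counit H (h \<otimes>\<^bsub>H\<^esub> x) \<odot>\<^bsub>A\<^esub> a) (coact A e)"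
  proof -
    have "u' x = tsum K A H A (\<lambda>a h. counit H (x \<otimes>\<^bsub>H\<^esub> counit_t K H h) \<odot>\<^bsub>A\<^esub> a) (coact A e)"
      unfolding u'_def by (rule tsum_coact_e[symmetric]) simp_all
    also have "\<dots> = tsum K A H A (\<lambda>a h. counit H (counit_t K H h \<otimes>\<^bsub>H\<^esub> x) \<odot>\<^bsub>A\<^esub> a) (coact A e)"
      by (intro tsum_cong refl) (simp_all add: H_s_H_t_commute[OF x] H_t_iff)
    also have "\<dots> = tsum K A H A (\<lambda>a h. counit H (h \<otimes>\<^bsub>H\<^esub> x) \<odot>\<^bsub>A\<^esub> a) (coact A e)"
      by (rule tsum_coact_e) simp_all
    finally show ?thesis .
  qed
  have "tsum K A H A (\<lambda>a\<^sub>0 a\<^sub>1. counit H (a\<^sub>1 \<otimes>\<^bsub>H\<^esub> x) \<odot>\<^bsub>A\<^esub> a\<^sub>0) (coact A a) =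
      tsum K A H A (\<lambda>a\<^sub>0 a\<^sub>1. counit H (a\<^sub>1 \<otimes>\<^bsub>H\<^esub> x) \<odot>\<^bsub>A\<^esub> a\<^sub>0) (coact A (mul a e))"
    by (simp add: mul_one)
  also have "\<dots> = tsum K A H A (\<lambda>a\<^sub>0 a\<^sub>1. tsum K A H A (\<lambda>e\<^sub>0 e\<^sub>1. tsum K H H A (\<lambda>h\<^sub>1 h\<^sub>2.
      ?g e\<^sub>0 h\<^sub>1 h\<^sub>2 a\<^sub>0 a\<^sub>1) (comult H e\<^sub>1)) (coact A e)) (coact A a)"
    by (simp add: tsum_coact_mul counit_mult(1) A.smult_assoc1)
  also have "\<dots> = tsum K A H A (\<lambda>a\<^sub>0 a\<^sub>1. tsum K A H A (\<lambda>e\<^sub>0 h\<^sub>2. tsum K A H A (\<lambda>e' h\<^sub>1.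
      ?g e' h\<^sub>1 h\<^sub>2 a\<^sub>0 a\<^sub>1) (coact A e\<^sub>0)) (coact A e)) (coact A a)"
    by (intro tsum_cong refl coact_coassoc[symmetric, where \<gamma> = "\<lambda>e' h\<^sub>1 h\<^sub>2. ?g e' h\<^sub>1 h\<^sub>2 _ _"]) simp_all
  also have "\<dots> = mul a (u' x)"
    by (simp add: mul_eq_counit[of _ "u' x"])
      (simp add: u' linear_map_smult[OF coact_linear] smult_left_commute[of K A "counit H (_ \<otimes>\<^bsub>H\<^esub> x)"])
  finally show ?thesis by simp
qed

end

section \<open>Restricted functions and the unit constraints\<close>

context weak_bialg
begin

lemma colinear_restrict_id:
  assumes "right_comodule K H M"
  shows "colinear M M (\<lambda>x\<in>carrier M. x)"
proof (rule colinearI)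
  note [simp] = assms
  show "linear_map K M M (\<lambda>x\<in>carrier M. x)"
    by (rule linear_map_cong[OF linear_id]) simp_all
  fix x assume [simp]: "x \<in> carrier M"
  have "tsum K M H (tensor K M H) (\<lambda>a h. tens K M H ((\<lambda>x\<in>carrier M. x) a) h) (coact M x) =
      tsum K M H (tensor K M H) (\<lambda>a h. tens K M H a h) (coact M x)"
    by (intro tsum_cong) simp_all
  then show "coact M ((\<lambda>x\<in>carrier M. x) x) =
      tsum K M H (tensor K M H) (\<lambda>a h. tens K M H ((\<lambda>x\<in>carrier M. x) a) h) (coact M x)"
    by (simp add: tsum_tens_id)
qed

lemma left_unitor_eq: "x \<in> carrier (comodule_prod K H (unit_comodule K H) M) \<Longrightarrow>
  left_unitor K H M x = tsum K (unit_comodule K H) M M (\<lambda>x m. tsum K M H M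
    (\<lambda>m\<^sub>0 m\<^sub>1. counit H (x \<otimes>\<^bsub>H\<^esub> m\<^sub>1) \<odot>\<^bsub>M\<^esub> m\<^sub>0) (coact M m)) x"
  by (simp add: left_unitor_def tsum_def)

lemma right_unitor_eq: "x \<in> carrier (comodule_prod K H M (unit_comodule K H)) \<Longrightarrow>
  right_unitor K H M x = tsum K M (unit_comodule K H) M (\<lambda>m x. tsum K M H M
    (\<lambda>m\<^sub>0 m\<^sub>1. counit H (m\<^sub>1 \<otimes>\<^bsub>H\<^esub> x) \<odot>\<^bsub>M\<^esub> m\<^sub>0) (coact M m)) x"
  by (simp add: right_unitor_def tsum_def)

lemma prod_map_eq:
  "x \<in> carrier (comodule_prod K H M N) \<Longrightarrow> prod_map K H M N M' N' f g x = tensor_map K M' N' f g x"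
  by (simp add: prod_map_def)

text \<open>The structure morphisms are restricted functions. Here they are exchanged for total ones
  that agree on the carriers and to which the linearity rules apply.\<close>

lemma tensor_map_cong_tsum:
  assumes "module K M" "module K N" "x \<in> carrier (tensor K M N)"
    and "\<And>m. m \<in> carrier M \<Longrightarrow> f m = f' m" "\<And>n. n \<in> carrier N \<Longrightarrow> g n = g' n"
  shows "tensor_map K M' N' f g x = tsum K M N (tensor K M' N') (\<lambda>m n. tens K M' N' (f' m) (g' n)) x"
  unfolding tensor_map_eq_tsum[where M = M and N = N] using assms by (intro tsum_cong) simp_all

end

section \<open>The algebra laws for the restricted product\<close>

context comod_alg
begin

abbreviation "i \<equiv> \<lambda>x\<in>carrier A. x"

lemma i_colinear: "colinear A A i"
  by (rule colinear_restrict_id) simp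

lemma m_unit_l:
  assumes x: "x \<in> carrier (comodule_prod K H unit_obj A)"
  shows "m (prod_map K H unit_obj A A A u i x) = left_unitor K H A x"
proof -
  have [simp]: "x \<in> carrier (tensor K unit_obj A)"
    using x by (simp add: carrier_comodule_prod)
  note [simp] = linear_comp[OF u'_linear]
  have "m (prod_map K H unit_obj A A A u i x) = \<mu> (tensor_map K A A u i x)"
    using tensor_map_comodule_prod[OF _ _ _ _ u_colinear i_colinear x] x
    by (simp add: prod_map_eq m_eq)
  also have "tensor_map K A A u i x = tsum K unit_obj A AA (\<lambda>x a. tens K A A (u' x) a) x"
    by (rule tensor_map_cong_tsum) (simp_all add: u_eq)
  also have "\<mu> \<dots> = tsum K unit_obj A A (\<lambda>x a. mul (u' x) a) x"
    by simp
  also have "\<dots> = left_unitor K H A x"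
    unfolding left_unitor_eq[OF x] by (intro tsum_cong) (simp_all add: mul_u'_l)
  finally show ?thesis .
qed

lemma m_unit_r:
  assumes x: "x \<in> carrier (comodule_prod K H A unit_obj)"
  shows "m (prod_map K H A unit_obj A A i u x) = right_unitor K H A x"
proof -
  have [simp]: "x \<in> carrier (tensor K A unit_obj)"
    using x by (simp add: carrier_comodule_prod)
  note [simp] = linear_comp[OF u'_linear]
  have "m (prod_map K H A unit_obj A A i u x) = \<mu> (tensor_map K A A i u x)"
    using tensor_map_comodule_prod[OF _ _ _ _ i_colinear u_colinear x] x
    by (simp add: prod_map_eq m_eq)
  also have "tensor_map K A A i u x = tsum K A unit_obj AA (\<lambda>a x. tens K A A a (u' x)) x"
    by (rule tensor_map_cong_tsum) (simp_all add: u_eq)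
  also have "\<mu> \<dots> = tsum K A unit_obj A (\<lambda>a x. mul a (u' x)) x"
    by simp
  also have "\<dots> = right_unitor K H A x"
    unfolding right_unitor_eq[OF x]
    by (intro tsum_cong) (simp_all add: mul_u'_r carrier_unit_comodule)
  finally show ?thesis .
qed

text \<open>Both composites factor through a \<otimes> s \<mapsto> a \<mu>(s) on A \<otimes> (A
  \<otimes> A), the left one by associativity of \<open>mul\<close>, the right one because \<mu> is
  defined on all of A \<otimes> A. In that space \<open>prod_assoc\<close> is the associator of
  vector spaces.\<close>

lemma m_assoc:
  assumes x: "x \<in> carrier (comodule_prod K H prod_AA A)"
  shows "m (prod_map K H prod_AA A A A m i x) =
    m (prod_map K H A prod_AA A A i m (prod_assoc K H A A A x))"
proof -
  define y where "y = prod_assoc K H A A A x"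
  let ?incl_l = "tensor_map K AA A (\<lambda>x. x) (\<lambda>x. x)"
  let ?incl_r = "tensor_map K A AA (\<lambda>x. x) (\<lambda>x. x)"
  have y: "y \<in> carrier (comodule_prod K H A prod_AA)"
    and incl_y: "?incl_r y = tensor_assoc K A A A (?incl_l x)"
    unfolding y_def using prod_assoc_props[OF A A A x] by simp_all
  have [simp]: "x \<in> carrier (tensor K prod_AA A)" "y \<in> carrier (tensor K A prod_AA)"
    using x y by (simp_all add: carrier_comodule_prod)
  have incl_l: "?incl_l x = tsum K prod_AA A (tensor K AA A) (\<lambda>s c. tens K AA A s c) x"
    and incl_r: "?incl_r y = tsum K A prod_AA (tensor K A AA) (\<lambda>a s. tens K A AA a s) y"
    by (simp_all add: tensor_map_eq_tsum[where M = prod_AA and N = A]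
        tensor_map_eq_tsum[where M = A and N = prod_AA])
  have "m (prod_map K H prod_AA A A A m i x) = \<mu> (tensor_map K A A m i x)"
    using tensor_map_comodule_prod[OF _ _ _ _ m_colinear i_colinear x] x
    by (simp add: prod_map_eq m_eq)
  also have "tensor_map K A A m i x = tsum K prod_AA A AA (\<lambda>s a. tens K A A (\<mu> s) a) x"
    by (rule tensor_map_cong_tsum) (simp_all add: m_eq)
  also have "\<mu> \<dots> = tsum K prod_AA A A (\<lambda>s c. mul (\<mu> s) c) x"
    by simp
  also have "\<dots> = tsum K A AA A (\<lambda>a s. mul a (\<mu> s)) (tensor_assoc K A A A (?incl_l x))"
  proof -
    have "tsum K A AA A (\<lambda>a s. mul a (\<mu> s)) (tensor_assoc K A A A (?incl_l x)) =
        tsum K prod_AA A A (\<lambda>s c. tsum K A A A (\<lambda>a b. mul a (mul b c)) s) x"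
      unfolding incl_l tensor_assoc_eq_tsum by simp
    also have "\<dots> = tsum K prod_AA A A (\<lambda>s c. tsum K A A A (\<lambda>a b. mul (mul a b) c) s) x"
      by (intro tsum_cong refl) (simp_all add: mul_assoc)
    also have "\<dots> = tsum K prod_AA A A (\<lambda>s c. mul (\<mu> s) c) x"
      by (intro tsum_cong refl) (simp_all add: \<mu>_def mul_tsum)
    finally show ?thesis by simp
  qed
  also have "\<dots> = tsum K A AA A (\<lambda>a s. mul a (\<mu> s)) (?incl_r y)"
    by (simp only: incl_y)
  also have "\<dots> = \<mu> (tsum K A prod_AA AA (\<lambda>a s. tens K A A a (\<mu> s)) y)"
    unfolding incl_r by simp
  also have "tsum K A prod_AA AA (\<lambda>a s. tens K A A a (\<mu> s)) y = tensor_map K A A i m y"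
    by (rule tensor_map_cong_tsum[symmetric]) (simp_all add: m_eq)
  also have "\<mu> \<dots> = m (prod_map K H A prod_AA A A i m y)"
    using tensor_map_comodule_prod[OF _ _ _ _ i_colinear m_colinear y] y
    by (simp add: prod_map_eq m_eq)
  finally show ?thesis
    by (simp only: y_def)
qed

lemma algebra_in_comodules:
  "A \<in> comodules K H \<Longrightarrow> algebra_in_comodules K H A m u"
  unfolding algebra_in_comodules_def Let_def comodule_hom_iff
  using m_colinear u_colinear m_assoc m_unit_l m_unit_r
  by (simp add: m_def u_def carrier_unit_comodule)

end

lemma tensor_map_tens:
  assumes "module K M" "module K N" "module K M'" "module K N'" "linear_map K M M' f" "linear_map K N N' g"
    and "m \<in> carrier M" "n \<in> carrier N"
  shows "tensor_map K M' N' f g (tens K M N m n) = tens K M' N' (f m) (g n)"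
  unfolding tensor_map_eq_tsum[where M = M and N = N]
proof (rule tsum_tens)
  show "bilinear_map K M N (tensor K M' N') (\<lambda>m n. tens K M' N' (f m) (g n))"
    using assms linear_map_closed[OF assms(5)] linear_map_closed[OF assms(6)] by (intro bilinear_mapI) simp_all
qed (use assms in simp_all)

section \<open>From algebras in the category of comodules to comodule algebras\<close>

locale alg_comod = weak_bialg K H
  for K :: "('k, 'z) ring_scheme" and H :: "('k, 'h, 'w) bialgebra_scheme" +
  fixes A :: "('k, 'a, 'h) comodule" and m :: "('a \<times> 'a \<Rightarrow> 'k) set \<Rightarrow> 'a" and u :: "'h \<Rightarrow> 'a"
  assumes alg: "algebra_in_comodules K H A m u"
begin

abbreviation "AA \<equiv> tensor K A A"
abbreviation "PA \<equiv> prod_proj K H A A"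
abbreviation "prod_AA \<equiv> comodule_prod K H A A"
abbreviation "unit_obj \<equiv> unit_comodule K H"
abbreviation "i \<equiv> \<lambda>x\<in>carrier A. x"

lemma A [simp]: "right_comodule K H A"
  and m_colinear: "colinear prod_AA A m"
  and u_colinear: "colinear unit_obj A u"
  and m_ext: "m \<in> extensional (carrier prod_AA)"
  and u_ext: "u \<in> extensional (carrier unit_obj)"
  and alg_assoc: "x \<in> carrier (comodule_prod K H prod_AA A) \<Longrightarrow>
    m (prod_map K H prod_AA A A A m i x) = m (prod_map K H A prod_AA A A i m (prod_assoc K H A A A x))"
  and alg_unit_l: "z \<in> carrier (comodule_prod K H unit_obj A) \<Longrightarrow>
    m (prod_map K H unit_obj A A A u i z) = left_unitor K H A z"
  and alg_unit_r: "y \<in> carrier (comodule_prod K H A unit_obj) \<Longrightarrow>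
    m (prod_map K H A unit_obj A A i u y) = right_unitor K H A y"
  using alg unfolding algebra_in_comodules_def Let_def comodule_hom_iff comodules_def by blast+

lemma i_colinear: "colinear A A i"
  by (rule colinear_restrict_id) simp

lemmas lin_maps [simp] =
  linear_comp[OF colinear_linear[OF m_colinear]] linear_map_closed[OF colinear_linear[OF m_colinear]]
  linear_comp[OF colinear_linear[OF u_colinear]] linear_map_closed[OF colinear_linear[OF u_colinear]]
  linear_map_closed[OF prod_proj_retract[OF A A]] linear_comp[OF prod_proj_retract[OF A A]]
  linear_comp[OF comodule_prod_incl[OF A A]] linear_map_closed[OF comodule_prod_incl[OF A A]]
  linear_comp[OF unit_comodule_incl] linear_map_closed[OF unit_comodule_incl]

definition "\<mu> t = m (PA t)"

lemma \<mu>_linear: "linear_map K AA A \<mu>"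
  unfolding \<mu>_def[abs_def] by simp

lemmas \<mu>_simps [simp] = linear_comp[OF \<mu>_linear] linear_map_closed[OF \<mu>_linear]

lemma m_eq: "s \<in> carrier prod_AA \<Longrightarrow> m s = \<mu> s"
  by (simp add: \<mu>_def carrier_comodule_prod)

definition "mul a b = \<mu> (tens K A A a b)"

lemma mul_bilinear: "bilinear_map K A A A mul"
  by (rule bilinear_mapI) (simp_all add: mul_def)

lemma mul_closed [simp]: "\<lbrakk>a \<in> carrier A; b \<in> carrier A\<rbrakk> \<Longrightarrow> mul a b \<in> carrier A"
  by (rule bilinear_map_closed[OF mul_bilinear])

lemma one_unit_obj [simp]: "\<one>\<^bsub>H\<^esub> \<in> carrier unit_obj"
  by (simp add: carrier_unit_comodule one_H_s)

text \<open>Colinearity of m describes the coaction of m(P t) by the product coaction of P t, which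
  is the same as that of t.\<close>

lemma coact_\<mu>:
  assumes [simp]: "t \<in> carrier AA"
  shows "coact A (\<mu> t) = tsum K AA H (tensor K A H) (\<lambda>s h. tens K A H (\<mu> s) h) (prod_coact K H A A t)"
proof -
  have "coact A (\<mu> t) = tsum K prod_AA H (tensor K A H) (\<lambda>s h. tens K A H (m s) h) (coact prod_AA (PA t))"
    unfolding \<mu>_def by (rule colinear_coact[OF m_colinear]) simp
  also have "\<dots> = tsum K prod_AA H (tensor K A H) (\<lambda>s h. tens K A H (\<mu> s) h) (coact prod_AA (PA t))"
    by (intro tsum_cong refl) (simp_all add: m_eq)
  also have "\<dots> = tsum K AA H (tensor K A H) (\<lambda>s h. tens K A H (\<mu> s) h) (prod_coact K H A A (PA t))"
    by (rule tsum_prod_coact_comodule_prod[symmetric]) simp_all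
  finally show ?thesis
    by (simp only: prod_coact_proj[OF A A assms])
qed

lemma coact_mul:
  "\<lbrakk>a \<in> carrier A; b \<in> carrier A\<rbrakk> \<Longrightarrow> coact A (mul a b) =
      tsum K A H (tensor K A H) (\<lambda>a\<^sub>0 a\<^sub>1. tsum K A H (tensor K A H)
        (\<lambda>b\<^sub>0 b\<^sub>1. tens K A H (mul a\<^sub>0 b\<^sub>0) (a\<^sub>1 \<otimes>\<^bsub>H\<^esub> b\<^sub>1)) (coact A b)) (coact A a)"
  by (simp add: mul_def coact_\<mu> tsum_prod_coact)

text \<open>Colinearity of u yields u(1_1) \<otimes> 1_2, and \<open>counit_t\<close> fixes the
  second leg of \<Delta>(1).\<close>

lemma coact_one:
  "tsum K A H (tensor K A H) (\<lambda>a h. tens K A H a (counit_t K H h)) (coact A (u \<one>\<^bsub>H\<^esub>)) = coact A (u \<one>\<^bsub>H\<^esub>)"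
proof -
  note [simp] = linear_map_closed[OF unit_comodule_retract] linear_comp[OF unit_comodule_retract]
  \<comment> \<open>The coaction of the unit object is \<Delta> followed by the retraction
    \<open>counit_s\<close> on the first leg, whence its appearance in the argument of u.\<close>
  have c: "tsum K A H P \<beta> (coact A (u \<one>\<^bsub>H\<^esub>)) =
      tsum K H H P (\<lambda>x h. \<beta> (u (counit_s K H x)) h) \<Delta>\<^sub>1"
    if "module K P" "bilinear_map K A H P \<beta>" for P :: "('k, 'p) module" and \<beta>
  proof -
    note [simp] = that bilinear_map_linear[OF that(2)] bilinear_map_linear[OF that(2), THEN linear_comp]
    have "tsum K A H P \<beta> (coact A (u \<one>\<^bsub>H\<^esub>)) = tsum K unit_obj H P (\<lambda>x h. \<beta> (u x) h) (coact unit_obj \<one>\<^bsub>H\<^esub>)"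
      by (rule tsum_colinear[OF _ _ u_colinear]) simp_all
    also have "\<dots> = tsum K H H P (\<lambda>x h. \<beta> (u (counit_s K H x)) h) \<Delta>\<^sub>1"
      by (rule tsum_coact_unit_comodule) simp_all
    finally show ?thesis .
  qed
  have "tsum K A H (tensor K A H) (\<lambda>a h. tens K A H a (counit_t K H h)) (coact A (u \<one>\<^bsub>H\<^esub>)) =
      tsum K H H (tensor K A H) (\<lambda>x h. tens K A H (u (counit_s K H x)) (counit_t K H h)) \<Delta>\<^sub>1"
    by (rule c) simp_all
  also have "\<dots> = tsum K H H (tensor K A H) (\<lambda>x h. tens K A H (u (counit_s K H x)) h) \<Delta>\<^sub>1"
    by (rule counit_t_comult_one) simp_all
  also have "\<dots> = tsum K A H (tensor K A H) (\<lambda>a h. tens K A H a h) (coact A (u \<one>\<^bsub>H\<^esub>))"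
    by (rule c[symmetric]) simp_all
  finally show ?thesis
    by (simp add: tsum_tens_id)
qed

text \<open>The unit law speaks about elements of the monoidal product, hence is applied to P(x
  \<otimes> a); naturality moves P past u \<otimes> id. The unitor then gives \<epsilon>(x_1 a_1)
  \<epsilon>(x_2 a_2) a_0, which multiplicativity of \<Delta> and counitality contract to
  \<epsilon>(x a_1) a_0.\<close>

lemma mul_u_l:
  assumes [simp]: "x \<in> carrier unit_obj" "a \<in> carrier A"
  shows "mul (u x) a = tsum K A H A (\<lambda>a\<^sub>0 a\<^sub>1. counit H (x \<otimes>\<^bsub>H\<^esub> a\<^sub>1) \<odot>\<^bsub>A\<^esub> a\<^sub>0) (coact A a)"
proof -
  let ?y = "prod_proj K H unit_obj A (tens K unit_obj A x a)"
  have y: "?y \<in> carrier (comodule_prod K H unit_obj A)"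
    by (rule linear_map_closed[OF prod_proj_retract]) simp_all
  have "left_unitor K H A ?y = m (tensor_map K A A u i ?y)"
    using alg_unit_l[OF y] y by (simp add: prod_map_eq)
  also have "tensor_map K A A u i ?y = PA (tensor_map K A A u i (tens K unit_obj A x a))"
    by (rule prod_proj_natural[symmetric, OF _ _ _ _ u_colinear i_colinear]) simp_all
  also have "tensor_map K A A u i (tens K unit_obj A x a) = tens K A A (u x) a"
    by (subst tensor_map_cong_tsum[where f' = u and g' = "\<lambda>x. x" and M = unit_obj and N = A]) simp_all
  finally have 1: "mul (u x) a = left_unitor K H A ?y"
    by (simp add: mul_def \<mu>_def)
  let ?L = "\<lambda>x a. tsum K A H A (\<lambda>a\<^sub>0 a\<^sub>1. counit H (x \<otimes>\<^bsub>H\<^esub> a\<^sub>1) \<odot>\<^bsub>A\<^esub> a\<^sub>0) (coact A a)"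
  let ?g = "\<lambda>x\<^sub>0 x\<^sub>1 a h\<^sub>1 h\<^sub>2. counit H (x\<^sub>1 \<otimes>\<^bsub>H\<^esub> h\<^sub>2) \<odot>\<^bsub>A\<^esub> (counit H (x\<^sub>0 \<otimes>\<^bsub>H\<^esub> h\<^sub>1) \<odot>\<^bsub>A\<^esub> a)"
  note 1
  also have "left_unitor K H A ?y = tsum K unit_obj A A ?L ?y"
    by (rule left_unitor_eq[OF y])
  also have "\<dots> = tsum K unit_obj H A (\<lambda>x\<^sub>0 x\<^sub>1. tsum K A H A (\<lambda>a\<^sub>0 h\<^sub>2. tsum K A H A
      (\<lambda>a h\<^sub>1. ?g x\<^sub>0 x\<^sub>1 a h\<^sub>1 h\<^sub>2) (coact A a\<^sub>0)) (coact A a)) (coact unit_obj x)"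
    by (simp add: prod_proj_tens)
  also have "\<dots> = tsum K H H A (\<lambda>x\<^sub>0 x\<^sub>1. tsum K A H A (\<lambda>a\<^sub>0 h\<^sub>2. tsum K A H A
      (\<lambda>a h\<^sub>1. ?g x\<^sub>0 x\<^sub>1 a h\<^sub>1 h\<^sub>2) (coact A a\<^sub>0)) (coact A a)) (comult H x)"
    by (rule tsum_comult_unit_comodule[symmetric]) simp_all
  also have "\<dots> = tsum K H H A (\<lambda>x\<^sub>0 x\<^sub>1. tsum K A H A (\<lambda>a h. tsum K H H A
      (\<lambda>h\<^sub>1 h\<^sub>2. ?g x\<^sub>0 x\<^sub>1 a h\<^sub>1 h\<^sub>2) (comult H h)) (coact A a)) (comult H x)"
    by (intro tsum_cong refl coact_coassoc[where \<gamma> = "\<lambda>a h\<^sub>1 h\<^sub>2. ?g _ _ a h\<^sub>1 h\<^sub>2"]) simp_all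
  also have "\<dots> = tsum K A H A (\<lambda>a h. tsum K H H A (\<lambda>x\<^sub>0 x\<^sub>1. tsum K H H A
      (\<lambda>h\<^sub>1 h\<^sub>2. ?g x\<^sub>0 x\<^sub>1 a h\<^sub>1 h\<^sub>2) (comult H h)) (comult H x)) (coact A a)"
    by (rule tsum_swap) simp_all
  also have "\<dots> = tsum K A H A (\<lambda>a h. tsum K H H A (\<lambda>k\<^sub>1 k\<^sub>2. counit H k\<^sub>2 \<odot>\<^bsub>A\<^esub> (counit H k\<^sub>1 \<odot>\<^bsub>A\<^esub> a))
      (comult H (x \<otimes>\<^bsub>H\<^esub> h))) (coact A a)"
    by (intro tsum_cong refl comult_mult[symmetric]) simp_all
  also have "\<dots> = ?L x a"
    by (simp add: comult_counit_r[where f = "\<lambda>k. counit H k \<odot>\<^bsub>A\<^esub> _"])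
  finally show ?thesis .
qed

lemma mul_u_r:
  assumes [simp]: "x \<in> carrier unit_obj" "a \<in> carrier A"
  shows "mul a (u x) = tsum K A H A (\<lambda>a\<^sub>0 a\<^sub>1. counit H (a\<^sub>1 \<otimes>\<^bsub>H\<^esub> x) \<odot>\<^bsub>A\<^esub> a\<^sub>0) (coact A a)"
proof -
  let ?y = "prod_proj K H A unit_obj (tens K A unit_obj a x)"
  have y: "?y \<in> carrier (comodule_prod K H A unit_obj)"
    by (rule linear_map_closed[OF prod_proj_retract]) simp_all
  have "right_unitor K H A ?y = m (tensor_map K A A i u ?y)"
    using alg_unit_r[OF y] y by (simp add: prod_map_eq)
  also have "tensor_map K A A i u ?y = PA (tensor_map K A A i u (tens K A unit_obj a x))"
    by (rule prod_proj_natural[symmetric, OF _ _ _ _ i_colinear u_colinear]) simp_all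
  also have "tensor_map K A A i u (tens K A unit_obj a x) = tens K A A a (u x)"
    by (subst tensor_map_cong_tsum[where g' = u and f' = "\<lambda>x. x" and N = unit_obj and M = A]) simp_all
  finally have 1: "mul a (u x) = right_unitor K H A ?y"
    by (simp add: mul_def \<mu>_def)
  let ?L = "\<lambda>a x. tsum K A H A (\<lambda>a\<^sub>0 a\<^sub>1. counit H (a\<^sub>1 \<otimes>\<^bsub>H\<^esub> x) \<odot>\<^bsub>A\<^esub> a\<^sub>0) (coact A a)"
  let ?g = "\<lambda>x\<^sub>0 x\<^sub>1 a h\<^sub>1 h\<^sub>2. counit H (h\<^sub>2 \<otimes>\<^bsub>H\<^esub> x\<^sub>1) \<odot>\<^bsub>A\<^esub> (counit H (h\<^sub>1 \<otimes>\<^bsub>H\<^esub> x\<^sub>0) \<odot>\<^bsub>A\<^esub> a)"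
  note 1
  also have "right_unitor K H A ?y = tsum K A unit_obj A ?L ?y"
    by (rule right_unitor_eq[OF y])
  also have "\<dots> = tsum K A H A (\<lambda>a\<^sub>0 h\<^sub>2. tsum K unit_obj H A (\<lambda>x\<^sub>0 x\<^sub>1. tsum K A H A
      (\<lambda>a h\<^sub>1. ?g x\<^sub>0 x\<^sub>1 a h\<^sub>1 h\<^sub>2) (coact A a\<^sub>0)) (coact unit_obj x)) (coact A a)"
    by (simp add: prod_proj_tens)
  also have "\<dots> = tsum K A H A (\<lambda>a\<^sub>0 h\<^sub>2. tsum K H H A (\<lambda>x\<^sub>0 x\<^sub>1. tsum K A H A
      (\<lambda>a h\<^sub>1. ?g x\<^sub>0 x\<^sub>1 a h\<^sub>1 h\<^sub>2) (coact A a\<^sub>0)) (comult H x)) (coact A a)"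
    by (intro tsum_cong refl tsum_comult_unit_comodule[symmetric]) simp_all
  also have "\<dots> = tsum K A H A (\<lambda>a\<^sub>0 h\<^sub>2. tsum K A H A (\<lambda>a h\<^sub>1. tsum K H H A (\<lambda>x\<^sub>0 x\<^sub>1.
      ?g x\<^sub>0 x\<^sub>1 a h\<^sub>1 h\<^sub>2) (comult H x)) (coact A a\<^sub>0)) (coact A a)"
    by (intro tsum_cong refl tsum_swap) simp_all
  also have "\<dots> = tsum K A H A (\<lambda>a h. tsum K H H A (\<lambda>h\<^sub>1 h\<^sub>2. tsum K H H A (\<lambda>x\<^sub>0 x\<^sub>1.
      ?g x\<^sub>0 x\<^sub>1 a h\<^sub>1 h\<^sub>2) (comult H x)) (comult H h)) (coact A a)"
    by (rule coact_coassoc[where \<gamma> = "\<lambda>a h\<^sub>1 h\<^sub>2. tsum K H H A (\<lambda>x\<^sub>0 x\<^sub>1. ?g x\<^sub>0 x\<^sub>1 a h\<^sub>1 h\<^sub>2) (comult H x)"])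
      simp_all
  also have "\<dots> = tsum K A H A (\<lambda>a h. tsum K H H A (\<lambda>k\<^sub>1 k\<^sub>2. counit H k\<^sub>2 \<odot>\<^bsub>A\<^esub> (counit H k\<^sub>1 \<odot>\<^bsub>A\<^esub> a))
      (comult H (h \<otimes>\<^bsub>H\<^esub> x))) (coact A a)"
    by (intro tsum_cong refl comult_mult[symmetric]) simp_all
  also have "\<dots> = ?L a x"
    by (simp add: comult_counit_r[where f = "\<lambda>k. counit H k \<odot>\<^bsub>A\<^esub> _"])
  finally show ?thesis .
qed

lemma mul_one:
  assumes "a \<in> carrier A"
  shows "mul (u \<one>\<^bsub>H\<^esub>) a = a" "mul a (u \<one>\<^bsub>H\<^esub>) = a"
  using coact_counit[OF A _ linear_id assms] assms by (simp_all add: mul_u_l mul_u_r)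

text \<open>The associativity law is used at x = P(P(a \<otimes> b) \<otimes> c), whose associate is
  y, while the other bracketing comes from z = P(a \<otimes> P(b \<otimes> c)). Only the images of y
  and z in A \<otimes> (A \<otimes> A) are compared, and these already determine the values of id
  \<otimes> m.\<close>

lemma mul_assoc:
  assumes [simp]: "a \<in> carrier A" "b \<in> carrier A" "c \<in> carrier A"
  shows "mul (mul a b) c = mul a (mul b c)"
proof -
  define s where "s = PA (tens K A A a b)"
  define r where "r = PA (tens K A A b c)"
  have sr [simp]: "s \<in> carrier prod_AA" "r \<in> carrier prod_AA"
    by (simp_all add: s_def r_def)
  have ms: "m s = mul a b" "m r = mul b c"
    by (simp_all add: s_def r_def mul_def \<mu>_def)
  let ?incl_l = "tensor_map K AA A (\<lambda>x. x) (\<lambda>x. x)"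
  let ?incl_r = "tensor_map K A AA (\<lambda>x. x) (\<lambda>x. x)"
  define x where "x = prod_proj K H prod_AA A (tens K prod_AA A s c)"
  define z where "z = prod_proj K H A prod_AA (tens K A prod_AA a r)"
  have x: "x \<in> carrier (comodule_prod K H prod_AA A)" and z: "z \<in> carrier (comodule_prod K H A prod_AA)"
    unfolding x_def z_def by (rule linear_map_closed[OF prod_proj_retract]; simp)+
  define y where "y = prod_assoc K H A A A x"
  have y: "y \<in> carrier (comodule_prod K H A prod_AA)"
    and "?incl_r y = tensor_assoc K A A A (?incl_l x)"
    unfolding y_def using prod_assoc_props[OF A A A x] by simp_all
  then have incl_y: "?incl_r y = ?incl_r z"
    using assoc_prod_proj_tens[OF A A A assms] by (simp only: x_def z_def s_def r_def)
  have yz [simp]: "y \<in> carrier (tensor K A prod_AA)" "z \<in> carrier (tensor K A prod_AA)"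
    using y z by (simp_all add: carrier_comodule_prod)
  have im: "tensor_map K A A i m w = tsum K A AA AA (\<lambda>a s. tens K A A a (\<mu> s)) (?incl_r w)"
    if "w \<in> carrier (tensor K A prod_AA)" for w
  proof -
    have "tensor_map K A A i m w = tsum K A prod_AA AA (\<lambda>a s. tens K A A a (\<mu> s)) w"
      using that by (intro tensor_map_cong_tsum) (simp_all add: m_eq)
    also have "\<dots> = tsum K A AA AA (\<lambda>a s. tens K A A a (\<mu> s)) (?incl_r w)"
      unfolding tensor_map_eq_tsum[where M = A and N = prod_AA] using that by simp
    finally show ?thesis .
  qed
  note lin_i = colinear_linear[OF i_colinear] and lin_m = colinear_linear[OF m_colinear]
  have "mul (mul a b) c = m (PA (tensor_map K A A m i (tens K prod_AA A s c)))"
    by (simp add: tensor_map_tens[OF _ _ _ _ lin_m lin_i] tensor_map_tens[OF _ _ _ _ lin_i lin_m]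
        ms mul_def[of "mul a b"] \<mu>_def)
  also have "PA (tensor_map K A A m i (tens K prod_AA A s c)) = tensor_map K A A m i x"
    unfolding x_def by (rule prod_proj_natural[OF _ _ _ _ m_colinear i_colinear]) simp_all
  also have "m \<dots> = m (tensor_map K A A i m y)"
    using alg_assoc[OF x] x y by (simp add: prod_map_eq y_def)
  also have "tensor_map K A A i m y = tensor_map K A A i m z"
    unfolding im[OF yz(1)] im[OF yz(2)] incl_y ..
  also have "\<dots> = PA (tensor_map K A A i m (tens K A prod_AA a r))"
    unfolding z_def by (rule prod_proj_natural[symmetric, OF _ _ _ _ i_colinear m_colinear]) simp_all
  also have "m \<dots> = mul a (mul b c)"
    by (simp add: tensor_map_tens[OF _ _ _ _ lin_m lin_i] tensor_map_tens[OF _ _ _ _ lin_i lin_m]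
        ms mul_def[of a "mul b c"] \<mu>_def)
  finally show ?thesis .
qed

lemma comod_alg: "comod_alg K H A mul (u \<one>\<^bsub>H\<^esub>)"
  by (intro comod_alg.intro comod_alg_axioms.intro weak_bialg_axioms)
    (simp_all add: mul_bilinear mul_assoc mul_one coact_mul coact_one)

end

section \<open>The isomorphism\<close>

context
  fixes A :: "('k, 'a, 'h) comodule" and p :: "'a \<Rightarrow> 'a \<Rightarrow> 'a" and q :: 'a
begin

abbreviation "upd \<equiv> A\<lparr>mult := p, one := q\<rparr>"

lemma tensor_upd_l: "tensor K upd N = tensor K A N" "tens K upd N = tens K A N"
  by (rule tensor_record_cong; simp)+

lemma linear_map_upd_dom: "linear_map K upd N f = linear_map K A N f"
  by (simp add: linear_map_def)

lemma linear_map_upd_ran: "linear_map K M upd f = linear_map K M A f"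
  by (simp add: linear_map_def)

lemma module_upd: "module K upd = module K A"
proof
  show "module K upd" if "module K A"
    using that by (rule module_image[where c = "\<lambda>x. x"]) auto
  show "module K A" if "module K upd"
    using that by (rule module_image[where c = "\<lambda>x. x"]) auto
qed

lemma tensor_lift_upd: "tensor_lift K upd \<beta> t = tensor_lift K A \<beta> t"
  by (simp add: tensor_lift_def finsum_def)

lemma right_comodule_upd: "right_comodule K H upd = right_comodule K H A"
  by (simp add: right_comodule_def tensor_map_def tensor_assoc_def Let_def tensor_upd_l
      linear_map_upd_dom linear_map_upd_ran module_upd tensor_lift_upd)

lemma normal_comodule_upd: "normal_comodule K upd = normal_comodule K A"
  by (simp add: normal_comodule_def normal_space_def)

lemma comod_alg_upd: "comod_alg K H upd mul e = comod_alg K H A mul e"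
  by (simp add: comod_alg_def comod_alg_axioms_def bilinear_map_def linear_map_upd_dom linear_map_upd_ran
      right_comodule_upd tsum_def tensor_upd_l)

end

lemma comodule_hom_upd:
  "comodule_hom K H (A\<lparr>mult := p, one := q\<rparr>) (B\<lparr>mult := p', one := q'\<rparr>) = comodule_hom K H A B"
  by (simp add: comodule_hom_def linear_map_upd_dom linear_map_upd_ran tensor_map_def tensor_upd_l)

section \<open>Tensors with second leg in \<open>H_t\<close>\<close>

context weak_bialg
begin

abbreviation "Ht \<equiv> subspace_module K H (H_t K H)"

lemma Ht_carrier: "x \<in> carrier Ht \<longleftrightarrow> x \<in> carrier H \<and> counit_t K H x = x"
  unfolding subspace_module_simps H_t_iff ..

lemma Ht_simps:
  "\<zero>\<^bsub>Ht\<^esub> = \<zero>\<^bsub>H\<^esub>"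
  "\<lbrakk>x \<in> carrier Ht; y \<in> carrier Ht\<rbrakk> \<Longrightarrow> x \<oplus>\<^bsub>Ht\<^esub> y = x \<oplus>\<^bsub>H\<^esub> y"
  "\<lbrakk>a \<in> carrier K; x \<in> carrier Ht\<rbrakk> \<Longrightarrow> a \<odot>\<^bsub>Ht\<^esub> x = a \<odot>\<^bsub>H\<^esub> x"
  by (simp_all only: subspace_module_simps)

lemma counit_t_Ht: "x \<in> carrier H \<Longrightarrow> counit_t K H x \<in> carrier Ht"
  by (simp only: Ht_carrier counit_st_closed counit_t_idem)

lemma Ht_retract: "linear_map K H Ht (counit_t K H)"
  by (rule linear_mapI) (simp_all only: Ht_simps counit_t_Ht linear_map_add[OF counit_t_linear]
      linear_map_smult[OF counit_t_linear])

lemma Ht_incl: "linear_map K Ht H (\<lambda>x. x)"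
  by (rule linear_mapI) (simp_all only: Ht_simps Ht_carrier)

lemma Ht_module: "module K Ht"
proof (rule module_image[where F = H and c = "counit_t K H"])
  show "carrier Ht = counit_t K H ` carrier H"
    unfolding subspace_module_simps H_t_def ..
  show "counit_t K H \<zero>\<^bsub>H\<^esub> = \<zero>\<^bsub>Ht\<^esub>"
    unfolding Ht_simps by (rule linear_map_zero[OF module_H module_H counit_t_linear])
qed (simp_all only: module_H linear_map_add[OF Ht_retract] linear_map_smult[OF Ht_retract])

text \<open>\<open>counit_t\<close> retracts H onto \<open>H_t\<close>, so the image of A \<otimes>
  \<open>H_t\<close> is the fixed space of id \<otimes> \<open>counit_t\<close>. This turns the
  membership condition of \<open>comodule_algebra\<close> into the equation
  \<open>coact_e\<close>.\<close>

lemma image_Ht_iff: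
  assumes [simp]: "module K A" "t \<in> carrier (tensor K A H)"
  shows "t \<in> tensor_map K A H (\<lambda>x. x) (\<lambda>x. x) ` carrier (tensor K A Ht) \<longleftrightarrow>
    tsum K A H (tensor K A H) (\<lambda>a h. tens K A H a (counit_t K H h)) t = t"
proof
  note [simp] = Ht_module linear_comp[OF Ht_retract] linear_comp[OF Ht_incl]
    linear_map_closed[OF Ht_retract] linear_map_closed[OF Ht_incl]
  { assume "t \<in> tensor_map K A H (\<lambda>x. x) (\<lambda>x. x) ` carrier (tensor K A Ht)"
    then obtain y where [simp]: "y \<in> carrier (tensor K A Ht)" and t: "t = tensor_map K A H (\<lambda>x. x) (\<lambda>x. x) y"
      by blast
    have "tsum K A H (tensor K A H) (\<lambda>a h. tens K A H a (counit_t K H h)) t =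
        tsum K A Ht (tensor K A H) (\<lambda>a h. tens K A H a (counit_t K H h)) y"
      unfolding t tensor_map_eq_tsum[where M = A and N = Ht] by simp
    also have "\<dots> = tsum K A Ht (tensor K A H) (\<lambda>a h. tens K A H a h) y"
      by (intro tsum_cong refl) (simp_all add: Ht_carrier)
    also have "\<dots> = t"
      unfolding t by (rule tensor_map_eq_tsum[symmetric])
    finally show "tsum K A H (tensor K A H) (\<lambda>a h. tens K A H a (counit_t K H h)) t = t" . }
  assume *: "tsum K A H (tensor K A H) (\<lambda>a h. tens K A H a (counit_t K H h)) t = t"
  let ?y = "tsum K A H (tensor K A Ht) (\<lambda>a h. tens K A Ht a (counit_t K H h)) t"
  have "t = tensor_map K A H (\<lambda>x. x) (\<lambda>x. x) ?y"
    unfolding tensor_map_eq_tsum[where M = A and N = Ht] by (simp add: *)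
  moreover have "?y \<in> carrier (tensor K A Ht)"
    by simp
  ultimately show "t \<in> tensor_map K A H (\<lambda>x. x) (\<lambda>x. x) ` carrier (tensor K A Ht)"
    by (rule image_eqI)
qed

lemma comodule_algebra_comod_alg:
  assumes "comodule_algebra K H A"
  shows "comod_alg K H A (mult A) \<one>\<^bsub>A\<^esub>"
proof -
  interpret A: k_algebra K A
    using assms by (simp add: comodule_algebra_def)
  have rc [simp]: "right_comodule K H A"
    and coact_mult: "\<And>a b. \<lbrakk>a \<in> carrier A; b \<in> carrier A\<rbrakk> \<Longrightarrow>
      coact A (a \<otimes>\<^bsub>A\<^esub> b) = coact A a \<otimes>\<^bsub>tensor_algebra K A H\<^esub> coact A b"
    and "coact A \<one>\<^bsub>A\<^esub> \<in> tensor_map K A H (\<lambda>x. x) (\<lambda>x. x) ` carrier (tensor K A Ht)"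
    using assms by (simp_all add: comodule_algebra_def)
  then have one: "tsum K A H (tensor K A H) (\<lambda>a h. tens K A H a (counit_t K H h)) (coact A \<one>\<^bsub>A\<^esub>) = coact A \<one>\<^bsub>A\<^esub>"
    using image_Ht_iff[of A "coact A \<one>\<^bsub>A\<^esub>"] by simp
  have "bilinear_map K A A A (mult A)"
    by (intro bilinear_mapI linear_mult_l linear_mult_r linear_id A.k_algebra_axioms)
  then show ?thesis
    using one
    by (intro comod_alg.intro comod_alg_axioms.intro weak_bialg_axioms)
      (simp_all add: coact_mult tensor_algebra_mult_eq_tsum A.m_assoc)
qed

end

text \<open>The product recovered from m is an unrestricted function, whereas objects carry
  restricted ones. The axioms involve its values on the carrier only.\<close>

lemma comod_alg_cong:
  assumes "comod_alg K H A mul e"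
    and eq: "\<And>a b. \<lbrakk>a \<in> carrier A; b \<in> carrier A\<rbrakk> \<Longrightarrow> mul' a b = mul a b"
  shows "comod_alg K H A mul' e"
proof -
  interpret comod_alg K H A mul e by fact
  have "bilinear_map K A A A mul'"
  proof (rule bilinear_mapI)
    show "linear_map K A A (\<lambda>a. mul' a b)" if "b \<in> carrier A" for b
      using that by (intro linear_map_cong[OF bilinear_map_linear(1)[OF mul_bilinear that]]) (simp_all add: eq)
    show "linear_map K A A (\<lambda>b. mul' a b)" if "a \<in> carrier A" for a
      using that by (intro linear_map_cong[OF bilinear_map_linear(2)[OF mul_bilinear that]]) (simp_all add: eq)
  qed
  moreover have "coact A (mul' a b) = tsum K A H (tensor K A H) (\<lambda>a\<^sub>0 a\<^sub>1. tsum K A H (tensor K A H)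
      (\<lambda>b\<^sub>0 b\<^sub>1. tens K A H (mul' a\<^sub>0 b\<^sub>0) (a\<^sub>1 \<otimes>\<^bsub>H\<^esub> b\<^sub>1)) (coact A b)) (coact A a)"
    if [simp]: "a \<in> carrier A" "b \<in> carrier A" for a b
    unfolding eq[OF that] coact_mul[OF that] by (intro tsum_cong refl) (simp_all add: eq)
  ultimately show ?thesis
    by (intro comod_alg.intro comod_alg_axioms.intro weak_bialg_axioms)
      (simp_all add: eq mul_assoc mul_one coact_e)
qed

section \<open>Each construction undoes the other\<close>

lemma (in comod_alg) m_prod_proj_tens:
  "\<lbrakk>a \<in> carrier A; b \<in> carrier A\<rbrakk> \<Longrightarrow> m (PA (tens K A A a b)) = mul a b"
  by (simp add: m_eq \<mu>_prod_proj)

lemma (in comod_alg) u_one: "u \<one>\<^bsub>H\<^esub> = e"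
  using coact_counit[OF A _ linear_id e_closed] by (simp add: u_def one_H_s u'_def)

lemma (in comod_alg) comodule_algebra:
  "comodule_algebra K H (A\<lparr>mult := \<lambda>a\<in>carrier A. \<lambda>b\<in>carrier A. mul a b, one := e\<rparr>)" (is "comodule_algebra K H ?B")
proof -
  interpret A: module K A by simp
  note lin = bilinear_map_linear[OF mul_bilinear]
  have mB: "module K ?B"
    using A.module_axioms by (simp add: module_upd)
  have "monoid ?B"
    by (rule monoidI) (simp_all add: mul_assoc mul_one)
  moreover have "abelian_group ?B"
    using mB by (rule module.axioms)
  ultimately have "ring ?B"
    by (intro ringI) (simp_all add: linear_map_add[OF lin(1)] linear_map_add[OF lin(2)])
  then have "k_algebra K ?B"
    using mB by (intro k_algebra.intro k_algebra_axioms.intro) (simp_all add: smult_mul)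
  moreover have "coact A (mul a b) = coact A a \<otimes>\<^bsub>tensor_algebra K ?B H\<^esub> coact A b"
    if [simp]: "a \<in> carrier A" "b \<in> carrier A" for a b
  proof -
    have "coact A a \<otimes>\<^bsub>tensor_algebra K ?B H\<^esub> coact A b =
      tsum K A H (tensor K A H) (\<lambda>c h. tsum K A H (tensor K A H)
       (\<lambda>c' h'. tens K A H (c \<otimes>\<^bsub>?B\<^esub> c') (h \<otimes>\<^bsub>H\<^esub> h')) (coact A b)) (coact A a)"
      unfolding tensor_algebra_mult_eq_tsum tensor_upd_l tsum_def ..
    also have "\<dots> = coact A (mul a b)"
      unfolding coact_mul[OF that] by (intro tsum_cong refl) simp_all
    finally show ?thesis by simp
  qed
  moreover have "coact A e \<in> tensor_map K A H (\<lambda>x. x) (\<lambda>x. x) ` carrier (tensor K A Ht)"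
    using coact_e by (simp add: image_Ht_iff)
  ultimately show ?thesis
    by (simp add: comodule_algebra_def right_comodule_upd tensor_map_def tensor_upd_l)
qed

thm comod_alg.m_def comod_alg.u_def alg_comod.mul_def comod_alg.u'_def comod_alg.\<mu>_def alg_comod.\<mu>_def

text \<open>On an element s of the monoidal product both functions give \<mu>(s), as s is the sum of
  its own pure tensors; elsewhere both are \<open>undefined\<close>.\<close>

lemma (in alg_comod) comod_alg_m: "comod_alg.m K H A (\<lambda>a\<in>carrier A. \<lambda>b\<in>carrier A. mul a b) = m"
proof (rule extensionalityI)
  let ?mul = "\<lambda>a\<in>carrier A. \<lambda>b\<in>carrier A. mul a b"
  interpret M: comod_alg K H A ?mul "u \<one>\<^bsub>H\<^esub>"
    by (rule comod_alg_cong[OF comod_alg]) simp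
  show "comod_alg.m K H A ?mul \<in> extensional (carrier prod_AA)"
    by (simp add: M.m_def)
  show "m \<in> extensional (carrier prod_AA)"
    by (rule m_ext)
  fix s assume s: "s \<in> carrier prod_AA"
  then have [simp]: "s \<in> carrier AA" by simp
  have "comod_alg.m K H A ?mul s = tsum K A A A ?mul s"
    using s by (simp add: M.m_eq M.\<mu>_def)
  also have "\<dots> = tsum K A A A (\<lambda>a b. \<mu> (tens K A A a b)) s"
    by (intro tsum_cong) (simp_all add: mul_def)
  also have "\<dots> = \<mu> (tsum K A A AA (\<lambda>a b. tens K A A a b) s)"
    by (rule linear_tsum[symmetric, OF _ _ _ _ _ \<mu>_linear]) simp_all
  finally show "comod_alg.m K H A ?mul s = m s"
    using s by (simp add: tsum_tens_id m_eq)
qed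

text \<open>The recovered unit morphism sends x to \<epsilon>(x 1_1) 1_0, where 1 is the unit
  element of A. By \<open>mul_u_l\<close> this is the product of u(x) with that unit
  element.\<close>

lemma (in alg_comod) comod_alg_u: "comod_alg.u K H A (u \<one>\<^bsub>H\<^esub>) = u"
proof (rule extensionalityI)
  interpret M: comod_alg K H A mul "u \<one>\<^bsub>H\<^esub>"
    by (rule comod_alg)
  show "M.u \<in> extensional (carrier unit_obj)"
    by (simp add: M.u_def carrier_unit_comodule)
  show "u \<in> extensional (carrier unit_obj)"
    by (rule u_ext)
  fix x assume x: "x \<in> carrier unit_obj"
  have "M.u x = mul (u x) (u \<one>\<^bsub>H\<^esub>)"
    using x by (simp add: M.u_eq M.u'_def mul_u_l)
  then show "M.u x = u x"
    using x by (simp add: mul_one)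
qed

lemma (in alg_comod) u_eq_coact:
  "x \<in> carrier unit_obj \<Longrightarrow>
   u x = tsum K A H A (\<lambda>a h. counit H (x \<otimes>\<^bsub>H\<^esub> h) \<odot>\<^bsub>A\<^esub> a) (coact A (u \<one>\<^bsub>H\<^esub>))"
  using mul_u_l[of x "u \<one>\<^bsub>H\<^esub>"] by (simp add: mul_one)

text \<open>For the products, naturality of P and linearity pass between pure tensors and the
  monoidal product. For the units, u(x) = \<epsilon>(x 1_1) 1_0 is determined by the coaction of the
  unit element, which a colinear f respects; so preserving that single element is enough.\<close>

lemma alg_hom_iff:
  assumes "alg_comod K H A m u" and "alg_comod K H B m' u'" and f: "f \<in> comodule_hom K H A B"
  shows "((\<forall>x\<in>carrier (comodule_prod K H A A). f (m x) = m' (prod_map K H A A B B f f x)) \<and>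
      (\<forall>x\<in>H_s K H. f (u x) = u' x)) \<longleftrightarrow>
    (\<forall>a\<in>carrier A. \<forall>b\<in>carrier A. f (alg_comod.mul K H A m a b) = alg_comod.mul K H B m' (f a) (f b)) \<and>
      f (u \<one>\<^bsub>H\<^esub>) = u' \<one>\<^bsub>H\<^esub>"
proof -
  interpret A: alg_comod K H A m u by fact
  interpret B: alg_comod K H B m' u' by fact
  have col: "A.colinear A B f"
    using f by (simp add: A.comodule_hom_iff)
  note lf = A.colinear_linear[OF col]
  note [simp] = linear_comp[OF lf] linear_map_closed[OF lf]
  have ff: "tensor_map K B B f f x \<in> carrier B.prod_AA"
    "m' (prod_map K H A A B B f f x) = B.\<mu> (tensor_map K B B f f x)" if "x \<in> carrier A.prod_AA" for x
    using A.tensor_map_comodule_prod[OF A.A A.A B.A B.A col col that] that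
    by (simp_all add: A.prod_map_eq B.m_eq)
  have tens: "tensor_map K B B f f (tens K A A a b) = tens K B B (f a) (f b)"
    if "a \<in> carrier A" "b \<in> carrier A" for a b
    using that lf by (simp add: tensor_map_tens)
  show ?thesis
  proof (intro iffI conjI ballI)
    fix a b assume *: "(\<forall>x\<in>carrier A.prod_AA. f (m x) = m' (prod_map K H A A B B f f x)) \<and> (\<forall>x\<in>H_s K H. f (u x) = u' x)"
      and ab [simp]: "a \<in> carrier A" "b \<in> carrier A"
    have "f (A.mul a b) = m' (prod_map K H A A B B f f (A.PA (tens K A A a b)))"
      using * by (simp add: A.mul_def A.\<mu>_def)
    also have "\<dots> = m' (tensor_map K B B f f (A.PA (tens K A A a b)))"
      by (simp add: A.prod_map_eq)
    also have "tensor_map K B B f f (A.PA (tens K A A a b)) = B.PA (tensor_map K B B f f (tens K A A a b))"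
      by (rule A.prod_proj_natural[symmetric, OF A.A A.A B.A B.A col col]) simp
    finally show "f (A.mul a b) = B.mul (f a) (f b)"
      by (simp add: tens B.mul_def B.\<mu>_def)
  next
    assume "(\<forall>x\<in>carrier A.prod_AA. f (m x) = m' (prod_map K H A A B B f f x)) \<and> (\<forall>x\<in>H_s K H. f (u x) = u' x)"
    then show "f (u \<one>\<^bsub>H\<^esub>) = u' \<one>\<^bsub>H\<^esub>"
      using A.one_H_s by blast
  next
    assume *: "(\<forall>a\<in>carrier A. \<forall>b\<in>carrier A. f (A.mul a b) = B.mul (f a) (f b)) \<and> f (u \<one>\<^bsub>H\<^esub>) = u' \<one>\<^bsub>H\<^esub>"
    { fix x assume x: "x \<in> carrier A.prod_AA"
      then have xA: "x \<in> carrier (tensor K A A)" by simp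
      have "f (A.\<mu> x) = B.\<mu> (tsum K A A (tensor K B B) (\<lambda>a b. tens K B B (f a) (f b)) x)"
      proof (rule tensor_ext[OF _ _ _ _ _ _ xA, where P = B])
        fix a b assume "a \<in> carrier A" "b \<in> carrier A"
        then show "f (A.\<mu> (tens K A A a b)) =
            B.\<mu> (tsum K A A (tensor K B B) (\<lambda>a b. tens K B B (f a) (f b)) (tens K A A a b))"
          using * by (simp add: A.mul_def B.mul_def)
      qed simp_all
      then show "f (m x) = m' (prod_map K H A A B B f f x)"
        using x ff(2)[OF x] by (simp add: A.m_eq tensor_map_eq_tsum[where M = A and N = A]) }
    { fix x assume "x \<in> H_s K H"
      then have x [simp]: "x \<in> carrier A.unit_obj"
        by (simp add: A.carrier_unit_comodule)
      have "f (u x) = tsum K A H B (\<lambda>a h. f (counit H (x \<otimes>\<^bsub>H\<^esub> h) \<odot>\<^bsub>A\<^esub> a)) (coact A (u \<one>\<^bsub>H\<^esub>))"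
        unfolding A.u_eq_coact[OF x] by (rule linear_tsum[OF _ _ _ _ _ lf]) simp_all
      also have "\<dots> = tsum K A H B (\<lambda>a h. counit H (x \<otimes>\<^bsub>H\<^esub> h) \<odot>\<^bsub>B\<^esub> f a) (coact A (u \<one>\<^bsub>H\<^esub>))"
        by (simp add: linear_map_smult[OF lf])
      also have "\<dots> = tsum K B H B (\<lambda>a h. counit H (x \<otimes>\<^bsub>H\<^esub> h) \<odot>\<^bsub>B\<^esub> a) (coact B (f (u \<one>\<^bsub>H\<^esub>)))"
        by (rule A.tsum_colinear[OF _ _ col, symmetric]) simp_all
      also have "\<dots> = u' x"
        using * B.u_eq_coact[OF x] by simp
      finally show "f (u x) = u' x" . }
  qed
qed

text \<open>G is a bijection on objects, and all other data of D are those of C read along G. Hence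
  the axioms for D are axioms for C at the objects \<open>G X\<close>, and both functors can act as
  the identity on morphisms.\<close>

lemma isomorphic_categoriesI:
  assumes C: "category C"
    and G: "\<And>X. X \<in> Obj D \<Longrightarrow> G X \<in> Obj C" and F: "\<And>A. A \<in> Obj C \<Longrightarrow> F A \<in> Obj D"
    and GF: "\<And>A. A \<in> Obj C \<Longrightarrow> G (F A) = A" and FG: "\<And>X. X \<in> Obj D \<Longrightarrow> F (G X) = X"
    and Hom: "\<And>X Y. \<lbrakk>X \<in> Obj D; Y \<in> Obj D\<rbrakk> \<Longrightarrow> Hom D X Y = Hom C (G X) (G Y)"
    and Ident: "\<And>X. X \<in> Obj D \<Longrightarrow> Ident D X = Ident C (G X)"
    and Comp: "\<And>X Y Z g f. \<lbrakk>X \<in> Obj D; Y \<in> Obj D; Z \<in> Obj D\<rbrakk>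
      \<Longrightarrow> Comp D X Y Z g f = Comp C (G X) (G Y) (G Z) g f"
  shows "isomorphic_categories C D"
  unfolding isomorphic_categories_def
proof (intro conjI exI)
  show "category C" by fact
  show "category D"
    using C unfolding category_def by (simp add: Hom Ident Comp G)
  show "is_functor C D F (\<lambda>_ _ f. f)" "is_functor D C G (\<lambda>_ _ f. f)"
    unfolding is_functor_def by (simp_all add: Hom Ident Comp G F GF)
qed (simp_all add: GF FG)

section \<open>Identities and composites of morphisms\<close>

lemma comodule_hom_id:
  "weak_bialgebra K H \<Longrightarrow> right_comodule K H A \<Longrightarrow> (\<lambda>x\<in>carrier A. x) \<in> comodule_hom K H A A"
proof -
  assume "weak_bialgebra K H" and A: "right_comodule K H A"
  then interpret weak_bialg K H by unfold_locales
  show ?thesis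
    using colinear_restrict_id[OF A] by (simp add: comodule_hom_iff)
qed

lemma comodule_hom_compose:
  assumes "weak_bialgebra K H" "right_comodule K H A" "right_comodule K H B" "right_comodule K H C"
    and "f \<in> comodule_hom K H A B" "g \<in> comodule_hom K H B C"
  shows "compose (carrier A) g f \<in> comodule_hom K H A C"
proof -
  interpret weak_bialg K H by unfold_locales fact
  have f: "colinear A B f" and g: "colinear B C g"
    using assms(5,6) by (simp_all add: comodule_hom_iff)
  note lf = colinear_linear[OF f] and lg = colinear_linear[OF g]
  note [simp] = assms(2-4) linear_map_closed[OF lf] linear_map_closed[OF lg]
    linear_comp[OF lf] linear_comp[OF lg]
  have "colinear A C (compose (carrier A) g f)"
  proof (rule colinearI)
    have "linear_map K A C (\<lambda>x. g (f x))"
      by simp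
    then show "linear_map K A C (compose (carrier A) g f)"
      by (rule linear_map_cong) (simp_all add: compose_eq)
    fix a assume [simp]: "a \<in> carrier A"
    have "coact C (g (f a)) = tsum K B H (tensor K C H) (\<lambda>b h. tens K C H (g b) h) (coact B (f a))"
      by (rule colinear_coact[OF g]) simp
    also have "\<dots> = tsum K A H (tensor K C H) (\<lambda>a h. tens K C H (g (f a)) h) (coact A a)"
      by (rule tsum_colinear[OF _ _ f]) simp_all
    also have "\<dots> = tsum K A H (tensor K C H) (\<lambda>a h. tens K C H (compose (carrier A) g f a) h) (coact A a)"
      by (intro tsum_cong refl) (simp_all add: compose_eq)
    finally show "coact C (compose (carrier A) g f a) =
        tsum K A H (tensor K C H) (\<lambda>a h. tens K C H (compose (carrier A) g f a) h) (coact A a)"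
      by (simp add: compose_eq)
  qed
  then show ?thesis
    by (simp add: comodule_hom_iff)
qed

lemma category_comodule_algebra_cat:
  assumes H: "weak_bialgebra K H"
  shows "category (comodule_algebra_cat K H)"
proof -
  have id: "(\<lambda>x\<in>carrier A. x) \<in> comodule_hom K H A A \<inter> ring_hom A A" if "comodule_algebra K H A" for A
  proof -
    interpret k_algebra K A
      using that by (simp add: comodule_algebra_def)
    show ?thesis
      using comodule_hom_id[OF H] that by (auto simp: comodule_algebra_def ring_hom_def)
  qed
  have comp: "compose (carrier A) g f \<in> comodule_hom K H A C \<inter> ring_hom A C"
    if A: "comodule_algebra K H A" "comodule_algebra K H B" "comodule_algebra K H C"
      and f: "f \<in> comodule_hom K H A B \<inter> ring_hom A B" and g: "g \<in> comodule_hom K H B C \<inter> ring_hom B C"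
    for A B C f g
  proof -
    interpret k_algebra K A
      using A by (simp add: comodule_algebra_def)
    have "compose (carrier A) g f \<in> comodule_hom K H A C"
      using A f g by (intro comodule_hom_compose[OF H]) (auto simp: comodule_algebra_def)
    moreover have "compose (carrier A) g f \<in> ring_hom A C"
      using f g by (auto simp: ring_hom_def compose_eq Pi_iff)
    ultimately show ?thesis by simp
  qed
  have ext: "f \<in> extensional (carrier A)" "f \<in> carrier A \<rightarrow> carrier B" if "f \<in> comodule_hom K H A B" for f A B
    using that by (auto simp: comodule_hom_def linear_map_def)
  note id' = id[THEN IntD1] id[THEN IntD2]
    and comp' = comp[THEN IntD1, OF _ _ _ IntI IntI] comp[THEN IntD2, OF _ _ _ IntI IntI]
  show ?thesis
    unfolding category_def comodule_algebra_cat_def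
    by (auto intro: id' comp' compose_Id[OF ext(2,1)] compose_assoc[OF ext(2), symmetric]
        simp: ext Id_compose)
qed

theorem theorem1p2:
  fixes K :: "('k, 'z) ring_scheme" and H :: "('k, 'h, 'w) bialgebra_scheme"
  assumes "field K" and "weak_bialgebra K H"
  shows "isomorphic_categories
           (comodule_algebra_cat K H :: (('k, 'a, 'h) comodule, 'a \<Rightarrow> 'a) cat)
           (alg_comodule_cat K H ::
              (('k, 'a, 'h) comodule \<times> (('a \<times> 'a \<Rightarrow> 'k) set \<Rightarrow> 'a) \<times> ('h \<Rightarrow> 'a), 'a \<Rightarrow> 'a) cat)"
    (is "isomorphic_categories ?C ?D")
proof -
  interpret weak_bialg K H
    using assms(2) by unfold_locales
  \<comment> \<open>The restriction makes the product extensional, as required of objects of the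
    category of comodule algebras.\<close>
  define prodm where "prodm A m = (\<lambda>a\<in>carrier A. \<lambda>b\<in>carrier A. alg_comod.mul K H A m a b)"
    for A :: "('k, 'a, 'h) comodule" and m
  define G where "G = (\<lambda>(A :: ('k, 'a, 'h) comodule, m, u). A\<lparr>mult := prodm A m, one := u \<one>\<^bsub>H\<^esub>\<rparr>)"
  \<comment> \<open>Comodules in the other category have both fields undefined; erasing them is what
    makes the two object maps inverse to each other on the nose.\<close>
  define U where "U A = A\<lparr>mult := undefined, one := undefined\<rparr>" for A :: "('k, 'a, 'h) comodule"
  define F where "F A = (U A, comod_alg.m K H (U A) (mult A), comod_alg.u K H (U A) \<one>\<^bsub>A\<^esub>)" for A
  have D: "alg_comod K H A m u" if "(A, m, u) \<in> Obj ?D" for A m u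
    using that by (auto simp: alg_comodule_cat_def intro: alg_comod.intro weak_bialg_axioms alg_comod_axioms.intro)
  have C: "comod_alg K H (U A) (mult A) \<one>\<^bsub>A\<^esub>" if "A \<in> Obj ?C" for A
    using that comodule_algebra_comod_alg[of A]
    by (simp add: comodule_algebra_cat_def U_def comod_alg_upd)
  show ?thesis
  proof (rule isomorphic_categoriesI[where F = F and G = G])
    show "category ?C"
      using assms(2) by (rule category_comodule_algebra_cat)
  next
    fix X assume "X \<in> Obj ?D"
    moreover obtain A m u where X: "X = (A, m, u)"
      by (cases X)
    ultimately have *: "(A, m, u) \<in> Obj ?D" by simp
    interpret alg_comod K H A m u
      by (rule D[OF *])
    have A: "normal_comodule K A" "mult A = undefined" "\<one>\<^bsub>A\<^esub> = undefined"
      using alg by (simp_all add: algebra_in_comodules_def Let_def comodules_def)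
    show "G X \<in> Obj ?C"
      using comod_alg.comodule_algebra[OF comod_alg] A(1)
      by (auto simp: X G_def prodm_def comodule_algebra_cat_def normal_comodule_upd)
    \<comment> \<open>Erasing the new fields restores A itself, since its own \<open>mult\<close>
      and \<open>one\<close> are undefined.\<close>
    have "U (A\<lparr>mult := p, one := q\<rparr>) = A" for p q
      using A(2,3) by (cases A) (simp add: U_def)
    then show "F (G X) = X"
      by (simp add: X G_def F_def prodm_def comod_alg_m comod_alg_u)
    show "Ident ?D X = Ident ?C (G X)"
      by (simp add: X G_def alg_comodule_cat_def comodule_algebra_cat_def)
  next
    fix A assume obj: "A \<in> Obj ?C"
    interpret comod_alg K H "U A" "mult A" "\<one>\<^bsub>A\<^esub>"
      by (rule C[OF obj])
    have "normal_comodule K A" and mult_ext: "mult A \<in> carrier A \<rightarrow>\<^sub>E carrier A \<rightarrow>\<^sub>E carrier A"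
      using obj by (simp_all add: comodule_algebra_cat_def)
    then have "U A \<in> comodules K H"
      using comod_alg.A[OF C[OF obj]] by (simp add: comodules_def U_def normal_comodule_upd)
    then have alg: "algebra_in_comodules K H (U A) m u"
      by (rule algebra_in_comodules)
    then show "F A \<in> Obj ?D"
      by (simp add: F_def alg_comodule_cat_def)
    interpret B: alg_comod K H "U A" m u
      using alg by (intro alg_comod.intro alg_comod_axioms.intro weak_bialg_axioms)
    have [simp]: "carrier (U A) = carrier A"
      by (simp add: U_def)
    \<comment> \<open>Equality is needed at all arguments: on the carrier it is
      \<open>m_prod_proj_tens\<close>, elsewhere both sides are undefined by extensionality.\<close>
    have "prodm (U A) m = mult A"
    proof (intro ext)
      fix a b
      show "prodm (U A) m a b = a \<otimes>\<^bsub>A\<^esub> b"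
        using mult_ext m_prod_proj_tens[of a b]
        by (cases "a \<in> carrier A"; cases "b \<in> carrier A")
          (auto simp: prodm_def B.mul_def B.\<mu>_def PiE_iff extensional_def)
    qed
    then show "G (F A) = A"
      by (simp add: G_def F_def u_one) (simp add: U_def)
  next
    fix X Y assume "X \<in> Obj ?D" "Y \<in> Obj ?D"
    moreover obtain A m u B m' u' where XY: "X = (A, m, u)" "Y = (B, m', u')"
      by (metis prod_cases3)
    ultimately have A: "alg_comod K H A m u" and B: "alg_comod K H B m' u'"
      using D by simp_all
    \<comment> \<open>Linearity already gives the closure and additivity parts of
      \<open>ring_hom\<close>, so product and unit remain.\<close>
    have ring_hom: "f \<in> ring_hom (G X) (G Y) \<longleftrightarrow>
      (\<forall>a\<in>carrier A. \<forall>b\<in>carrier A. f (alg_comod.mul K H A m a b) = alg_comod.mul K H B m' (f a) (f b)) \<and>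
        f (u \<one>\<^bsub>H\<^esub>) = u' \<one>\<^bsub>H\<^esub>" if "f \<in> comodule_hom K H A B" for f
    proof -
      have "f \<in> carrier A \<rightarrow> carrier B" and "\<forall>x\<in>carrier A. \<forall>y\<in>carrier A. f (x \<oplus>\<^bsub>A\<^esub> y) = f x \<oplus>\<^bsub>B\<^esub> f y"
        using that by (simp_all add: comodule_hom_def linear_map_def)
      then show ?thesis
        by (auto simp: ring_hom_def XY G_def prodm_def Pi_iff)
    qed
    show "Hom ?D X Y = Hom ?C (G X) (G Y)"
    proof (rule Set.set_eqI)
      fix f
      have "f \<in> Hom ?C (G X) (G Y) \<longleftrightarrow> f \<in> comodule_hom K H A B \<and> f \<in> ring_hom (G X) (G Y)"
        by (simp add: comodule_algebra_cat_def XY G_def comodule_hom_upd)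
      then show "f \<in> Hom ?D X Y \<longleftrightarrow> f \<in> Hom ?C (G X) (G Y)"
        using ring_hom[of f] alg_hom_iff[OF A B, of f] by (auto simp: alg_comodule_cat_def XY)
    qed
  next
    fix X Y Z g f assume "X \<in> Obj ?D" "Y \<in> Obj ?D" "Z \<in> Obj ?D"
    show "Comp ?D X Y Z g f = Comp ?C (G X) (G Y) (G Z) g f"
      by (cases X) (simp add: alg_comodule_cat_def comodule_algebra_cat_def G_def)
  qed
qed

end
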